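(* Let $s\in(0,\tfrac12)$. There exists $\delta>0$ such that the following holds. Let $i\varkappa^2\in\mathbb{R}\setminus(-1,1)$ and let $q\in C^1(I;\mathscr{S}(\mathbb{R}))$ ($I$ an interval), with $\|q(t)\|_{H^s}\le\delta$ for $t\in I$, evolve under the derivative nonlinear Schrödinger (DNLS) flow $i\partial_tq+\partial_x^2q+i\partial_x(|q|^2q)=0$; put $r=-\bar q$. Then $$\frac{d}{dt}q=iq''+(q^2r)',\qquad \frac{d}{dt}r=-ir''+(qr^2)',$$ and $$\frac{d}{dt}g_{12}(\varkappa)=-2(2i\varkappa^4+i\varkappa^2qr)g_{12}(\varkappa)-(2\varkappa^3q+i\varkappa q'+\varkappa q^2r)(\gamma(\varkappa)+1),$$ $$\frac{d}{dt}g_{21}(\varkappa)=2(2i\varkappa^4+i\varkappa^2qr)g_{21}(\varkappa)+(2\varkappa^3r-i\varkappa r'+\varkappa qr^2)(\gamma(\varkappa)+1),$$ $$\frac{d}{dt}\gamma(\varkappa)=2\varkappa^2\gamma'(\varkappa)+2i\varkappa\,(q'g_{21}(\varkappa)+r'g_{12}(\varkappa))+qr\,\gamma'(\varkappa).$$ Moreover, the microscopic conservation law $$\partial_t\rho(\varkappa)+\partial_xj_{\mathrm{DNLS}}(\varkappa)=0$$ holds, with $$\rho(\varkappa)=-\varkappa\frac{q\,g_{21}(\varkappa)+r\,g_{12}(\varkappa)}{2+\gamma(\varkappa)},\qquad j_{\mathrm{DNLS}}(\varkappa)=i\varkappa\frac{q'g_{21}(\varkappa)-r'g_{12}(\vark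appa)}{2+\gamma(\varkappa)}-i\varkappa^2qr-2\varkappa^2\rho(\varkappa)-qr\,\rho(\varkappa).$$
   Context: Primes denote $\partial_x$. Norm: $\|f\|_{H^s}^2=\int(4+\xi^2)^s|\hat f(\xi)|^2d\xi$ with unitary Fourier transform. For $\kappa\in\mathbb{C}$ with $i\kappa^2\in\mathbb{R}$, $|\kappa|\ge1$, and $r=-\bar q$, let $$L(\kappa)=\begin{bmatrix}\partial+i\kappa^2&-\kappa q\\-\kappa r&\partial-i\kappa^2\end{bmatrix},\qquad L_0(\kappa)=\begin{bmatrix}\partial+i\kappa^2&0\\0&\partial-i\kappa^2\end{bmatrix}$$ on $L^2(\mathbb{R};\mathbb{C}^2)$. For $q$ sufficiently small, $L(\kappa)$ is invertible; $G(x,y;\kappa)$, $G_0(x,y;\kappa)$ are the $2\times2$ matrix integral kernels of $L(\kappa)^{-1}$, $L_0(\kappa)^{-1}$, and $G-G_0$ is continuous in $(x,y)$. Define $$\gamma(x;\kappa)=\mathrm{sgn}(i\kappa^2)[G_{11}(x,x;\kappa)-G_{22}(x,x;\kappa)]-1,$$ $$g_{12}(x;\kappa)=\mathrm{sgn}(i\kappa^2)G_{12}(x,x;\kappa),\quad g_{21}(x;\kappa)=\mathrm{sgn}(i\kappa^2)G_{21}(x,x;\kappa),$$ where on the diagonal $G_0$ contributes $\mathrm{sgn}(i\kappa^2)$ to $G_{11}-G_{22}$, i.e. $\gamma=\mathrm{sgn}(i\kappa^2)[(G-G_0)_{11}-(G-G_0)_{22}](x,x;\kappa)$. All quantities are computed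 at each time from $q(t)$, $r(t)$. *)

theory Defs
  imports "HOL-Analysis.Analysis"
begin

section \<open>Derivatives, Schwartz space, Sobolev norm\<close>

definition dx :: "(real \<Rightarrow> complex) \<Rightarrow> real \<Rightarrow> complex" where
  "dx f x = vector_derivative f (at x)"

definition schwartz :: "(real \<Rightarrow> complex) \<Rightarrow> bool" where
  "schwartz f \<longleftrightarrow>
     (\<forall>n x. (dx ^^ n) f differentiable (at x)) \<and>
     (\<forall>m n. bdd_above (range (\<lambda>x. \<bar>x\<bar> ^ m * cmod ((dx ^^ n) f x))))"

definition schwartz_seminorm :: "nat \<Rightarrow> nat \<Rightarrow> (real \<Rightarrow> complex) \<Rightarrow> real" where
  "schwartz_seminorm m n f = (SUP x. \<bar>x\<bar> ^ m * cmod ((dx ^^ n) f x))"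

text \<open>
  Membership in \<open>C\<^sup>1(I; S)\<close> for the Frechet topology of the Schwartz space \<open>S\<close>: the
  difference quotients converge in every seminorm (one-sidedly at endpoints of \<open>I\<close> that
  belong to \<open>I\<close>), and the derivative \<open>p\<close> is a continuous \<open>S\<close>-valued map.
\<close>
definition C1_schwartz :: "real set \<Rightarrow> (real \<Rightarrow> real \<Rightarrow> complex) \<Rightarrow> bool" where
  "C1_schwartz I q \<longleftrightarrow>
     (\<forall>t\<in>I. schwartz (q t)) \<and>
     (\<exists>p. (\<forall>t\<in>I. schwartz (p t)) \<and>
       (\<forall>t\<in>I. \<forall>m n.
          ((\<lambda>\<tau>. schwartz_seminorm m n (\<lambda>x. (q \<tau> x - q t x) /\<^sub>R (\<tau> - t) - p t x))
             \<longlongrightarrow> 0) (at t within I)) \<and>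
       (\<forall>t\<in>I. \<forall>m n.
          ((\<lambda>\<tau>. schwartz_seminorm m n (\<lambda>x. p \<tau> x - p t x)) \<longlongrightarrow> 0) (at t within I)))"

definition fourier :: "(real \<Rightarrow> complex) \<Rightarrow> real \<Rightarrow> complex" where
  "fourier f \<xi> =
     (LINT x|lborel. exp (- \<i> * of_real (\<xi> * x)) * f x) / of_real (sqrt (2 * pi))"

definition Hs_norm :: "real \<Rightarrow> (real \<Rightarrow> complex) \<Rightarrow> real" where
  "Hs_norm s f = sqrt (LINT \<xi>|lborel. (4 + \<xi>\<^sup>2) powr s * (cmod (fourier f \<xi>))\<^sup>2)"

section \<open>The operator \<open>L(\<kappa>)\<close> and its Green's function\<close>

definition rfun :: "(real \<Rightarrow> complex) \<Rightarrow> real \<Rightarrow> complex" where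
  "rfun q x = - cnj (q x)"

definition L2 :: "(real \<Rightarrow> complex ^ 2) \<Rightarrow> bool" where
  "L2 f \<longleftrightarrow> f \<in> borel_measurable lborel \<and> integrable lborel (\<lambda>x. (norm (f x))\<^sup>2)"

text \<open>\<open>u\<close> is the absolutely continuous representative of an \<open>H\<^sup>1\<close> function and \<open>v\<close> is its
  derivative in \<open>L\<^sup>2\<close>.\<close>
definition H1_deriv :: "(real \<Rightarrow> complex ^ 2) \<Rightarrow> (real \<Rightarrow> complex ^ 2) \<Rightarrow> bool" where
  "H1_deriv u v \<longleftrightarrow> L2 u \<and> L2 v \<and>
     (\<forall>a b. a \<le> b \<longrightarrow> (LINT x:{a..b}|lborel. v x) = u b - u a)"

definition L_coeff :: "complex \<Rightarrow> (real \<Rightarrow> complex) \<Rightarrow> real \<Rightarrow> complex ^ 2 ^ 2" where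
  "L_coeff \<kappa> q x =
     vector [vector [\<i> * \<kappa>\<^sup>2, - \<kappa> * q x],
             vector [- \<kappa> * rfun q x, - \<i> * \<kappa>\<^sup>2]]"

text \<open>The graph of the unbounded operator \<open>L(\<kappa>)\<close> on \<open>L\<^sup>2\<close> with domain \<open>H\<^sup>1\<close>:
  \<open>u\<close> is in the domain and \<open>L(\<kappa>) u = f\<close> in \<open>L\<^sup>2\<close>. The free operator
  \<open>L\<^sub>0(\<kappa>)\<close> is the case \<open>q = 0\<close>.\<close>
definition L_graph ::
  "complex \<Rightarrow> (real \<Rightarrow> complex) \<Rightarrow> (real \<Rightarrow> complex ^ 2) \<Rightarrow> (real \<Rightarrow> complex ^ 2) \<Rightarrow> bool" where
  "L_graph \<kappa> q u f \<longleftrightarrow> L2 f \<and>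
     (\<exists>v. H1_deriv u v \<and> (AE x in lborel. f x = v x + L_coeff \<kappa> q x *v u x))"

text \<open>Since \<open>L(\<kappa>)\<close> is closed for bounded \<open>q\<close>, the inverse is automatically bounded.\<close>
definition L_invertible :: "complex \<Rightarrow> (real \<Rightarrow> complex) \<Rightarrow> bool" where
  "L_invertible \<kappa> q \<longleftrightarrow> (\<forall>f. L2 f \<longrightarrow> (\<exists>!u. L_graph \<kappa> q u f))"

definition inverse_kernel ::
  "complex \<Rightarrow> (real \<Rightarrow> complex) \<Rightarrow> (real \<Rightarrow> real \<Rightarrow> complex ^ 2 ^ 2) \<Rightarrow> bool" where
  "inverse_kernel \<kappa> q K \<longleftrightarrow> L_invertible \<kappa> q \<and>
     case_prod K \<in> borel_measurable borel \<and>
     (\<forall>u f. L_graph \<kappa> q u f \<longrightarrow>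
        (AE x in lborel. integrable lborel (\<lambda>y. K x y *v f y) \<and>
                         u x = (LINT y|lborel. K x y *v f y)))"

text \<open>
  Integral kernels are only determined almost everywhere, and \<open>G\<close> itself jumps across the
  diagonal; what has well-defined diagonal values is the continuous representative of
  \<open>G - G\<^sub>0\<close>, and this is unique.
\<close>
definition is_green_diff ::
  "complex \<Rightarrow> (real \<Rightarrow> complex) \<Rightarrow> (real \<Rightarrow> real \<Rightarrow> complex ^ 2 ^ 2) \<Rightarrow> bool" where
  "is_green_diff \<kappa> q D \<longleftrightarrow> continuous_on UNIV (case_prod D) \<and>
     (\<exists>G G0. inverse_kernel \<kappa> q G \<and> inverse_kernel \<kappa> (\<lambda>_. 0) G0 \<and>
             (\<forall>x y. D x y = G x y - G0 x y))"

definition green_diff ::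
  "complex \<Rightarrow> (real \<Rightarrow> complex) \<Rightarrow> real \<Rightarrow> real \<Rightarrow> complex ^ 2 ^ 2" where
  "green_diff \<kappa> q = (THE D. is_green_diff \<kappa> q D)"

text \<open>
  On the diagonal \<open>G\<^sub>0\<close> contributes \<open>sgn (i \<kappa>\<^sup>2)\<close> to \<open>G\<^sub>1\<^sub>1 - G\<^sub>2\<^sub>2\<close>,
  which is cancelled by the \<open>-1\<close> in \<open>\<gamma> = sgn (i \<kappa>\<^sup>2) (G\<^sub>1\<^sub>1 - G\<^sub>2\<^sub>2) - 1\<close>.
  As \<open>L\<^sub>0(\<kappa>)\<close> is diagonal, \<open>G\<^sub>0\<close> does not contribute to the off-diagonal entries.
\<close>
definition gam :: "complex \<Rightarrow> (real \<Rightarrow> complex) \<Rightarrow> real \<Rightarrow> complex" where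
  "gam \<kappa> q x = sgn (\<i> * \<kappa>\<^sup>2) * (green_diff \<kappa> q x x $ 1 $ 1 - green_diff \<kappa> q x x $ 2 $ 2)"

definition g12 :: "complex \<Rightarrow> (real \<Rightarrow> complex) \<Rightarrow> real \<Rightarrow> complex" where
  "g12 \<kappa> q x = sgn (\<i> * \<kappa>\<^sup>2) * green_diff \<kappa> q x x $ 1 $ 2"

definition g21 :: "complex \<Rightarrow> (real \<Rightarrow> complex) \<Rightarrow> real \<Rightarrow> complex" where
  "g21 \<kappa> q x = sgn (\<i> * \<kappa>\<^sup>2) * green_diff \<kappa> q x x $ 2 $ 1"

definition rho :: "complex \<Rightarrow> (real \<Rightarrow> complex) \<Rightarrow> real \<Rightarrow> complex" where
  "rho \<kappa> q x =
     - \<kappa> * ((q x * g21 \<kappa> q x + rfun q x * g12 \<kappa> q x) / (2 + gam \<kappa> q x))"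

definition j_DNLS :: "complex \<Rightarrow> (real \<Rightarrow> complex) \<Rightarrow> real \<Rightarrow> complex" where
  "j_DNLS \<kappa> q x =
     \<i> * \<kappa> * ((dx q x * g21 \<kappa> q x - dx (rfun q) x * g12 \<kappa> q x) / (2 + gam \<kappa> q x))
     - \<i> * \<kappa>\<^sup>2 * q x * rfun q x - 2 * \<kappa>\<^sup>2 * rho \<kappa> q x - q x * rfun q x * rho \<kappa> q x"

section \<open>The DNLS flow\<close>

definition DNLS_on :: "real set \<Rightarrow> (real \<Rightarrow> real \<Rightarrow> complex) \<Rightarrow> bool" where
  "DNLS_on I q \<longleftrightarrow>
     (\<forall>t\<in>I. \<forall>x. \<exists>qt. ((\<lambda>\<tau>. q \<tau> x) has_vector_derivative qt) (at t within I) \<and>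
        \<i> * qt + dx (dx (q t)) x
          + \<i> * dx (\<lambda>y. of_real ((cmod (q t y))\<^sup>2) * q t y) x = 0)"

end

theory Submission
  imports Defs "HOL-Probability.Probability"
begin

text \<open>
  Put \<open>\<nu> = i\<kappa>\<^sup>2\<close>, a real number with \<open>\<bar>\<nu>\<bar> = \<bar>\<kappa>\<bar>\<^sup>2 \<ge> 1\<close>. The solutions of \<open>L(\<kappa>) u = 0\<close> that
  decay at one end of the line have component ratios \<open>a = u\<^sub>2 / u\<^sub>1\<close> and \<open>b = u\<^sub>1 / u\<^sub>2\<close>, and
  these are the bounded solutions of the Riccati equations \<open>a' = 2\<nu>a + \<kappa>r - \<kappa>q a\<^sup>2\<close> and
  \<open>b' = -2\<nu>b + \<kappa>q - \<kappa>r b\<^sup>2\<close>. In integral form, \<open>\<kappa>q\<close> and \<open>\<kappa>r\<close> are integrated against one-sided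
  exponentials of rate \<open>2\<bar>\<nu>\<bar>\<close>, and by Cauchy-Schwarz this costs
  \<open>\<bar>\<kappa>\<bar> \<parallel>q\<parallel> / (2 sqrt \<bar>\<nu>\<bar>) = \<parallel>q\<parallel> / 2\<close> in the \<open>L\<^sup>2\<close> norm. The bound does not depend on \<open>\<kappa>\<close>: a
  single \<open>\<delta> = 1/2\<close> makes the integral equations contractions on the functions bounded by \<open>1/2\<close>
  (\<open>riccati_bounded_solution\<close>). That the \<open>H\<^sup>s\<close> norm dominates the \<open>L\<^sup>2\<close> norm is the Plancherel
  identity (\<open>L2_le_Hs_norm\<close>).

  Let \<open>V\<close> be the matrix with columns \<open>exp(\<phi>) (1, a)\<close> and \<open>exp(\<psi>) (b, 1)\<close>, where \<open>\<phi>' = \<kappa>q a\<close>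
  and \<open>\<psi>' = \<kappa>r b\<close>. Then \<open>V\<close> and its inverse are bounded and \<open>L(\<kappa>) V = V L\<^sub>0(\<kappa>)\<close>. So \<open>L(\<kappa>)\<close> is
  invertible, its kernel is \<open>G(x,y) = V(x) G\<^sub>0(x,y) W(y)\<close> with \<open>W\<close> the inverse of \<open>V\<close> and \<open>G\<^sub>0\<close>
  an explicit exponential, and the diagonal of \<open>G - G\<^sub>0\<close> can be read off
  (\<open>green_diff_riccati\<close>): for both signs of \<open>\<nu>\<close>, \<open>\<gamma> = 2ab/(1-ab)\<close>, \<open>g\<^sub>1\<^sub>2 = -b/(1-ab)\<close>,
  \<open>g\<^sub>2\<^sub>1 = a/(1-ab)\<close>, and hence \<open>\<rho> = -\<kappa>(qa - rb)/2\<close>.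

  For the evolution, the difference quotient in time of \<open>a\<close> solves a linear equation of the
  same structure, whose bounded solutions are controlled by the supremum of the source. Hence
  it converges uniformly to the bounded solution of the linearised equation
  (\<open>riccati_time_derivative\<close>). The zero-curvature identity (\<open>lax_riccati_compatibility\<close>) says
  that \<open>A\<^sub>2\<^sub>1 + 2A\<^sub>2\<^sub>2 a - A\<^sub>1\<^sub>2 a\<^sup>2\<close> solves that equation, where \<open>A\<close> is the time part of the Lax
  pair, so it is the time derivative of \<open>a\<close>; likewise for \<open>b\<close>. All assertions then reduce to
  polynomial identities in \<open>a\<close>, \<open>b\<close>, \<open>q\<close>, \<open>r\<close> and their derivatives.
\<close>

section \<open>Bounded solutions of linear equations on the line\<close>

lemma exp_decay_integral:
  fixes \<mu> x :: real
  assumes "\<mu> > 0"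
  shows "set_integrable lborel {x..} (\<lambda>s. exp (- \<mu> * s))"
    and "(LINT s:{x..}|lborel. exp (- \<mu> * s)) = exp (- \<mu> * x) / \<mu>"
proof -
  have hi: "((\<lambda>s. exp (- \<mu> * s)) has_integral exp (- \<mu> * x) / \<mu>) {x..}"
    using has_integral_exp_minus_to_infinity[OF assms, of x] by simp
  have "set_integrable lebesgue {x..} (\<lambda>s. exp (- \<mu> * s))"
    using hi by (intro nonnegative_absolutely_integrable_1) (auto simp: integrable_on_def)
  then show *: "set_integrable lborel {x..} (\<lambda>s. exp (- \<mu> * s))"
    unfolding set_integrable_def by (simp add: integrable_completion)
  show "(LINT s:{x..}|lborel. exp (- \<mu> * s)) = exp (- \<mu> * x) / \<mu>"
    using set_borel_integral_eq_integral(2)[OF *] hi by (simp add: integral_unique)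
qed

text \<open>
  Solving backwards from \<open>X\<close>, \<open>y(x)\<close> is \<open>exp(-\<mu>(X-x)) y(X)\<close> minus the integral of
  \<open>exp(-\<mu>(s-x)) F(s)\<close> over \<open>x \<le> s \<le> X\<close>; as \<open>X\<close> tends to infinity the boundary term disappears
  for a bounded solution, whatever its bound is. This turns every later estimate into a bound
  on a source term.
\<close>
lemma linear_ode_bounded_solution_bound:
  fixes y F :: "real \<Rightarrow> complex"
  assumes \<mu>: "\<mu> > 0"
    and der: "\<And>x. (y has_vector_derivative (complex_of_real \<mu> * y x + F x)) (at x)"
    and contF: "continuous_on UNIV F"
    and bdd: "\<And>x. cmod (y x) \<le> B"
    and K: "\<And>x X. x \<le> X \<Longrightarrow> integral {x..X} (\<lambda>s. exp (- \<mu> * (s - x)) * cmod (F s)) \<le> K"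
  shows "cmod (y x) \<le> K"
proof -
  have bound: "cmod (y x) \<le> exp (- \<mu> * (X - x)) * B + K" if "x \<le> X" for X
  proof -
    define g where "g s = complex_of_real (exp (- \<mu> * (s - x))) * y s" for s
    have dg: "(g has_vector_derivative complex_of_real (exp (- \<mu> * (s - x))) * F s) (at s)" for s
      unfolding g_def
      by (rule has_vector_derivative_eq_rhs, (rule der derivative_eq_intros refl | simp)+)
         (simp add: algebra_simps scaleR_conv_of_real)
    have int: "((\<lambda>s. complex_of_real (exp (- \<mu> * (s - x))) * F s) has_integral (g X - g x)) {x..X}"
      by (rule fundamental_theorem_of_calculus[OF that])
         (rule has_vector_derivative_at_within[OF dg])
    have "cmod (integral {x..X} (\<lambda>s. complex_of_real (exp (- \<mu> * (s - x))) * F s))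
        \<le> integral {x..X} (\<lambda>s. exp (- \<mu> * (s - x)) * cmod (F s))"
      by (intro integral_norm_bound_integral integrable_continuous_interval continuous_intros
            continuous_on_subset[OF contF]) (auto simp: norm_mult)
    also have "\<dots> \<le> K" using K that .
    finally have 1: "cmod (g X - g x) \<le> K" using int by (simp add: integral_unique)
    have 2: "cmod (g X) \<le> exp (- \<mu> * (X - x)) * B"
      unfolding g_def by (simp add: norm_mult bdd)
    have "g x = y x" by (simp add: g_def)
    then show ?thesis using 1 2 norm_triangle_ineq2[of "g x" "g X"]
      by (simp add: norm_minus_commute)
  qed
  have "((\<lambda>X. exp (- \<mu> * (X - x)) * B + K) \<longlongrightarrow> 0 * B + K) at_top"
  proof (intro tendsto_intros)
    have "filterlim (\<lambda>X. - \<mu> * (X - x)) at_bot at_top" using \<mu> by real_asymp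
    then show "((\<lambda>X. exp (- \<mu> * (X - x))) \<longlongrightarrow> 0) at_top"
      by (rule filterlim_compose[OF exp_at_bot])
  qed
  then show ?thesis
    using bound by (intro tendsto_lowerbound[of _ "0 * B + K" at_top "cmod (y x)", simplified])
      (auto intro: eventually_at_top_linorderI[of x])
qed

text \<open>
  The boundary term at infinity has to vanish, so \<open>y(x)\<close> must be minus the integral of
  \<open>exp(-\<mu>(s-x)) F(s)\<close> over all \<open>s \<ge> x\<close>.
\<close>
lemma linear_ode_bounded_solution_exists:
  fixes F :: "real \<Rightarrow> complex"
  assumes \<mu>: "\<mu> > 0" and contF: "continuous_on UNIV F" and B: "\<And>x. cmod (F x) \<le> B"
  shows "\<exists>y. (\<forall>x. (y has_vector_derivative (complex_of_real \<mu> * y x + F x)) (at x))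
            \<and> (\<forall>x. cmod (y x) \<le> B / \<mu>)"
proof -
  define h where "h s = complex_of_real (exp (- \<mu> * s)) * F s" for s
  have conth: "continuous_on A h" for A
    unfolding h_def by (intro continuous_intros continuous_on_subset[OF contF]) auto
  then have hm[measurable]: "h \<in> borel_measurable borel"
    by (simp add: borel_measurable_continuous_onI)
  have "B \<ge> 0" using order_trans[OF norm_ge_zero B] .
  have hb: "cmod (h s) \<le> B * exp (- \<mu> * s)" for s
    unfolding h_def using B[of s] by (simp add: norm_mult mult.commute)
  have Bi: "set_integrable lborel {x..} (\<lambda>s. B * exp (- \<mu> * s))" for x
    using exp_decay_integral(1)[OF \<mu>, of x] by simp
  have hi: "set_integrable lborel {x..} h" for x
    by (rule set_integrable_bound[OF Bi[of x]])
       (use hb in \<open>auto simp: set_borel_measurable_def intro: order_trans[OF _ abs_ge_self]\<close>)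
  define J where "J x = (LINT s:{x..}|lborel. h s)" for x
  have split: "J x = integral {x..N} h + J N" if "x \<le> N" for x N
  proof -
    have i1: "set_integrable lborel {x..N} h" by (rule set_integrable_subset[OF hi[of x]]) auto
    have i2: "set_integrable lborel {N<..} h" by (rule set_integrable_subset[OF hi[of x]]) (use that in auto)
    have "J x = (LINT s:{x..N} \<union> {N<..}|lborel. h s)"
      unfolding J_def by (rule arg_cong[where f="\<lambda>A. set_lebesgue_integral lborel A h"]) (use that in auto)
    also have "\<dots> = (LINT s:{x..N}|lborel. h s) + (LINT s:{N<..}|lborel. h s)"
      by (rule set_integral_Un[OF _ i1 i2]) auto
    also have "(LINT s:{x..N}|lborel. h s) = integral {x..N} h"
      using set_borel_integral_eq_integral(2)[OF i1] .
    also have "(LINT s:{N<..}|lborel. h s) = J N"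
      unfolding J_def set_lebesgue_integral_def
      by (rule integral_cong_AE)
         (auto simp: indicator_def intro!: eventually_mono[OF AE_lborel_singleton[of N]])
    finally show ?thesis .
  qed
  have dJ: "(J has_vector_derivative - h x) (at x)" for x
  proof -
    have "((\<lambda>u. integral {u..x+1} h) has_vector_derivative - h x) (at x within {x-1..x+1})"
      by (rule integral_has_vector_derivative'[OF conth]) auto
    then have "((\<lambda>u. integral {u..x+1} h) has_vector_derivative - h x) (at x)"
      by (simp add: at_within_interior[of x "{x-1..x+1}"])
    then have "((\<lambda>u. integral {u..x+1} h + J (x+1)) has_vector_derivative - h x) (at x)"
      by (auto intro!: derivative_eq_intros)
    then show ?thesis
      by (rule has_vector_derivative_transform_within_open[where S="{..<x+1}"]) (auto intro!: split[symmetric])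
  qed
  have bJ: "cmod (J x) \<le> B * exp (- \<mu> * x) / \<mu>" for x
  proof -
    have "cmod (J x) \<le> (LINT s:{x..}|lborel. B * exp (- \<mu> * s))"
      unfolding J_def set_lebesgue_integral_def
      by (rule Bochner_Integration.integral_norm_bound_integral)
         (use hi Bi hb in \<open>auto simp: set_integrable_def indicator_def\<close>)
    then show ?thesis using exp_decay_integral(2)[OF \<mu>, of x] by simp
  qed
  define y where "y x = - complex_of_real (exp (\<mu> * x)) * J x" for x
  have eh: "complex_of_real (exp (\<mu> * x)) * h x = F x" for x
  proof -
    have "exp (\<mu> * x) * exp (- \<mu> * x) = 1" by (simp flip: exp_add)
    then show ?thesis unfolding h_def by (metis mult.assoc mult_1 of_real_1 of_real_mult)
  qed
  have "(y has_vector_derivative (complex_of_real \<mu> * y x + F x)) (at x)" for x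
    unfolding y_def
    by (rule has_vector_derivative_eq_rhs, (rule dJ derivative_eq_intros refl | simp)+)
       (simp add: algebra_simps scaleR_conv_of_real eh[unfolded mult.commute[of _ "h _"]])
  moreover have "cmod (y x) \<le> B / \<mu>" for x
  proof -
    have "cmod (y x) \<le> exp (\<mu> * x) * (B * exp (- \<mu> * x) / \<mu>)"
      unfolding y_def using bJ[of x] by (simp add: norm_mult del: times_divide_eq_right)
    also have "\<dots> = B / \<mu>" by (simp add: exp_minus field_simps)
    finally show ?thesis .
  qed
  ultimately show ?thesis by blast
qed

section \<open>The Riccati equation\<close>

text \<open>
  For \<open>Q = \<kappa> q\<close> with \<open>\<bar>\<kappa>\<bar>\<^sup>2 = \<bar>\<nu>\<bar>\<close> this says that the \<open>L\<^sup>2\<close> norm of \<open>q\<close> is at most \<open>1/2\<close>.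
  Bounding integrals over compact intervals makes the condition obviously invariant under
  reflection of the line, which exchanges the two signs of \<open>\<nu>\<close>.
\<close>
definition small_potential :: "real \<Rightarrow> (real \<Rightarrow> complex) \<Rightarrow> bool" where
  "small_potential \<nu> Q \<longleftrightarrow> continuous_on UNIV Q \<and> bounded (range Q) \<and>
     (\<forall>x X. x \<le> X \<longrightarrow> integral {x..X} (\<lambda>s. (cmod (Q s))\<^sup>2) \<le> \<bar>\<nu>\<bar> / 4)"

lemma small_potential_reflect:
  assumes "small_potential \<nu> Q"
  shows "small_potential (- \<nu>) (\<lambda>x. - Q (- x))"
  unfolding small_potential_def
proof (intro conjI allI impI)
  have c: "continuous_on UNIV Q" using assms by (simp add: small_potential_def)
  show "continuous_on UNIV (\<lambda>x. - Q (- x))"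
    by (intro continuous_intros continuous_on_compose2[OF c]) auto
  show "bounded (range (\<lambda>x. - Q (- x)))"
    using assms unfolding small_potential_def bounded_iff by auto
  fix x X :: real assume "x \<le> X"
  have "integral {x..X} (\<lambda>s. (cmod (- Q (- s)))\<^sup>2) = integral {-X..-x} (\<lambda>s. (cmod (Q s))\<^sup>2)"
    using Henstock_Kurzweil_Integration.integral_reflect_real[of "-x" "-X" "\<lambda>s. (cmod (Q s))\<^sup>2"] by simp
  then show "integral {x..X} (\<lambda>s. (cmod (- Q (- s)))\<^sup>2) \<le> \<bar>- \<nu>\<bar> / 4"
    using assms \<open>x \<le> X\<close> by (simp add: small_potential_def)
qed

text \<open>
  This is Cauchy-Schwarz: the exponential has \<open>L\<^sup>2\<close> norm at most \<open>1 / (2 sqrt \<nu>)\<close> and \<open>Q\<close> has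
  norm at most \<open>sqrt \<nu> / 2\<close>, so the factors of \<open>\<nu>\<close> cancel.
\<close>
lemma small_potential_exp_integral:
  assumes "small_potential \<nu> Q" and \<nu>: "\<nu> > 0" and "x \<le> X"
  shows "integral {x..X} (\<lambda>s. exp (- (2 * \<nu>) * (s - x)) * cmod (Q s)) \<le> 1 / 4"
proof -
  have c: "continuous_on S Q" for S
    using assms(1) continuous_on_subset by (auto simp: small_potential_def)
  have e: "integral {x..X} (\<lambda>s. exp (- (4 * \<nu>) * (s - x))) \<le> 1 / (4 * \<nu>)"
  proof -
    have "((\<lambda>s. exp (- (4 * \<nu>) * (s - x))) has_integral
        (- exp (- (4 * \<nu>) * (X - x)) / (4 * \<nu>) - - exp (- (4 * \<nu>) * (x - x)) / (4 * \<nu>))) {x..X}"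
      using \<nu> by (intro fundamental_theorem_of_calculus[OF \<open>x \<le> X\<close>])
        (auto intro!: derivative_eq_intros simp flip: has_real_derivative_iff_has_vector_derivative)
    then show ?thesis using \<nu> by (simp add: integral_unique field_simps)
  qed
  \<comment> \<open>The weights \<open>\<nu>\<close> and \<open>1/\<nu>\<close> in the arithmetic-geometric mean are the ones that balance both terms.\<close>
  have "integral {x..X} (\<lambda>s. exp (- (2 * \<nu>) * (s - x)) * cmod (Q s))
     \<le> integral {x..X} (\<lambda>s. \<nu> / 2 * exp (- (4 * \<nu>) * (s - x)) + 1 / (2 * \<nu>) * (cmod (Q s))\<^sup>2)"
  proof (intro integral_le integrable_continuous_interval continuous_intros c)
    fix s
    have *: "2 * (u * w) \<le> \<nu> * u\<^sup>2 + w\<^sup>2 / \<nu>" for u w :: real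
    proof -
      have "0 \<le> (\<nu> * u - w)\<^sup>2 / \<nu>" using \<nu> by simp
      also have "\<dots> = \<nu> * u\<^sup>2 + w\<^sup>2 / \<nu> - 2 * (u * w)"
        using \<nu> by (simp add: power2_eq_square field_simps)
      finally show ?thesis by simp
    qed
    have "(exp (- (2 * \<nu>) * (s - x)))\<^sup>2 = exp (- (4 * \<nu>) * (s - x))"
      by (simp add: power2_eq_square algebra_simps flip: exp_add)
    then show "exp (- (2 * \<nu>) * (s - x)) * cmod (Q s)
        \<le> \<nu> / 2 * exp (- (4 * \<nu>) * (s - x)) + 1 / (2 * \<nu>) * (cmod (Q s))\<^sup>2"
      using *[of "exp (- (2 * \<nu>) * (s - x))" "cmod (Q s)"] by simp
  qed
  also have "\<dots> = \<nu> / 2 * integral {x..X} (\<lambda>s. exp (- (4 * \<nu>) * (s - x)))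
      + 1 / (2 * \<nu>) * integral {x..X} (\<lambda>s. (cmod (Q s))\<^sup>2)"
    by (subst integral_add) (intro integrable_continuous_interval continuous_intros c | simp)+
  also have "\<dots> \<le> \<nu> / 2 * (1 / (4 * \<nu>)) + 1 / (2 * \<nu>) * (\<nu> / 4)"
    using assms e by (intro add_mono mult_left_mono) (auto simp: small_potential_def)
  also have "\<dots> = 1 / 4" using \<nu> by simp
  finally show ?thesis .
qed

lemma weighted_integral_le:
  assumes Q: "small_potential \<nu> Q" and \<nu>: "\<nu> > 0" and le: "x \<le> X"
    and F: "continuous_on UNIV F" and b: "\<And>s. cmod (F s) \<le> C * cmod (Q s)" and "C \<ge> 0"
  shows "integral {x..X} (\<lambda>s. exp (- (2 * \<nu>) * (s - x)) * cmod (F s)) \<le> C / 4"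
proof -
  have c: "continuous_on S Q" "continuous_on S F" for S
    using Q F continuous_on_subset by (auto simp: small_potential_def)
  have "integral {x..X} (\<lambda>s. exp (- (2 * \<nu>) * (s - x)) * cmod (F s))
     \<le> integral {x..X} (\<lambda>s. C * (exp (- (2 * \<nu>) * (s - x)) * cmod (Q s)))"
    by (intro integral_le integrable_continuous_interval continuous_intros c)
       (use b in \<open>simp add: mult.left_commute\<close>)
  also have "\<dots> = C * integral {x..X} (\<lambda>s. exp (- (2 * \<nu>) * (s - x)) * cmod (Q s))" by simp
  also have "\<dots> \<le> C * (1 / 4)"
    using small_potential_exp_integral[OF Q \<nu> le] \<open>C \<ge> 0\<close> by (rule mult_left_mono)
  finally show ?thesis by simp
qed

text \<open>
  The map \<open>T\<close> sends \<open>a\<close> to the bounded solution \<open>y\<close> of \<open>y' = 2\<nu>y + R - Q a\<^sup>2\<close>. By the weighted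
  estimate it maps the ball of radius \<open>1/2\<close> in the bounded continuous functions to itself,
  since \<open>1/4 + 1/4 = 1/2\<close>, and on that ball it is a contraction with constant \<open>1/4\<close>, since
  \<open>\<bar>a\<^sup>2 - b\<^sup>2\<bar> \<le> \<bar>a - b\<bar>\<close> there.
\<close>
lemma riccati_bounded_solution_pos:
  assumes \<nu>: "\<nu> > 0" and Q: "small_potential \<nu> Q" and R: "small_potential \<nu> R"
  shows "\<exists>a. (\<forall>x. (a has_vector_derivative
               (complex_of_real (2 * \<nu>) * a x + R x - Q x * (a x)\<^sup>2)) (at x)) \<and>
             (\<forall>x. cmod (a x) \<le> 1 / 2)"
proof -
  have cQ: "continuous_on S Q" "continuous_on S R" for S
    using Q R continuous_on_subset by (auto simp: small_potential_def)
  obtain BQ BR where BQ: "\<And>x. cmod (Q x) \<le> BQ" and BR: "\<And>x. cmod (R x) \<le> BR"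
    using Q R unfolding small_potential_def bounded_iff by auto
  define F where "F a x = R x - Q x * (apply_bcontfun a x)\<^sup>2" for a x
  have cF: "continuous_on S (F a)" for S a
    unfolding F_def by (intro continuous_intros cQ) auto
  have "\<exists>y :: real \<Rightarrow>\<^sub>C complex. \<forall>x. (apply_bcontfun y has_vector_derivative
               (complex_of_real (2 * \<nu>) * apply_bcontfun y x + F a x)) (at x)" for a
  proof -
    have bF: "cmod (F a x) \<le> BR + BQ * (norm a)\<^sup>2" for x
      unfolding F_def
      by (rule norm_triangle_le_diff)
         (auto intro!: add_mono mult_mono BR BQ power_mono norm_bounded simp: norm_mult norm_power
               intro: order_trans[OF norm_ge_zero BQ])
    obtain y where y: "\<And>x. (y has_vector_derivative (complex_of_real (2 * \<nu>) * y x + F a x)) (at x)"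
        and yb: "\<And>x. cmod (y x) \<le> (BR + BQ * (norm a)\<^sup>2) / (2 * \<nu>)"
      using linear_ode_bounded_solution_exists[of "2 * \<nu>" "F a" "BR + BQ * (norm a)\<^sup>2"] \<nu> cF bF
      by auto
    have "continuous_on UNIV y"
      using y by (meson continuous_at_imp_continuous_on has_vector_derivative_continuous)
    then have "y \<in> bcontfun" using yb by (rule bcontfun_normI)
    then show ?thesis using y by (intro exI[of _ "Bcontfun y"]) (simp add: Bcontfun_inverse)
  qed
  then obtain T :: "(real \<Rightarrow>\<^sub>C complex) \<Rightarrow> (real \<Rightarrow>\<^sub>C complex)" where
    T: "\<And>a x. (apply_bcontfun (T a) has_vector_derivative
               (complex_of_real (2 * \<nu>) * apply_bcontfun (T a) x + F a x)) (at x)"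
    by metis
  have into: "norm (T a) \<le> 1 / 2" if "norm a \<le> 1 / 2" for a
  proof (rule norm_bound)
    have ax: "cmod (apply_bcontfun a x) \<le> 1 / 2" for x
      using norm_bounded[of a x] that by simp
    fix x
    show "cmod (apply_bcontfun (T a) x) \<le> 1 / 2"
    proof (rule linear_ode_bounded_solution_bound[OF _ T cF norm_bounded])
      show "0 < 2 * \<nu>" using \<nu> by simp
      fix x X :: real assume le: "x \<le> X"
      have "integral {x..X} (\<lambda>s. exp (- (2 * \<nu>) * (s - x)) * cmod (F a s))
         \<le> integral {x..X} (\<lambda>s. exp (- (2 * \<nu>) * (s - x)) * cmod (R s)
               + exp (- (2 * \<nu>) * (s - x)) * cmod (Q s * (apply_bcontfun a s)\<^sup>2))"
        by (intro integral_le integrable_continuous_interval continuous_intros cQ cF)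
           (auto simp: F_def norm_triangle_ineq4 simp flip: distrib_left)
      also have "\<dots> = integral {x..X} (\<lambda>s. exp (- (2 * \<nu>) * (s - x)) * cmod (R s))
            + integral {x..X} (\<lambda>s. exp (- (2 * \<nu>) * (s - x)) * cmod (Q s * (apply_bcontfun a s)\<^sup>2))"
        by (intro integral_add integrable_continuous_interval continuous_intros cQ) auto
      also have "\<dots> \<le> 1 / 4 + 1 / 4"
      proof (intro add_mono)
        show "integral {x..X} (\<lambda>s. exp (- (2 * \<nu>) * (s - x)) * cmod (R s)) \<le> 1 / 4"
          by (rule small_potential_exp_integral[OF R \<nu> le])
        have "cmod (apply_bcontfun a s ^ 2) \<le> 1" for s
          unfolding norm_power using ax[of s] by (intro power_le_one) auto
        then show "integral {x..X} (\<lambda>s. exp (- (2 * \<nu>) * (s - x)) * cmod (Q s * (apply_bcontfun a s)\<^sup>2)) \<le> 1 / 4"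
          by (intro weighted_integral_le[OF Q \<nu> le] continuous_intros cQ)
             (auto simp: norm_mult mult_left_le)
      qed
      finally show "integral {x..X} (\<lambda>s. exp (- (2 * \<nu>) * (s - x)) * cmod (F a s)) \<le> 1 / 2" by simp
    qed
  qed
  have contr: "dist (T a) (T b) \<le> 1 / 4 * dist a b" if "norm a \<le> 1 / 2" "norm b \<le> 1 / 2" for a b
  proof (rule dist_bound)
    have ax: "cmod (apply_bcontfun a x) \<le> 1 / 2" "cmod (apply_bcontfun b x) \<le> 1 / 2" for x
      using norm_bounded[of a x] norm_bounded[of b x] that by simp_all
    fix x
    show "dist (apply_bcontfun (T a) x) (apply_bcontfun (T b) x) \<le> 1 / 4 * dist a b"
      unfolding dist_norm[of "apply_bcontfun (T a) x"]
    proof (rule linear_ode_bounded_solution_bound[where F = "\<lambda>x. F a x - F b x" and \<mu> = "2 * \<nu>"])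
      show "0 < 2 * \<nu>" using \<nu> by simp
      show "((\<lambda>x. apply_bcontfun (T a) x - apply_bcontfun (T b) x) has_vector_derivative
          complex_of_real (2 * \<nu>) * (apply_bcontfun (T a) x - apply_bcontfun (T b) x) + (F a x - F b x)) (at x)" for x
        by (rule has_vector_derivative_eq_rhs, (rule T derivative_eq_intros refl)+) (simp add: algebra_simps)
      show cd: "continuous_on UNIV (\<lambda>x. F a x - F b x)" by (intro continuous_intros cF)
      show "cmod (apply_bcontfun (T a) x - apply_bcontfun (T b) x) \<le> dist (T a) (T b)" for x
        using dist_bounded[of "T a" x "T b"] by (simp add: dist_norm)
      fix x X :: real assume le: "x \<le> X"
      have "cmod (F a s - F b s) \<le> dist a b * cmod (Q s)" for s
      proof -
        have "F a s - F b s = Q s * (apply_bcontfun a s + apply_bcontfun b s) * (apply_bcontfun b s - apply_bcontfun a s)"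
          by (simp add: F_def power2_eq_square algebra_simps)
        then have "cmod (F a s - F b s) = cmod (Q s) * cmod (apply_bcontfun a s + apply_bcontfun b s)
              * dist (apply_bcontfun a s) (apply_bcontfun b s)"
          by (simp add: norm_mult dist_norm norm_minus_commute)
        also have "\<dots> \<le> cmod (Q s) * 1 * dist a b"
          using norm_triangle_le[of "apply_bcontfun a s" "apply_bcontfun b s" 1] ax[of s]
          by (intro mult_mono dist_bounded) auto
        finally show ?thesis by (simp add: mult.commute)
      qed
      from weighted_integral_le[OF Q \<nu> le cd this]
      show "integral {x..X} (\<lambda>s. exp (- (2 * \<nu>) * (s - x)) * cmod (F a s - F b s)) \<le> 1 / 4 * dist a b"
        by simp
    qed
  qed
  have "\<exists>!a\<in>cball 0 (1/2). T a = a"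
    by (rule Banach_fix[where c = "1/4"]) (use into contr in \<open>auto simp: complete_eq_closed\<close>)
  then obtain a where "norm a \<le> 1 / 2" "T a = a" by auto
  moreover have "cmod (apply_bcontfun a x) \<le> 1 / 2" for x
    using norm_bounded[of a x] \<open>norm a \<le> 1 / 2\<close> by simp
  ultimately show ?thesis
    using T[of a] by (intro exI[of _ "apply_bcontfun a"]) (auto simp: F_def algebra_simps)
qed

lemma has_vector_derivative_reflect:
  assumes "(y has_vector_derivative d) (at (- x))"
  shows "((\<lambda>x. y (- x)) has_vector_derivative - d) (at (x::real))"
proof -
  have "((y \<circ> uminus) has_vector_derivative - 1 *\<^sub>R d) (at x)"
    by (rule vector_diff_chain_at) (auto intro!: derivative_eq_intros assms)
  then show ?thesis by (simp add: o_def)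
qed

text \<open>
  For negative \<open>\<nu>\<close> the bounded solution is determined from the left end of the line instead
  of the right end; reflecting the line reduces this to the positive case.
\<close>
theorem riccati_bounded_solution:
  assumes \<nu>: "\<nu> \<noteq> 0" and Q: "small_potential \<nu> Q" and R: "small_potential \<nu> R"
  shows "\<exists>a. (\<forall>x. (a has_vector_derivative
               (complex_of_real (2 * \<nu>) * a x + R x - Q x * (a x)\<^sup>2)) (at x)) \<and>
             (\<forall>x. cmod (a x) \<le> 1 / 2)"
proof (cases "\<nu> > 0")
  case True
  then show ?thesis using riccati_bounded_solution_pos Q R by blast
next
  case False
  then have "- \<nu> > 0" using \<nu> by simp
  from riccati_bounded_solution_pos[OF this small_potential_reflect[OF Q] small_potential_reflect[OF R]]
  obtain a where a: "\<And>x. (a has_vector_derivative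
               (complex_of_real (2 * - \<nu>) * a x + - R (- x) - - Q (- x) * (a x)\<^sup>2)) (at x)"
      "\<And>x. cmod (a x) \<le> 1 / 2" by blast
  have "((\<lambda>x. a (- x)) has_vector_derivative
           (complex_of_real (2 * \<nu>) * a (- x) + R x - Q x * (a (- x))\<^sup>2)) (at x)" for x
    using has_vector_derivative_reflect[OF a(1)[of "- x"]] by (simp add: algebra_simps)
  then show ?thesis using a(2) by (intro exI[of _ "\<lambda>x. a (- x)"]) auto
qed

text \<open>
  The difference of two Riccati solutions \<open>a\<^sub>1\<close>, \<open>a\<^sub>2\<close> satisfies the equation of \<open>e\<close> with
  \<open>c = a\<^sub>1 + a\<^sub>2\<close>. By smallness of \<open>Q\<close> the term \<open>Q c e\<close> costs only a quarter of the supremum of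
  \<open>e\<close> and is absorbed into the left-hand side. The source is measured in the supremum norm, in
  which the difference quotients of a curve in the Schwartz space converge.
\<close>
lemma riccati_difference_bound:
  assumes \<nu>: "\<nu> \<noteq> 0" and Q: "small_potential \<nu> Q"
    and c: "continuous_on UNIV c" "\<And>x. cmod (c x) \<le> 1"
    and e: "\<And>x. (e has_vector_derivative
               ((complex_of_real (2 * \<nu>) - Q x * c x) * e x + f x)) (at x)"
    and eb: "bounded (range e)"
    and f: "continuous_on UNIV f" "\<And>x. cmod (f x) \<le> \<Phi>"
  shows "cmod (e x) \<le> \<Phi> / \<bar>\<nu>\<bar>"
proof -
  have pos: "cmod (e x) \<le> \<Phi> / \<nu>"
    if \<nu>: "\<nu> > 0" and Q: "small_potential \<nu> Q"
    and c: "continuous_on UNIV c" "\<And>x. cmod (c x) \<le> 1"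
    and e: "\<And>x. (e has_vector_derivative
               ((complex_of_real (2 * \<nu>) - Q x * c x) * e x + f x)) (at x)"
    and eb: "bounded (range e)"
    and f: "continuous_on UNIV f" "\<And>x. cmod (f x) \<le> \<Phi>" for \<nu> Q c e f x
  proof -
    have "\<Phi> \<ge> 0" using order_trans[OF norm_ge_zero f(2)] .
    have ce: "continuous_on S e" for S
      using e by (meson continuous_at_imp_continuous_on has_vector_derivative_continuous)
    have cc: "continuous_on S c" "continuous_on S f" "continuous_on S Q" for S
      using c f Q continuous_on_subset[OF _ subset_UNIV] by (auto simp: small_potential_def)
    have bdd: "bdd_above (range (\<lambda>x. cmod (e x)))"
      using eb unfolding bounded_iff bdd_above_def by auto
    define B where "B = (SUP x. cmod (e x))"
    have B: "cmod (e x) \<le> B" for x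
      unfolding B_def by (rule cSUP_upper[OF _ bdd]) simp
    have "B \<ge> 0" using order_trans[OF norm_ge_zero B] .
    have step: "cmod (e x) \<le> \<Phi> / (2 * \<nu>) + B / 4" for x
    proof (rule linear_ode_bounded_solution_bound[where F = "\<lambda>x. f x - Q x * c x * e x" and \<mu> = "2 * \<nu>"])
      show "0 < 2 * \<nu>" using \<nu> by simp
      show "(e has_vector_derivative complex_of_real (2 * \<nu>) * e x + (f x - Q x * c x * e x)) (at x)" for x
        using e[of x] by (simp add: algebra_simps)
      show "continuous_on UNIV (\<lambda>x. f x - Q x * c x * e x)"
        by (intro continuous_intros cc ce)
      show "cmod (e x) \<le> B" for x by (rule B)
      fix x X :: real assume le: "x \<le> X"
      have "integral {x..X} (\<lambda>s. exp (- (2 * \<nu>) * (s - x)) * cmod (f s - Q s * c s * e s))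
         \<le> integral {x..X} (\<lambda>s. \<Phi> * exp (- (2 * \<nu>) * (s - x))
               + exp (- (2 * \<nu>) * (s - x)) * cmod (Q s * c s * e s))"
      proof (intro integral_le integrable_continuous_interval continuous_intros cc ce)
        fix s
        have "cmod (f s - Q s * c s * e s) \<le> \<Phi> + cmod (Q s * c s * e s)"
          using norm_triangle_ineq4[of "f s" "Q s * c s * e s"] f(2)[of s] by simp
        from mult_left_mono[OF this, of "exp (- (2 * \<nu>) * (s - x))"]
        show "exp (- (2 * \<nu>) * (s - x)) * cmod (f s - Q s * c s * e s) \<le>
          \<Phi> * exp (- (2 * \<nu>) * (s - x)) + exp (- (2 * \<nu>) * (s - x)) * cmod (Q s * c s * e s)"
          unfolding distrib_left mult.commute[of \<Phi>] by simp
      qed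
      also have "\<dots> = \<Phi> * integral {x..X} (\<lambda>s. exp (- (2 * \<nu>) * (s - x)))
            + integral {x..X} (\<lambda>s. exp (- (2 * \<nu>) * (s - x)) * cmod (Q s * c s * e s))"
        by (subst integral_add) (intro integrable_continuous_interval continuous_intros cc ce | simp)+
      also have "\<dots> \<le> \<Phi> * (1 / (2 * \<nu>)) + B / 4"
      proof (intro add_mono mult_left_mono \<open>\<Phi> \<ge> 0\<close>)
        have "((\<lambda>s. exp (- (2 * \<nu>) * (s - x))) has_integral
            (- exp (- (2 * \<nu>) * (X - x)) / (2 * \<nu>) - - exp (- (2 * \<nu>) * (x - x)) / (2 * \<nu>))) {x..X}"
          using \<nu> by (intro fundamental_theorem_of_calculus[OF le])
            (auto intro!: derivative_eq_intros simp flip: has_real_derivative_iff_has_vector_derivative)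
        then show "integral {x..X} (\<lambda>s. exp (- (2 * \<nu>) * (s - x))) \<le> 1 / (2 * \<nu>)"
          using \<nu> by (simp add: integral_unique field_simps)
        have "cmod (Q s * c s * e s) \<le> B * cmod (Q s)" for s
        proof -
          have "cmod (c s) * cmod (e s) \<le> 1 * B" by (intro mult_mono c B) auto
          from mult_left_mono[OF this norm_ge_zero[of "Q s"]]
          show ?thesis by (simp add: norm_mult mult_ac)
        qed
        then show "integral {x..X} (\<lambda>s. exp (- (2 * \<nu>) * (s - x)) * cmod (Q s * c s * e s)) \<le> B / 4"
          by (intro weighted_integral_le[OF Q \<nu> le] continuous_intros cc ce \<open>B \<ge> 0\<close>)
      qed
      finally show "integral {x..X} (\<lambda>s. exp (- (2 * \<nu>) * (s - x)) * cmod (f s - Q s * c s * e s))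
          \<le> \<Phi> / (2 * \<nu>) + B / 4" by simp
    qed
    have "B \<le> \<Phi> / (2 * \<nu>) + B / 4"
      unfolding B_def by (rule cSUP_least) (use step in \<open>auto simp: B_def\<close>)
    moreover have "\<Phi> / (2 * \<nu>) = \<Phi> / \<nu> / 2" by simp
    moreover have "\<Phi> / \<nu> \<ge> 0" using \<open>\<Phi> \<ge> 0\<close> \<nu> by simp
    ultimately show ?thesis using B[of x] by linarith
  qed
  show ?thesis
  proof (cases "\<nu> > 0")
    case True
    show ?thesis using pos[OF True Q c e eb f] True by simp
  next
    case False
    then have "- \<nu> > 0" using \<nu> by simp
    have "cmod (e (- (- x))) \<le> \<Phi> / - \<nu>"
    proof (rule pos[OF \<open>- \<nu> > 0\<close> small_potential_reflect[OF Q], where c = "\<lambda>x. c (- x)" and f = "\<lambda>x. - f (- x)"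
          and e = "\<lambda>x. e (- x)"])
      show "continuous_on UNIV (\<lambda>x. c (- x))" "continuous_on UNIV (\<lambda>x. - f (- x))"
        by (intro continuous_intros continuous_on_compose2[OF c(1)] continuous_on_compose2[OF f(1)]; simp)+
      show "((\<lambda>x. e (- x)) has_vector_derivative
          (complex_of_real (2 * - \<nu>) - - Q (- x) * c (- x)) * e (- x) + - f (- x)) (at x)" for x
        using has_vector_derivative_reflect[OF e[of "- x"]] by (simp add: algebra_simps)
      show "bounded (range (\<lambda>x. e (- x)))"
        using eb unfolding bounded_iff by auto
    qed (use c f in auto)
    then show ?thesis using False by simp
  qed
qed

section \<open>Differentiation of the Riccati solution in a parameter\<close>

lemma has_vector_derivative_within_if_quotient_bound:
  fixes f :: "real \<Rightarrow> complex"
  assumes "(\<Psi> \<longlongrightarrow> 0) (at t within I)"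
    and "\<And>\<tau>. \<tau> \<in> I \<Longrightarrow> \<tau> \<noteq> t \<Longrightarrow> cmod ((f \<tau> - f t) / complex_of_real (\<tau> - t) - d) \<le> \<Psi> \<tau>"
  shows "(f has_vector_derivative d) (at t within I)"
  unfolding has_vector_derivative_def has_derivative_iff_norm
proof (intro conjI bounded_linear_scaleR_left Lim_null_comparison[OF _ assms(1)])
  show "\<forall>\<^sub>F \<tau> in at t within I. norm (cmod (f \<tau> - f t - (\<tau> - t) *\<^sub>R d) / norm (\<tau> - t)) \<le> \<Psi> \<tau>"
    unfolding eventually_at_filter
  proof (intro always_eventually allI impI)
    fix \<tau> assume "\<tau> \<noteq> t" "\<tau> \<in> I"
    have "u - z * d = z * (u / z - d)" if "z \<noteq> 0" for u z
      using that by (simp add: right_diff_distrib)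
    from this[of "complex_of_real (\<tau> - t)" "f \<tau> - f t"]
    have "f \<tau> - f t - (\<tau> - t) *\<^sub>R d
        = complex_of_real (\<tau> - t) * ((f \<tau> - f t) / complex_of_real (\<tau> - t) - d)"
      using \<open>\<tau> \<noteq> t\<close> by (simp add: scaleR_conv_of_real)
    then show "norm (cmod (f \<tau> - f t - (\<tau> - t) *\<^sub>R d) / norm (\<tau> - t)) \<le> \<Psi> \<tau>"
      using assms(2)[OF \<open>\<tau> \<in> I\<close> \<open>\<tau> \<noteq> t\<close>] \<open>\<tau> \<noteq> t\<close> by (simp add: norm_mult del: of_real_diff)
  qed
qed

text \<open>
  The error \<open>e = (a\<^sub>\<tau> - a\<^sub>t)/(\<tau> - t) - v\<close> satisfies the equation of \<open>riccati_difference_bound\<close>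
  with \<open>c = a\<^sub>\<tau> + a\<^sub>t\<close>. Its source consists of the errors of the difference quotients of \<open>Q\<close> and
  \<open>R\<close>, which are at most \<open>\<eta> \<tau>\<close>, and of the change of the coefficient \<open>Q c\<close>, which is of size
  \<open>\<bar>\<tau> - t\<bar>\<close> by the same a priori bound applied to \<open>a\<^sub>\<tau> - a\<^sub>t\<close>. So the error tends to zero, which
  gives differentiability in time together with the value of the derivative.
\<close>
theorem riccati_time_derivative:
  fixes Q R a :: "real \<Rightarrow> real \<Rightarrow> complex"
  assumes \<nu>: "\<nu> \<noteq> 0" and t: "t \<in> I"
    and Q: "\<And>\<tau>. \<tau> \<in> I \<Longrightarrow> small_potential \<nu> (Q \<tau>)"
    and R: "\<And>\<tau>. \<tau> \<in> I \<Longrightarrow> small_potential \<nu> (R \<tau>)"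
    and a: "\<And>\<tau> x. \<tau> \<in> I \<Longrightarrow> (a \<tau> has_vector_derivative
               (complex_of_real (2 * \<nu>) * a \<tau> x + R \<tau> x - Q \<tau> x * (a \<tau> x)\<^sup>2)) (at x)"
    and ab: "\<And>\<tau> x. \<tau> \<in> I \<Longrightarrow> cmod (a \<tau> x) \<le> 1 / 2"
    and Qt: "continuous_on UNIV Qt" "\<And>x. cmod (Qt x) \<le> P"
    and Rt: "continuous_on UNIV Rt" "\<And>x. cmod (Rt x) \<le> P"
    and \<eta>: "(\<eta> \<longlongrightarrow> 0) (at t within I)"
    and Q\<eta>: "\<And>\<tau> x. \<tau> \<in> I \<Longrightarrow> \<tau> \<noteq> t \<Longrightarrow> cmod ((Q \<tau> x - Q t x) / complex_of_real (\<tau> - t) - Qt x) \<le> \<eta> \<tau>"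
    and R\<eta>: "\<And>\<tau> x. \<tau> \<in> I \<Longrightarrow> \<tau> \<noteq> t \<Longrightarrow> cmod ((R \<tau> x - R t x) / complex_of_real (\<tau> - t) - Rt x) \<le> \<eta> \<tau>"
    and v: "\<And>x. (v has_vector_derivative
               ((complex_of_real (2 * \<nu>) - 2 * Q t x * a t x) * v x + Rt x - Qt x * (a t x)\<^sup>2)) (at x)"
    and vb: "bounded (range v)"
  shows "((\<lambda>\<tau>. a \<tau> x) has_vector_derivative v x) (at t within I)"
proof -
  have cQ: "continuous_on S (Q \<tau>)" "continuous_on S (R \<tau>)" if "\<tau> \<in> I" for S \<tau>
    using Q[OF that] R[OF that] continuous_on_subset[OF _ subset_UNIV] by (auto simp: small_potential_def)
  have ca: "continuous_on S (a \<tau>)" if "\<tau> \<in> I" for S \<tau>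
    using a[OF that] by (meson continuous_at_imp_continuous_on has_vector_derivative_continuous)
  have cv: "continuous_on S v" for S
    using v by (meson continuous_at_imp_continuous_on has_vector_derivative_continuous)
  have "bounded (range (Q t))" using Q[OF t] by (simp add: small_potential_def)
  then obtain BQ where BQ: "\<And>x. cmod (Q t x) \<le> BQ"
    unfolding bounded_iff by auto
  obtain V where V: "\<And>x. cmod (v x) \<le> V" using vb unfolding bounded_iff by auto
  have "BQ \<ge> 0" "V \<ge> 0" using order_trans[OF norm_ge_zero BQ] order_trans[OF norm_ge_zero V] .
  \<comment> \<open>\<open>E \<tau>\<close> bounds the increments of \<open>Q\<close> and \<open>R\<close>, and \<open>\<Phi> \<tau>\<close> the source in the equation of the error.\<close>
  define E where "E \<tau> = \<bar>\<tau> - t\<bar> * (\<eta> \<tau> + P)" for \<tau>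
  define \<Phi> where "\<Phi> \<tau> = 2 * \<eta> \<tau> + (E \<tau> + BQ * (2 * E \<tau> / \<bar>\<nu>\<bar>)) * V" for \<tau>
  have E0: "(E \<longlongrightarrow> 0 * (0 + P)) (at t within I)"
    unfolding E_def by (intro tendsto_intros \<eta>) (auto intro!: tendsto_eq_intros)
  have "(\<Phi> \<longlongrightarrow> 2 * 0 + (0 + BQ * (2 * 0 / \<bar>\<nu>\<bar>)) * V) (at t within I)"
    unfolding \<Phi>_def using E0 \<nu> by (intro tendsto_intros \<eta>) auto
  then have lim: "((\<lambda>\<tau>. \<Phi> \<tau> / \<bar>\<nu>\<bar>) \<longlongrightarrow> 0) (at t within I)"
    using tendsto_divide[OF _ tendsto_const, of \<Phi> 0 "at t within I" "\<bar>\<nu>\<bar>"] \<nu> by simp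
  have sq: "cmod ((a t x)\<^sup>2) \<le> 1" for x
    unfolding norm_power using ab[OF t, of x] by (intro power_le_one) auto
  have main: "cmod ((a \<tau> x - a t x) / complex_of_real (\<tau> - t) - v x) \<le> \<Phi> \<tau> / \<bar>\<nu>\<bar>"
    if \<tau>: "\<tau> \<in> I" "\<tau> \<noteq> t" for \<tau> x
  proof -
    define d where "d = complex_of_real (\<tau> - t)"
    have d0: "d \<noteq> 0" using \<tau> by (simp add: d_def)
    have nd: "cmod d = \<bar>\<tau> - t\<bar>" unfolding d_def by (rule norm_of_real)
    have incr: "cmod u \<le> E \<tau>" if "cmod (u / d - w) \<le> \<eta> \<tau>" "cmod w \<le> P" for u w
    proof -
      have "cmod (u / d) \<le> \<eta> \<tau> + P"
        using norm_triangle_sub[of "u / d" w] that by simp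
      then have "cmod d * cmod (u / d) \<le> E \<tau>" unfolding E_def nd by (intro mult_left_mono) auto
      then show ?thesis using d0 by (simp add: norm_divide)
    qed
    have QE: "cmod (Q \<tau> x - Q t x) \<le> E \<tau>" and RE: "cmod (R \<tau> x - R t x) \<le> E \<tau>" for x
      using incr[OF Q\<eta>[OF \<tau>, folded d_def] Qt(2)] incr[OF R\<eta>[OF \<tau>, folded d_def] Rt(2)] .
    have E0: "E \<tau> \<ge> 0" using order_trans[OF norm_ge_zero QE] .
    have csum: "continuous_on UNIV (\<lambda>x. a \<tau> x + a t x)" by (intro continuous_intros ca \<tau> t)
    have bsum: "cmod (a \<tau> x + a t x) \<le> 1" for x
      using norm_triangle_ineq[of "a \<tau> x" "a t x"] ab[OF \<tau>(1), of x] ab[OF t, of x] by simp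
    have hb: "cmod (a \<tau> x - a t x) \<le> 2 * E \<tau> / \<bar>\<nu>\<bar>" for x
    proof (rule riccati_difference_bound[OF \<nu> Q[OF \<tau>(1)] csum bsum,
          where e = "\<lambda>x. a \<tau> x - a t x" and f = "\<lambda>x. (R \<tau> x - R t x) - (Q \<tau> x - Q t x) * (a t x)\<^sup>2"])
      show "((\<lambda>x. a \<tau> x - a t x) has_vector_derivative
          (complex_of_real (2 * \<nu>) - Q \<tau> x * (a \<tau> x + a t x)) * (a \<tau> x - a t x)
            + (R \<tau> x - R t x - (Q \<tau> x - Q t x) * (a t x)\<^sup>2)) (at x)" for x
        by (rule has_vector_derivative_eq_rhs, (rule a \<tau> t derivative_eq_intros refl)+)
           (simp add: algebra_simps power2_eq_square)
      have "cmod (a \<tau> x - a t x) \<le> 1" for x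
        using norm_triangle_ineq4[of "a \<tau> x" "a t x"] ab[OF \<tau>(1), of x] ab[OF t, of x] by simp
      then show "bounded (range (\<lambda>x. a \<tau> x - a t x))" by (intro boundedI[of _ 1]) auto
      show "continuous_on UNIV (\<lambda>x. R \<tau> x - R t x - (Q \<tau> x - Q t x) * (a t x)\<^sup>2)"
        by (intro continuous_intros cQ ca \<tau> t)
      show "cmod (R \<tau> x - R t x - (Q \<tau> x - Q t x) * (a t x)\<^sup>2) \<le> 2 * E \<tau>" for x
      proof -
        have "cmod ((Q \<tau> x - Q t x) * (a t x)\<^sup>2) \<le> E \<tau> * 1"
          unfolding norm_mult by (intro mult_mono QE sq E0) auto
        then show ?thesis
          using norm_triangle_ineq4[of "R \<tau> x - R t x" "(Q \<tau> x - Q t x) * (a t x)\<^sup>2"] RE[of x] by simp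
      qed
    qed
    define f where "f x = ((R \<tau> x - R t x) / d - Rt x) - ((Q \<tau> x - Q t x) / d - Qt x) * (a t x)\<^sup>2
        - ((Q \<tau> x - Q t x) * (a \<tau> x + a t x) + Q t x * (a \<tau> x - a t x)) * v x" for x
    have "cmod ((a \<tau> x - a t x) / d - v x) \<le> \<Phi> \<tau> / \<bar>\<nu>\<bar>"
    proof (rule riccati_difference_bound[OF \<nu> Q[OF \<tau>(1)] csum bsum,
          where e = "\<lambda>x. (a \<tau> x - a t x) / d - v x" and f = f])
      show "((\<lambda>x. (a \<tau> x - a t x) / d - v x) has_vector_derivative
          (complex_of_real (2 * \<nu>) - Q \<tau> x * (a \<tau> x + a t x)) * ((a \<tau> x - a t x) / d - v x) + f x) (at x)" for x
        unfolding f_def divide_inverse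
        by (rule has_vector_derivative_eq_rhs,
            (rule a v \<tau> t has_vector_derivative_mult_left derivative_eq_intros refl)+)
           (use d0 in \<open>simp add: field_simps power2_eq_square\<close>)
      have "cmod ((a \<tau> x - a t x) / d - v x) \<le> 2 * E \<tau> / \<bar>\<nu>\<bar> / cmod d + V" for x
        using norm_triangle_ineq4[of "(a \<tau> x - a t x) / d" "v x"] V[of x] divide_right_mono[OF hb[of x], of "cmod d"]
        by (simp add: norm_divide)
      then show "bounded (range (\<lambda>x. (a \<tau> x - a t x) / d - v x))" by (intro boundedI) auto
      show "continuous_on UNIV f" unfolding f_def
        by (intro continuous_intros cQ ca cv \<tau> t Qt Rt) (use d0 in auto)
      show "cmod (f x) \<le> \<Phi> \<tau>" for x
      proof -
        have 1: "cmod ((R \<tau> x - R t x) / d - Rt x) \<le> \<eta> \<tau>" "cmod ((Q \<tau> x - Q t x) / d - Qt x) \<le> \<eta> \<tau>"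
          using R\<eta>[OF \<tau>, of x] Q\<eta>[OF \<tau>, of x] by (simp_all add: d_def)
        have 2: "cmod (((Q \<tau> x - Q t x) / d - Qt x) * (a t x)\<^sup>2) \<le> \<eta> \<tau> * 1"
          unfolding norm_mult by (intro mult_mono 1 sq order_trans[OF norm_ge_zero 1(1)]) auto
        have "cmod (Q t x * (a \<tau> x - a t x)) \<le> BQ * (2 * E \<tau> / \<bar>\<nu>\<bar>)"
          unfolding norm_mult by (intro mult_mono BQ hb \<open>BQ \<ge> 0\<close>) auto
        moreover have "BQ * (2 * E \<tau> / \<bar>\<nu>\<bar>) \<ge> 0" using \<open>BQ \<ge> 0\<close> E0 by simp
        moreover have "cmod ((Q \<tau> x - Q t x) * (a \<tau> x + a t x)) \<le> E \<tau> * 1"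
          unfolding norm_mult by (intro mult_mono QE bsum E0) auto
        ultimately have "cmod ((Q \<tau> x - Q t x) * (a \<tau> x + a t x) + Q t x * (a \<tau> x - a t x))
              \<le> E \<tau> + BQ * (2 * E \<tau> / \<bar>\<nu>\<bar>)"
          using norm_triangle_ineq[of "(Q \<tau> x - Q t x) * (a \<tau> x + a t x)" "Q t x * (a \<tau> x - a t x)"]
          by linarith
        then have 3: "cmod (((Q \<tau> x - Q t x) * (a \<tau> x + a t x) + Q t x * (a \<tau> x - a t x)) * v x)
              \<le> (E \<tau> + BQ * (2 * E \<tau> / \<bar>\<nu>\<bar>)) * V"
          unfolding norm_mult[of _ "v x"] using V[of x] \<open>V \<ge> 0\<close> \<open>BQ \<ge> 0\<close> E0 by (intro mult_mono) auto
        show ?thesis unfolding f_def \<Phi>_def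
          by (rule order_trans[OF norm_triangle_ineq4 order_trans[OF add_mono[OF norm_triangle_ineq4 order_refl]]])
             (use 1 2 3 in linarith)
      qed
    qed
    then show ?thesis by (simp add: d_def)
  qed
  show ?thesis
    by (rule has_vector_derivative_within_if_quotient_bound[OF lim main])
qed

section \<open>Absolutely continuous functions\<close>

text \<open>
  The interchanges of complex-valued integrals below have the form \<open>p(x) K(x,y) w(y)\<close> with
  integrable \<open>p\<close>, \<open>w\<close> and bounded \<open>K\<close>.
\<close>
lemma integrable_product_bounded_kernel:
  fixes p w :: "real \<Rightarrow> complex" and K :: "real \<Rightarrow> real \<Rightarrow> complex"
  assumes p: "integrable lborel p" and w: "integrable lborel w"
    and K: "case_prod K \<in> borel_measurable (borel \<Otimes>\<^sub>M borel)" "\<And>x y. cmod (K x y) \<le> C"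
  shows "integrable (lborel \<Otimes>\<^sub>M lborel) (\<lambda>(x, y). p x * K x y * w y)"
proof -
  have [measurable]: "p \<in> borel_measurable borel" "w \<in> borel_measurable borel"
    using p w by (auto dest: borel_measurable_integrable)
  note K(1)[measurable]
  have "C \<ge> 0" using order_trans[OF norm_ge_zero K(2)] .
  have "integrable (lborel \<Otimes>\<^sub>M lborel) (\<lambda>z. C *\<^sub>R (p (fst z) * w (snd z)))"
  proof (intro integrable_scaleR_right impI)
    show "integrable (lborel \<Otimes>\<^sub>M lborel) (\<lambda>z. p (fst z) * w (snd z))"
      by (rule lborel_pair.Fubini_integrable) (use p w in \<open>auto simp: norm_mult\<close>)
  qed
  then show ?thesis
  proof (rule Bochner_Integration.integrable_bound)
    show "(\<lambda>(x, y). p x * K x y * w y) \<in> borel_measurable (lborel \<Otimes>\<^sub>M lborel)" by measurable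
    show "AE z in lborel \<Otimes>\<^sub>M lborel. norm (case z of (x, y) \<Rightarrow> p x * K x y * w y)
        \<le> norm (C *\<^sub>R (p (fst z) * w (snd z)))"
    proof (intro AE_I2, clarsimp simp: norm_mult)
      fix x y
      have "cmod (K x y) * (cmod (p x) * cmod (w y)) \<le> \<bar>C\<bar> * (cmod (p x) * cmod (w y))"
        using K(2)[of x y] \<open>C \<ge> 0\<close> by (intro mult_right_mono) auto
      then show "cmod (p x) * cmod (K x y) * cmod (w y) \<le> \<bar>C\<bar> * (cmod (p x) * cmod (w y))"
        by (simp add: mult_ac)
    qed
  qed
qed

lemma Fubini_bounded_kernel:
  fixes p w :: "real \<Rightarrow> complex" and K :: "real \<Rightarrow> real \<Rightarrow> complex"
  assumes "integrable lborel p" and "integrable lborel w"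
    and "case_prod K \<in> borel_measurable (borel \<Otimes>\<^sub>M borel)" "\<And>x y. cmod (K x y) \<le> C"
  shows "(LINT x|lborel. p x * (LINT y|lborel. K x y * w y))
       = (LINT y|lborel. (LINT x|lborel. p x * K x y) * w y)"
proof -
  have "(LINT x|lborel. p x * (LINT y|lborel. K x y * w y))
      = (LINT x|lborel. (LINT y|lborel. p x * K x y * w y))"
    by (simp add: mult.assoc)
  also have "\<dots> = (LINT y|lborel. (LINT x|lborel. p x * K x y * w y))"
    using lborel_pair.Fubini_integral[OF integrable_product_bounded_kernel[OF assms]] by simp
  finally show ?thesis by (simp only: integral_mult_left_zero)
qed

text \<open>
  \<open>u\<close> is locally absolutely continuous with almost everywhere derivative \<open>v\<close>, expressed
  through the fundamental theorem of calculus, which is the form of the derivative in the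
  definition of the domain of \<open>L(\<kappa>)\<close>.
\<close>
definition ac_deriv :: "(real \<Rightarrow> complex) \<Rightarrow> (real \<Rightarrow> complex) \<Rightarrow> bool" where
  "ac_deriv u v \<longleftrightarrow> (\<forall>a b. a \<le> b \<longrightarrow>
     set_integrable lborel {a..b} v \<and> (LINT x:{a..b}|lborel. v x) = u b - u a)"

lemma ac_deriv_continuous:
  assumes "ac_deriv u v"
  shows "continuous_on UNIV u"
proof -
  have "isCont u x" for x
  proof -
    have si: "set_integrable lborel {x-1..y} v" if "x - 1 \<le> y" for y
      using assms that by (simp add: ac_deriv_def)
    have u: "u y = u (x-1) + integral {x-1..y} v" if "x - 1 \<le> y" for y
    proof -
      have "integral {x-1..y} v = (LINT z:{x-1..y}|lborel. v z)"
        using set_borel_integral_eq_integral(2)[OF si[OF that]] by simp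
      also have "\<dots> = u y - u (x-1)" using assms that by (auto simp: ac_deriv_def)
      finally show ?thesis by simp
    qed
    have "continuous_on {x-1..x+1} (\<lambda>y. u (x-1) + integral {x-1..y} v)"
      by (intro continuous_intros indefinite_integral_continuous_1
            set_borel_integral_eq_integral(1) si) simp
    then have "continuous_on {x-1..x+1} u"
      by (rule continuous_on_eq) (auto intro!: u[symmetric])
    then show ?thesis
      by (rule continuous_on_interior) simp
  qed
  then show ?thesis by (simp add: continuous_at_imp_continuous_on)
qed

lemma set_integrable_continuous_mult:
  fixes v \<phi> :: "real \<Rightarrow> complex"
  assumes v: "set_integrable lborel {a..b} v" and \<phi>: "continuous_on UNIV \<phi>"
  shows "set_integrable lborel {a..b} (\<lambda>x. \<phi> x * v x)"
proof -
  have "bounded (\<phi> ` {a..b})"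
    by (intro compact_imp_bounded compact_continuous_image continuous_on_subset[OF \<phi>]) auto
  then obtain C where "\<forall>z\<in>\<phi> ` {a..b}. cmod z \<le> C" unfolding bounded_iff by blast
  then have C: "cmod (\<phi> x) \<le> C" if "x \<in> {a..b}" for x using that by blast
  have [measurable]: "\<phi> \<in> borel_measurable borel" by (rule borel_measurable_continuous_onI[OF \<phi>])
  have [measurable]: "(\<lambda>x. indicat_real {a..b} x *\<^sub>R v x) \<in> borel_measurable borel"
    using v by (auto simp: set_integrable_def dest: borel_measurable_integrable)
  have "integrable lborel (\<lambda>x. C *\<^sub>R (indicat_real {a..b} x *\<^sub>R v x))"
    unfolding set_integrable_def[symmetric] using v
    by (auto simp: set_integrable_def intro!: Bochner_Integration.integrable_scaleR_right simp del: scaleR_scaleR)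
  then have "integrable lborel (\<lambda>x. \<phi> x * (indicat_real {a..b} x *\<^sub>R v x))"
  proof (rule Bochner_Integration.integrable_bound)
    show "AE x in lborel. norm (\<phi> x * (indicat_real {a..b} x *\<^sub>R v x))
      \<le> norm (C *\<^sub>R (indicat_real {a..b} x *\<^sub>R v x))"
      by (intro AE_I2) (use C in \<open>force simp: norm_mult indicator_def intro!: mult_right_mono\<close>)
  qed measurable
  then show ?thesis by (simp add: set_integrable_def)
qed

text \<open>
  As \<open>u\<close> is differentiable almost everywhere at best, integration by parts is done by Fubini
  over the triangle \<open>a \<le> y \<le> x \<le> b\<close>, whose indicator is the kernel \<open>K\<close>: integrating
  \<open>\<phi>'(x) v(y)\<close> first in \<open>y\<close> produces \<open>\<phi>'u\<close>, first in \<open>x\<close> it produces \<open>\<phi>v\<close>.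
\<close>
theorem ac_deriv_mult:
  fixes \<phi> \<phi>' :: "real \<Rightarrow> complex"
  assumes u: "ac_deriv u v"
    and \<phi>: "\<And>x. (\<phi> has_vector_derivative \<phi>' x) (at x)" and \<phi>': "continuous_on UNIV \<phi>'"
  shows "ac_deriv (\<lambda>x. \<phi> x * u x) (\<lambda>x. \<phi>' x * u x + \<phi> x * v x)"
  unfolding ac_deriv_def
proof (intro allI impI)
  fix a b :: real assume le: "a \<le> b"
  have c\<phi>: "continuous_on UNIV \<phi>"
    using \<phi> by (meson continuous_at_imp_continuous_on has_vector_derivative_continuous)
  have [measurable]: "\<phi> \<in> borel_measurable borel" "\<phi>' \<in> borel_measurable borel"
    by (auto intro!: borel_measurable_continuous_onI c\<phi> \<phi>')
  have vi: "set_integrable lborel {a..b} v" and vu: "(LINT x:{a..b}|lborel. v x) = u b - u a"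
    using u le by (auto simp: ac_deriv_def)
  have vx: "(LINT y:{a..x}|lborel. v y) = u x - u a" if "x \<in> {a..b}" for x
    using u that by (auto simp: ac_deriv_def)
  have pi: "set_integrable lborel {a..b} \<phi>'"
    by (rule borel_integrable_atLeastAtMost') (rule continuous_on_subset[OF \<phi>'], simp)
  have i1: "set_integrable lborel {a..b} (\<lambda>x. \<phi>' x * u x)"
    by (rule borel_integrable_atLeastAtMost')
       (rule continuous_on_subset[OF continuous_on_mult[OF \<phi>' ac_deriv_continuous[OF u]]], simp)
  have i2: "set_integrable lborel {a..b} (\<lambda>x. \<phi> x * v x)"
    by (rule set_integrable_continuous_mult[OF vi c\<phi>])
  show "set_integrable lborel {a..b} (\<lambda>x. \<phi>' x * u x + \<phi> x * v x) \<and>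
        (LINT x:{a..b}|lborel. \<phi>' x * u x + \<phi> x * v x) = \<phi> b * u b - \<phi> a * u a"
  proof (intro conjI set_integral_add(1) i1 i2)
    have d\<phi>: "(LINT x:{y..b}|lborel. \<phi>' x) = \<phi> b - \<phi> y" if "y \<le> b" for y
    proof -
      have "set_integrable lborel {y..b} \<phi>'"
        by (rule borel_integrable_atLeastAtMost') (rule continuous_on_subset[OF \<phi>'], simp)
      then have "(LINT x:{y..b}|lborel. \<phi>' x) = integral {y..b} \<phi>'"
        by (rule set_borel_integral_eq_integral)
      also have "(\<phi>' has_integral \<phi> b - \<phi> y) {y..b}"
        by (rule fundamental_theorem_of_calculus[OF that]) (rule has_vector_derivative_at_within[OF \<phi>])
      then have "integral {y..b} \<phi>' = \<phi> b - \<phi> y" by (rule integral_unique)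
      finally show ?thesis .
    qed
    define p w where "p x = indicat_real {a..b} x *\<^sub>R \<phi>' x"
      and "w x = indicat_real {a..b} x *\<^sub>R v x" for x
    define K :: "real \<Rightarrow> real \<Rightarrow> complex" where "K x y = (if y \<le> x then 1 else 0)" for x y
    have "(LINT x|lborel. p x * (LINT y|lborel. K x y * w y))
       = (LINT y|lborel. (LINT x|lborel. p x * K x y) * w y)"
      by (rule Fubini_bounded_kernel[where C = 1])
         (use pi vi in \<open>auto simp: p_def w_def set_integrable_def K_def\<close>)
    also have "(LINT x|lborel. p x * (LINT y|lborel. K x y * w y))
        = (LINT x:{a..b}|lborel. \<phi>' x * u x - u a * \<phi>' x)"
      unfolding set_lebesgue_integral_def
    proof (rule Bochner_Integration.integral_cong[OF refl])
      fix x
      show "p x * (LINT y|lborel. K x y * w y) = indicat_real {a..b} x *\<^sub>R (\<phi>' x * u x - u a * \<phi>' x)"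
      proof (cases "x \<in> {a..b}")
        case True
        have "(LINT y|lborel. K x y * w y) = (LINT y:{a..x}|lborel. v y)"
          unfolding set_lebesgue_integral_def
          by (rule Bochner_Integration.integral_cong[OF refl])
             (use True in \<open>auto simp: K_def w_def indicator_def\<close>)
        also have "\<dots> = u x - u a" by (rule vx[OF True])
        finally show ?thesis by (simp only:) (use True in \<open>simp add: p_def algebra_simps\<close>)
      qed (simp add: p_def)
    qed
    also have "\<dots> = (LINT x:{a..b}|lborel. \<phi>' x * u x) - u a * (\<phi> b - \<phi> a)"
      using set_integral_diff(2)[OF i1 set_integrable_mult_right[where a = "u a", OF pi]] d\<phi>[OF le] by simp
    also have "(LINT y|lborel. (LINT x|lborel. p x * K x y) * w y)
        = (LINT y:{a..b}|lborel. \<phi> b * v y - \<phi> y * v y)"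
      unfolding set_lebesgue_integral_def
    proof (rule Bochner_Integration.integral_cong[OF refl])
      fix y
      show "(LINT x|lborel. p x * K x y) * w y = indicat_real {a..b} y *\<^sub>R (\<phi> b * v y - \<phi> y * v y)"
      proof (cases "y \<in> {a..b}")
        case True
        have "(LINT x|lborel. p x * K x y) = (LINT x:{y..b}|lborel. \<phi>' x)"
          unfolding set_lebesgue_integral_def
          by (rule Bochner_Integration.integral_cong[OF refl])
             (use True in \<open>auto simp: K_def p_def indicator_def\<close>)
        also have "\<dots> = \<phi> b - \<phi> y" by (rule d\<phi>) (use True in simp)
        finally show ?thesis by (simp only:) (use True in \<open>simp add: w_def algebra_simps\<close>)
      qed (simp add: w_def)
    qed
    also have "\<dots> = \<phi> b * (u b - u a) - (LINT x:{a..b}|lborel. \<phi> x * v x)"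
      using set_integral_diff(2)[OF set_integrable_mult_right[where a = "\<phi> b", OF vi] i2] vu by simp
    finally show "(LINT x:{a..b}|lborel. \<phi>' x * u x + \<phi> x * v x) = \<phi> b * u b - \<phi> a * u a"
      using set_integral_add(2)[OF i1 i2] by (simp add: algebra_simps)
  qed
qed

lemma ac_deriv_diff:
  assumes "ac_deriv u v" "ac_deriv u' v'"
  shows "ac_deriv (\<lambda>x. u x - u' x) (\<lambda>x. v x - v' x)"
  using assms unfolding ac_deriv_def by (simp add: set_integral_diff)

lemma ac_deriv_add:
  assumes "ac_deriv u v" "ac_deriv u' v'"
  shows "ac_deriv (\<lambda>x. u x + u' x) (\<lambda>x. v x + v' x)"
  using assms unfolding ac_deriv_def by (simp add: set_integral_add)

section \<open>Square-integrable functions\<close>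

definition square_integrable :: "(real \<Rightarrow> complex) \<Rightarrow> bool" where
  "square_integrable f \<longleftrightarrow> f \<in> borel_measurable lborel \<and> integrable lborel (\<lambda>x. (cmod (f x))\<^sup>2)"

lemma square_integrable_prod:
  assumes "square_integrable f" "square_integrable g"
  shows "integrable lborel (\<lambda>x. f x * g x)"
proof (rule Bochner_Integration.integrable_bound)
  show "integrable lborel (\<lambda>x. (cmod (f x))\<^sup>2 + (cmod (g x))\<^sup>2)"
    using assms by (auto simp: square_integrable_def)
  show "(\<lambda>x. f x * g x) \<in> borel_measurable lborel"
    using assms by (auto simp: square_integrable_def)
  show "AE x in lborel. norm (f x * g x) \<le> norm ((cmod (f x))\<^sup>2 + (cmod (g x))\<^sup>2)"
  proof (intro AE_I2)
    fix x
    have "2 * (cmod (f x) * cmod (g x)) \<le> (cmod (f x))\<^sup>2 + (cmod (g x))\<^sup>2"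
      using sum_squares_bound[of "cmod (f x)" "cmod (g x)"] by simp
    moreover have "cmod (f x) * cmod (g x) \<ge> 0" by simp
    ultimately show "norm (f x * g x) \<le> norm ((cmod (f x))\<^sup>2 + (cmod (g x))\<^sup>2)"
      unfolding norm_mult real_norm_def by linarith
  qed
qed

lemma square_integrable_bounded_mult:
  assumes f: "square_integrable f" and [measurable]: "m \<in> borel_measurable borel" and m: "\<And>x. cmod (m x) \<le> C"
  shows "square_integrable (\<lambda>x. m x * f x)"
  unfolding square_integrable_def
proof
  have [measurable]: "f \<in> borel_measurable borel" using f by (simp add: square_integrable_def)
  show "(\<lambda>x. m x * f x) \<in> borel_measurable lborel" by measurable
  have "integrable lborel (\<lambda>x. C\<^sup>2 * (cmod (f x))\<^sup>2)"
    using f by (auto simp: square_integrable_def)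
  then show "integrable lborel (\<lambda>x. (cmod (m x * f x))\<^sup>2)"
    by (rule Bochner_Integration.integrable_bound)
       (auto simp: norm_mult power_mult_distrib intro!: mult_right_mono power_mono m)
qed

lemma square_integrable_add:
  assumes "square_integrable f" "square_integrable g"
  shows "square_integrable (\<lambda>x. f x + g x)"
  unfolding square_integrable_def
proof
  have [measurable]: "f \<in> borel_measurable borel" "g \<in> borel_measurable borel"
    using assms by (auto simp: square_integrable_def)
  show "(\<lambda>x. f x + g x) \<in> borel_measurable lborel" by measurable
  have "integrable lborel (\<lambda>x. 2 * (cmod (f x))\<^sup>2 + 2 * (cmod (g x))\<^sup>2)"
    using assms by (auto simp: square_integrable_def)
  then show "integrable lborel (\<lambda>x. (cmod (f x + g x))\<^sup>2)"
  proof (rule Bochner_Integration.integrable_bound)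
    have "(cmod (f x + g x))\<^sup>2 \<le> 2 * (cmod (f x))\<^sup>2 + 2 * (cmod (g x))\<^sup>2" for x
    proof -
      have "(cmod (f x + g x))\<^sup>2 \<le> (cmod (f x) + cmod (g x))\<^sup>2"
        by (intro power_mono norm_triangle_ineq) auto
      also have "\<dots> \<le> 2 * (cmod (f x))\<^sup>2 + 2 * (cmod (g x))\<^sup>2"
        using sum_squares_bound[of "cmod (f x)" "cmod (g x)"] by (simp add: power2_sum)
      finally show ?thesis .
    qed
    then show "AE x in lborel. norm ((cmod (f x + g x))\<^sup>2) \<le> norm (2 * (cmod (f x))\<^sup>2 + 2 * (cmod (g x))\<^sup>2)"
      by (intro AE_I2) simp
  qed measurable
qed

lemma square_integrable_diff:
  assumes "square_integrable f" "square_integrable g"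
  shows "square_integrable (\<lambda>x. f x - g x)"
  using square_integrable_add[OF assms(1) square_integrable_bounded_mult[OF assms(2), of "\<lambda>_. -1" 1]]
  by simp

lemma square_integrable_imp_set_integrable:
  assumes "square_integrable f"
  shows "set_integrable lborel {a..b} f"
proof -
  have "square_integrable (\<lambda>x. complex_of_real (indicat_real {a..b} x))"
    unfolding square_integrable_def
  proof
    have "integrable lborel (indicat_real {a..b})" by (rule integrable_real_indicator) (auto simp: emeasure_lborel_Icc_eq)
    then show "integrable lborel (\<lambda>x. (cmod (complex_of_real (indicat_real {a..b} x)))\<^sup>2)"
      by (rule back_subst[of "integrable lborel"]) (auto simp: indicator_def)
  qed measurable
  from square_integrable_prod[OF this assms] show ?thesis
    by (simp add: set_integrable_def scaleR_conv_of_real)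
qed

section \<open>The resolvent of a scalar first-order operator\<close>

text \<open>
  The convolution kernel of the inverse of \<open>d/dx + \<mu>\<close> on \<open>L\<^sup>2\<close>: the exponential \<open>exp(-\<mu>z)\<close> cut
  off to the half-line on which it decays. The value at \<open>z = 0\<close> is the limit from the right
  for both signs of \<open>\<mu>\<close>; thus the jump term in \<open>scalar_kernel_split\<close> vanishes on the diagonal.
\<close>
definition scalar_kernel :: "real \<Rightarrow> real \<Rightarrow> complex" where
  "scalar_kernel \<mu> z = complex_of_real
     ((if 0 \<le> z then (if 0 < \<mu> then 1 else 0) else (if 0 < \<mu> then 0 else - 1)) * exp (- \<mu> * z))"

lemma scalar_kernel_measurable[measurable]: "scalar_kernel \<mu> \<in> borel_measurable borel"
  unfolding scalar_kernel_def by measurable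

lemma scalar_kernel_bound:
  assumes "\<mu> \<noteq> 0"
  shows "cmod (scalar_kernel \<mu> z) \<le> exp (- \<bar>\<mu>\<bar> * \<bar>z\<bar>)"
  unfolding scalar_kernel_def norm_of_real
  using assms by (cases "0 \<le> z"; cases "0 < \<mu>") (simp_all add: abs_if)

lemma exp_abs_integrable:
  assumes "\<mu> \<noteq> 0"
  shows "integrable lborel (\<lambda>z::real. exp (- \<bar>\<mu>\<bar> * \<bar>z\<bar>))"
proof -
  have 1: "integrable lborel (\<lambda>z. indicat_real {0..} z *\<^sub>R exp (- \<bar>\<mu>\<bar> * z))"
    using exp_decay_integral(1)[of "\<bar>\<mu>\<bar>" 0] assms by (simp add: set_integrable_def)
  from lborel_integrable_real_affine[OF this, of "-1" 0]
  have 2: "integrable lborel (\<lambda>z. indicat_real {0..} (- z) *\<^sub>R exp (- \<bar>\<mu>\<bar> * (- z)))" by simp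
  from Bochner_Integration.integrable_add[OF 1 2] show ?thesis
    by (rule Bochner_Integration.integrable_bound) (auto simp: indicator_def)
qed

lemma scalar_kernel_integrable_mult:
  assumes "\<mu> \<noteq> 0" and f: "square_integrable f"
  shows "integrable lborel (\<lambda>y. scalar_kernel \<mu> (x - y) * f y)"
proof (rule square_integrable_prod[OF _ f])
  have "integrable lborel (\<lambda>y. exp (- \<bar>2 * \<mu>\<bar> * \<bar>x + - 1 * y\<bar>))"
    by (rule lborel_integrable_real_affine[OF exp_abs_integrable]) (use assms in auto)
  then have "integrable lborel (\<lambda>y. (cmod (scalar_kernel \<mu> (x - y)))\<^sup>2)"
  proof (rule Bochner_Integration.integrable_bound)
    have "(cmod (scalar_kernel \<mu> z))\<^sup>2 \<le> exp (- \<bar>2 * \<mu>\<bar> * \<bar>z\<bar>)" for z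
    proof -
      have "(cmod (scalar_kernel \<mu> z))\<^sup>2 \<le> (exp (- \<bar>\<mu>\<bar> * \<bar>z\<bar>))\<^sup>2"
        by (intro power_mono scalar_kernel_bound assms) auto
      then show ?thesis by (simp add: power2_eq_square abs_mult mult.assoc flip: exp_add)
    qed
    then show "AE y in lborel. norm ((cmod (scalar_kernel \<mu> (x - y)))\<^sup>2)
        \<le> norm (exp (- \<bar>2 * \<mu>\<bar> * \<bar>x + - 1 * y\<bar>))"
      by (intro AE_I2) (simp add: abs_mult)
  qed measurable
  then show "square_integrable (\<lambda>y. scalar_kernel \<mu> (x - y))"
    by (simp add: square_integrable_def)
qed

text \<open>
  Young's inequality for convolution with an integrable kernel, by splitting the exponential
  majorant as \<open>e = h\<^sup>2\<close>, Cauchy-Schwarz and Tonelli.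
\<close>
lemma square_integrable_scalar_resolvent:
  assumes \<mu>: "\<mu> \<noteq> 0" and f: "square_integrable f"
  shows "square_integrable (\<lambda>x. LINT y|lborel. scalar_kernel \<mu> (x - y) * f y)"
  unfolding square_integrable_def
proof
  have [measurable]: "f \<in> borel_measurable borel" using f by (simp add: square_integrable_def)
  let ?u = "\<lambda>x. LINT y|lborel. scalar_kernel \<mu> (x - y) * f y"
  show m[measurable]: "?u \<in> borel_measurable lborel" by measurable
  define e :: "real \<Rightarrow> ennreal" where "e z = ennreal (exp (- \<bar>\<mu>\<bar> * \<bar>z\<bar>))" for z
  define h :: "real \<Rightarrow> ennreal" where "h z = ennreal (exp (- \<bar>\<mu>\<bar> * \<bar>z\<bar> / 2))" for z
  have [measurable]: "e \<in> borel_measurable borel" "h \<in> borel_measurable borel"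
    unfolding e_def h_def by measurable
  have hh: "h z * h z = e z" for z
    unfolding e_def h_def by (simp flip: ennreal_mult exp_add)
  define A where "A = (\<integral>\<^sup>+z. e z \<partial>lborel)"
  have Afin: "A < \<infinity>"
    using exp_abs_integrable[OF \<mu>] unfolding A_def e_def by (simp add: integrable_iff_bounded)
  have A1: "(\<integral>\<^sup>+y. e (x - y) \<partial>lborel) = A" for x
    unfolding A_def using nn_integral_real_affine[of e "-1" x] by simp
  have A2: "(\<integral>\<^sup>+x. e (x - y) \<partial>lborel) = A" for y
    unfolding A_def using nn_integral_real_affine[of e 1 "-y"] by simp
  have pt: "ennreal ((cmod (?u x))\<^sup>2) \<le> A * (\<integral>\<^sup>+y. e (x - y) * ennreal ((cmod (f y))\<^sup>2) \<partial>lborel)" for x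
  proof -
    have "ennreal (cmod (?u x)) \<le> (\<integral>\<^sup>+y. ennreal (cmod (scalar_kernel \<mu> (x - y) * f y)) \<partial>lborel)"
      by (rule integral_norm_bound_ennreal[OF scalar_kernel_integrable_mult[OF assms]])
    also have "\<dots> \<le> (\<integral>\<^sup>+y. h (x - y) * (h (x - y) * ennreal (cmod (f y))) \<partial>lborel)"
    proof (rule nn_integral_mono)
      fix y
      have "ennreal (cmod (scalar_kernel \<mu> (x - y) * f y)) \<le> e (x - y) * ennreal (cmod (f y))"
        unfolding norm_mult e_def using scalar_kernel_bound[OF \<mu>]
        by (subst ennreal_mult[symmetric]) (auto intro!: ennreal_leI mult_right_mono)
      then show "ennreal (cmod (scalar_kernel \<mu> (x - y) * f y)) \<le> h (x - y) * (h (x - y) * ennreal (cmod (f y)))"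
        by (simp add: hh flip: mult.assoc)
    qed
    finally have "(ennreal (cmod (?u x)))\<^sup>2 \<le> (\<integral>\<^sup>+y. h (x - y) * (h (x - y) * ennreal (cmod (f y))) \<partial>lborel)\<^sup>2"
      by (rule power_mono) simp
    also have "\<dots> \<le> (\<integral>\<^sup>+y. (h (x - y))\<^sup>2 \<partial>lborel) * (\<integral>\<^sup>+y. (h (x - y) * ennreal (cmod (f y)))\<^sup>2 \<partial>lborel)"
      by (rule Cauchy_Schwarz_nn_integral) measurable
    also have "(\<integral>\<^sup>+y. (h (x - y))\<^sup>2 \<partial>lborel) = A"
      by (simp add: power2_eq_square hh A1)
    also have "(\<integral>\<^sup>+y. (h (x - y) * ennreal (cmod (f y)))\<^sup>2 \<partial>lborel)
        = (\<integral>\<^sup>+y. e (x - y) * ennreal ((cmod (f y))\<^sup>2) \<partial>lborel)"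
      unfolding power_mult_distrib power2_eq_square[of "h _"] hh by (simp add: ennreal_power)
    finally show ?thesis by (simp add: ennreal_power)
  qed
  have "(\<integral>\<^sup>+x. ennreal ((cmod (?u x))\<^sup>2) \<partial>lborel)
      \<le> (\<integral>\<^sup>+x. A * (\<integral>\<^sup>+y. e (x - y) * ennreal ((cmod (f y))\<^sup>2) \<partial>lborel) \<partial>lborel)"
    by (rule nn_integral_mono) (rule pt)
  also have "\<dots> = A * (\<integral>\<^sup>+x. (\<integral>\<^sup>+y. e (x - y) * ennreal ((cmod (f y))\<^sup>2) \<partial>lborel) \<partial>lborel)"
    by (rule nn_integral_cmult) measurable
  also have "(\<integral>\<^sup>+x. (\<integral>\<^sup>+y. e (x - y) * ennreal ((cmod (f y))\<^sup>2) \<partial>lborel) \<partial>lborel)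
      = (\<integral>\<^sup>+y. (\<integral>\<^sup>+x. e (x - y) * ennreal ((cmod (f y))\<^sup>2) \<partial>lborel) \<partial>lborel)"
    by (rule lborel_pair.Fubini'[symmetric]) measurable
  also have "\<dots> = A * (\<integral>\<^sup>+y. ennreal ((cmod (f y))\<^sup>2) \<partial>lborel)"
    by (simp add: nn_integral_multc nn_integral_cmult A2)
  also have "A * \<dots> < \<infinity>"
  proof -
    have "(\<integral>\<^sup>+y. ennreal ((cmod (f y))\<^sup>2) \<partial>lborel) < \<infinity>"
      using f by (auto simp: square_integrable_def integrable_iff_bounded)
    then show ?thesis using Afin by (simp add: ennreal_mult_less_top)
  qed
  finally show "integrable lborel (\<lambda>x. (cmod (?u x))\<^sup>2)"
    by (simp add: integrable_iff_bounded)
qed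

text \<open>
  The distributional equation \<open>k' + \<mu>k = \<delta>\<close>, integrated over an interval.
\<close>
lemma scalar_kernel_integral:
  assumes \<mu>: "\<mu> \<noteq> 0" and le: "a \<le> b"
  shows "complex_of_real \<mu> * (LINT x:{a..b}|lborel. scalar_kernel \<mu> (x - y))
       = of_real (indicat_real {a<..b} y) - scalar_kernel \<mu> (b - y) + scalar_kernel \<mu> (a - y)"
proof -
  have int: "set_integrable lborel {a..b} (\<lambda>x. scalar_kernel \<mu> (x - y))"
    unfolding set_integrable_def
  proof (rule integrable_mult_indicator)
    have "integrable lborel (\<lambda>x. exp (- \<bar>\<mu>\<bar> * \<bar>- y + 1 * x\<bar>))"
      by (rule lborel_integrable_real_affine[OF exp_abs_integrable]) (use assms in auto)
    then show "integrable lborel (\<lambda>x. scalar_kernel \<mu> (x - y))"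
      by (rule Bochner_Integration.integrable_bound)
         (use scalar_kernel_bound[OF \<mu>] in \<open>auto intro!: AE_I2 simp: add.commute[of "- y"]\<close>)
  qed auto
  \<comment> \<open>\<open>P\<close> is the continuous antiderivative of \<open>\<mu> k\<close>: subtracting the kernel from the Heaviside
    function cancels the jump.\<close>
  define P where "P x = (if y \<le> x then 1 else 0) - scalar_kernel \<mu> (x - y)" for x
  have P: "P x = complex_of_real (if 0 < \<mu> then (if y \<le> x then 1 - exp (- \<mu> * (x - y)) else 0)
                      else (if y \<le> x then 1 else exp (- \<mu> * (x - y))))" for x
    unfolding P_def scalar_kernel_def by auto
  have "((\<lambda>x. complex_of_real \<mu> * scalar_kernel \<mu> (x - y)) has_integral (P b - P a)) {a..b}"
  proof (rule fundamental_theorem_of_calculus_interior_strong[of "{y}"])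
    have "continuous_on UNIV (\<lambda>x. if x \<le> y then (if 0 < \<mu> then 0 else complex_of_real (exp (- \<mu> * (x - y))))
            else (if 0 < \<mu> then complex_of_real (1 - exp (- \<mu> * (x - y))) else 1))"
    proof (rule continuous_on_cases_le[where h = "\<lambda>x. x" and a = y])
    qed (cases "0 < \<mu>"; auto intro!: continuous_intros)+
    also have "(\<lambda>x. if x \<le> y then (if 0 < \<mu> then 0 else complex_of_real (exp (- \<mu> * (x - y))))
            else (if 0 < \<mu> then complex_of_real (1 - exp (- \<mu> * (x - y))) else 1)) = P"
      by (auto simp: P fun_eq_iff)
    finally show "continuous_on {a..b} P" by (rule continuous_on_subset) auto
    show "(P has_vector_derivative complex_of_real \<mu> * scalar_kernel \<mu> (x - y)) (at x)"
      if "x \<in> {a<..<b} - {y}" for x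
    proof -
      define c d where "c = (if y \<le> x then (1::real) else 0)"
        and "d = (if 0 \<le> x - y then (if 0 < \<mu> then 1 else 0) else (if 0 < \<mu> then 0 else - (1::real)))"
      have "((\<lambda>z. complex_of_real (c - d * exp (- \<mu> * (z - y)))) has_vector_derivative
          complex_of_real (\<mu> * (d * exp (- \<mu> * (x - y))))) (at x)"
        by (intro has_vector_derivative_of_real)
           (auto intro!: derivative_eq_intros simp flip: has_real_derivative_iff_has_vector_derivative)
      then have "(P has_vector_derivative complex_of_real (\<mu> * (d * exp (- \<mu> * (x - y))))) (at x)"
      proof (rule has_vector_derivative_transform_within_open)
        show "open (if y < x then {y<..} else {..<y})" by auto
        show "x \<in> (if y < x then {y<..} else {..<y})" using that by auto
        show "complex_of_real (c - d * exp (- \<mu> * (z - y))) = P z"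
          if "z \<in> (if y < x then {y<..} else {..<y})" for z
          using that \<open>x \<in> {a<..<b} - {y}\<close> by (auto simp: P c_def d_def split: if_splits)
      qed
      then show ?thesis by (simp add: scalar_kernel_def d_def)
    qed
  qed (use le in auto)
  then have "integral {a..b} (\<lambda>x. complex_of_real \<mu> * scalar_kernel \<mu> (x - y)) = P b - P a"
    by (rule integral_unique)
  moreover have "integral {a..b} (\<lambda>x. scalar_kernel \<mu> (x - y)) = (LINT x:{a..b}|lborel. scalar_kernel \<mu> (x - y))"
    using set_borel_integral_eq_integral(2)[OF int] by simp
  ultimately have "complex_of_real \<mu> * (LINT x:{a..b}|lborel. scalar_kernel \<mu> (x - y)) = P b - P a" by simp
  then show ?thesis using le by (auto simp: P_def indicator_def)
qed

text \<open>
  Integrating \<open>\<mu>u\<close> over \<open>[a,b]\<close> and interchanging the integrals reduces the claim to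
  \<open>scalar_kernel_integral\<close>. To have an integrable weight although \<open>f\<close> is only in \<open>L\<^sup>2\<close>, the
  factor \<open>exp(-\<bar>\<mu>\<bar>\<bar>y\<bar>)\<close>, by which the kernel decays uniformly for \<open>x\<close> in \<open>[a,b]\<close>, is moved
  from the kernel to \<open>f\<close>.
\<close>
lemma ac_deriv_scalar_resolvent:
  assumes \<mu>: "\<mu> \<noteq> 0" and f: "square_integrable f"
  defines "u \<equiv> \<lambda>x. LINT y|lborel. scalar_kernel \<mu> (x - y) * f y"
  shows "ac_deriv u (\<lambda>x. f x - complex_of_real \<mu> * u x)"
  unfolding ac_deriv_def
proof (intro allI impI)
  fix a b :: real assume le: "a \<le> b"
  have [measurable]: "f \<in> borel_measurable borel" using f by (simp add: square_integrable_def)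
  have fi: "set_integrable lborel {a..b} f"
    by (rule square_integrable_imp_set_integrable[OF f])
  have ui: "set_integrable lborel {a..b} u"
    unfolding u_def by (intro square_integrable_imp_set_integrable square_integrable_scalar_resolvent \<mu> f)
  show "set_integrable lborel {a..b} (\<lambda>x. f x - complex_of_real \<mu> * u x) \<and>
      (LINT x:{a..b}|lborel. f x - complex_of_real \<mu> * u x) = u b - u a"
  proof
    have mui: "set_integrable lborel {a..b} (\<lambda>x. complex_of_real \<mu> * u x)" using ui by simp
    show "set_integrable lborel {a..b} (\<lambda>x. f x - complex_of_real \<mu> * u x)"
      by (rule set_integral_diff(1)[OF fi mui])
    define M where "M = max \<bar>a\<bar> \<bar>b\<bar>"
    define p where "p x = complex_of_real (indicat_real {a..b} x)" for x
    define w where "w y = complex_of_real (exp (- \<bar>\<mu>\<bar> * \<bar>y\<bar>)) * f y" for y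
    define K where "K x y = p x * scalar_kernel \<mu> (x - y) * complex_of_real (exp (\<bar>\<mu>\<bar> * \<bar>y\<bar>))" for x y
    have Kw: "K x y * w y = p x * (scalar_kernel \<mu> (x - y) * f y)" for x y
    proof -
      have "exp (\<bar>\<mu>\<bar> * \<bar>y\<bar>) * exp (- \<bar>\<mu>\<bar> * \<bar>y\<bar>) = 1" by (simp flip: exp_add)
      then have "complex_of_real (exp (\<bar>\<mu>\<bar> * \<bar>y\<bar>)) * complex_of_real (exp (- \<bar>\<mu>\<bar> * \<bar>y\<bar>)) = 1"
        by (simp only: flip: of_real_mult) simp
      then show ?thesis unfolding K_def w_def by (simp add: algebra_simps)
    qed
    have pp: "p x * p x = p x" for x by (simp add: p_def indicator_def)
    have Fub: "(LINT x|lborel. p x * (LINT y|lborel. K x y * w y))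
       = (LINT y|lborel. (LINT x|lborel. p x * K x y) * w y)"
    proof (rule Fubini_bounded_kernel[where C = "exp (\<bar>\<mu>\<bar> * M)"])
      have "integrable lborel (\<lambda>x. indicat_real {a..b} x)"
        by (rule integrable_real_indicator) (auto simp: emeasure_lborel_Icc_eq)
      then show "integrable lborel p" unfolding p_def by simp
      have "square_integrable (\<lambda>y. complex_of_real (exp (- \<bar>\<mu>\<bar> * \<bar>y\<bar>)))"
        unfolding square_integrable_def
      proof
        have "integrable lborel (\<lambda>y. exp (- \<bar>2 * \<mu>\<bar> * \<bar>y\<bar>))"
          by (rule exp_abs_integrable) (use \<mu> in simp)
        also have "(\<lambda>y. exp (- \<bar>2 * \<mu>\<bar> * \<bar>y\<bar>)) = (\<lambda>y. (cmod (complex_of_real (exp (- \<bar>\<mu>\<bar> * \<bar>y\<bar>))))\<^sup>2)"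
          unfolding norm_of_real abs_exp_cancel by (simp add: fun_eq_iff abs_mult mult.assoc flip: exp_double)
        finally show "integrable lborel (\<lambda>y. (cmod (complex_of_real (exp (- \<bar>\<mu>\<bar> * \<bar>y\<bar>))))\<^sup>2)" .
        show "(\<lambda>y. complex_of_real (exp (- \<bar>\<mu>\<bar> * \<bar>y\<bar>))) \<in> borel_measurable lborel"
          by measurable
      qed
      then show "integrable lborel w"
        unfolding w_def by (rule square_integrable_prod[OF _ f])
      show "case_prod K \<in> borel_measurable (borel \<Otimes>\<^sub>M borel)"
        unfolding K_def p_def by measurable
      fix x y
      show "cmod (K x y) \<le> exp (\<bar>\<mu>\<bar> * M)"
      proof (cases "x \<in> {a..b}")
        case True
        have "cmod (K x y) \<le> exp (- \<bar>\<mu>\<bar> * \<bar>x - y\<bar>) * exp (\<bar>\<mu>\<bar> * \<bar>y\<bar>)"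
          using True scalar_kernel_bound[OF \<mu>, of "x - y"]
          by (simp add: K_def p_def norm_mult mult_right_mono)
        also have "\<dots> = exp (\<bar>\<mu>\<bar> * (\<bar>y\<bar> - \<bar>x - y\<bar>))" by (simp add: algebra_simps flip: exp_add)
        also have "\<dots> \<le> exp (\<bar>\<mu>\<bar> * M)"
        proof -
          have "\<bar>y\<bar> - \<bar>x - y\<bar> \<le> M" using True unfolding M_def by auto
          then show ?thesis by (simp add: mult_left_mono)
        qed
        finally show ?thesis .
      qed (simp add: K_def p_def)
    qed
    have L: "p x * (LINT y|lborel. K x y * w y) = indicat_real {a..b} x *\<^sub>R u x" for x
    proof -
      have "(LINT y|lborel. K x y * w y) = p x * u x"
        unfolding Kw u_def by (rule integral_mult_right_zero)
      then have "p x * (LINT y|lborel. K x y * w y) = p x * p x * u x" by (simp only: mult.assoc)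
      then show ?thesis unfolding pp by (simp add: p_def scaleR_conv_of_real)
    qed
    have pKw: "p x * K x y * w y = p x * scalar_kernel \<mu> (x - y) * f y" for x y
      using Kw[of x y] pp[of x] by (metis mult.assoc)
    have R: "complex_of_real \<mu> * ((LINT x|lborel. p x * K x y) * w y)
        = indicat_real {a<..b} y *\<^sub>R f y - scalar_kernel \<mu> (b - y) * f y + scalar_kernel \<mu> (a - y) * f y" for y
    proof -
      have "(LINT x|lborel. p x * K x y) * w y = (LINT x|lborel. p x * K x y * w y)" by simp
      also have "\<dots> = (LINT x|lborel. p x * scalar_kernel \<mu> (x - y) * f y)"
        unfolding pKw ..
      also have "\<dots> = (LINT x:{a..b}|lborel. scalar_kernel \<mu> (x - y)) * f y"
        by (simp add: set_lebesgue_integral_def p_def scaleR_conv_of_real)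
      finally have "complex_of_real \<mu> * ((LINT x|lborel. p x * K x y) * w y)
          = complex_of_real \<mu> * (LINT x:{a..b}|lborel. scalar_kernel \<mu> (x - y)) * f y" by simp
      then show ?thesis
        unfolding scalar_kernel_integral[OF \<mu> le] by (simp add: algebra_simps scaleR_conv_of_real)
    qed
    have fi': "integrable lborel (\<lambda>y. indicat_real {a<..b} y *\<^sub>R f y)"
      using set_integrable_subset[OF fi, of "{a<..b}"] by (simp add: set_integrable_def subset_eq)
    have "complex_of_real \<mu> * (LINT x:{a..b}|lborel. u x)
        = complex_of_real \<mu> * (LINT y|lborel. (LINT x|lborel. p x * K x y) * w y)"
      unfolding set_lebesgue_integral_def Fub[symmetric] L ..
    also have "\<dots> = (LINT y|lborel. indicat_real {a<..b} y *\<^sub>R f y - scalar_kernel \<mu> (b - y) * f y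
          + scalar_kernel \<mu> (a - y) * f y)"
      by (subst integral_mult_right_zero[symmetric]) (simp only: R)
    also have "\<dots> = (LINT y|lborel. indicat_real {a<..b} y *\<^sub>R f y) - u b + u a"
      unfolding u_def using fi' scalar_kernel_integrable_mult[OF \<mu> f] by simp
    also have "(LINT y|lborel. indicat_real {a<..b} y *\<^sub>R f y) = (LINT y:{a..b}|lborel. f y)"
      unfolding set_lebesgue_integral_def
      by (rule integral_cong_AE)
         (auto simp: indicator_def intro!: eventually_mono[OF AE_lborel_singleton[of a]])
    finally show "(LINT x:{a..b}|lborel. f x - complex_of_real \<mu> * u x) = u b - u a"
      using set_integral_diff(2)[OF fi mui] by simp
  qed
qed

text \<open>
  By the product rule \<open>exp(\<mu>x) w\<close> is constant, and a non-zero multiple of an exponential is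
  not in \<open>L\<^sup>2\<close>.
\<close>
lemma scalar_homogeneous_solution_zero:
  assumes \<mu>: "\<mu> \<noteq> 0" and w: "square_integrable w" and ac: "ac_deriv w v"
    and eq: "AE x in lborel. v x = - complex_of_real \<mu> * w x"
  shows "w x = 0"
proof -
  define E where "E x = complex_of_real (exp (\<mu> * x))" for x
  have dE: "(E has_vector_derivative complex_of_real \<mu> * E x) (at x)" for x
  proof -
    have "((\<lambda>x. complex_of_real (exp (\<mu> * x))) has_vector_derivative complex_of_real (\<mu> * exp (\<mu> * x))) (at x)"
      by (intro has_vector_derivative_of_real)
         (auto intro!: derivative_eq_intros simp flip: has_real_derivative_iff_has_vector_derivative)
    then show ?thesis by (simp add: E_def[abs_def])
  qed
  have cE: "continuous_on UNIV (\<lambda>x. complex_of_real \<mu> * E x)"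
    unfolding E_def by (intro continuous_intros)
  have acE: "ac_deriv (\<lambda>x. E x * w x) (\<lambda>x. complex_of_real \<mu> * E x * w x + E x * v x)"
    by (rule ac_deriv_mult[OF ac dE cE])
  have const: "E b * w b = E a * w a" if "a \<le> b" for a b
  proof -
    have "E b * w b - E a * w a = (LINT x:{a..b}|lborel. complex_of_real \<mu> * E x * w x + E x * v x)"
      using acE that by (simp add: ac_deriv_def)
    also have "\<dots> = 0"
      unfolding set_lebesgue_integral_def
      by (rule integral_eq_zero_AE, rule eventually_mono[OF eq]) simp
    finally show ?thesis by simp
  qed
  define c where "c = w 0"
  have wx: "w x = c * complex_of_real (exp (- \<mu> * x))" for x
  proof -
    have "E x * w x = c"
      using const[of 0 x] const[of x 0] by (cases "0 \<le> x") (auto simp: c_def E_def)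
    moreover have "E x * complex_of_real (exp (- \<mu> * x)) = 1"
      unfolding E_def by (simp flip: of_real_mult exp_add)
    ultimately show ?thesis by (metis (no_types, lifting) mult.assoc mult.commute mult_1)
  qed
  have "c = 0"
  proof (rule ccontr)
    assume "c \<noteq> 0"
    have "integrable lborel (\<lambda>x. (cmod (w x))\<^sup>2)" using w by (simp add: square_integrable_def)
    moreover have "(cmod (w x))\<^sup>2 = (cmod c)\<^sup>2 * exp (- (2 * \<mu>) * x)" for x
      unfolding wx norm_mult norm_of_real abs_exp_cancel power_mult_distrib
      by (simp add: mult.assoc flip: exp_double)
    ultimately have "integrable lborel (\<lambda>x. (cmod c)\<^sup>2 * exp (- (2 * \<mu>) * x))" by simp
    then have i: "integrable lborel (\<lambda>x. exp (- (2 * \<mu>) * x))" using \<open>c \<noteq> 0\<close> by simp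
    \<comment> \<open>A non-zero exponential is at least one on a half-line, hence not square integrable.\<close>
    have "real n \<le> (LINT x|lborel. exp (- (2 * \<mu>) * x))" for n
    proof -
      define S where "S = (if \<mu> > 0 then {- real n..0} else {0..real n})"
      have "real n = (LINT x|lborel. indicat_real S x)"
        by (simp add: S_def measure_def emeasure_lborel_Icc_eq)
      also have "\<dots> \<le> (LINT x|lborel. exp (- (2 * \<mu>) * x))"
      proof (rule integral_mono[OF _ i])
        show "integrable lborel (indicat_real S)"
          by (rule integrable_real_indicator) (auto simp: S_def emeasure_lborel_Icc_eq)
        fix x
        have "0 \<le> - (2 * \<mu>) * x" if "x \<in> S"
          using that \<mu> by (cases "\<mu> > 0") (auto simp: S_def mult_le_0_iff)
        then show "indicat_real S x \<le> exp (- (2 * \<mu>) * x)" by (auto simp: indicator_def)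
      qed
      finally show ?thesis .
    qed
    then show False using reals_Archimedean2 linorder_not_less by blast
  qed
  then show ?thesis using wx by simp
qed

section \<open>Two-component functions\<close>

lemma bounded_linear_axis: "bounded_linear (axis i :: complex \<Rightarrow> complex ^ 2)"
proof (rule bounded_linear_intro[where K = 1])
  show "norm (axis i x :: complex ^ 2) \<le> norm x * 1" for x
    by (simp add: norm_eq_sqrt_inner inner_axis_axis)
qed (auto simp: axis_def vec_eq_iff)

lemma vec2_axis: "v = axis 1 (v $ 1) + axis 2 (v $ 2)" for v :: "complex ^ 2"
  by (auto simp: vec_eq_iff axis_def forall_2)

lemma vec2_measurable_iff:
  fixes f :: "real \<Rightarrow> complex ^ 2"
  shows "f \<in> borel_measurable lborel \<longleftrightarrow> (\<forall>i. (\<lambda>x. f x $ i) \<in> borel_measurable lborel)"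
proof
  assume "f \<in> borel_measurable lborel"
  then show "\<forall>i. (\<lambda>x. f x $ i) \<in> borel_measurable lborel"
    using borel_measurable_continuous_on[OF linear_continuous_on[OF bounded_linear_vec_nth]] by blast
next
  assume *: "\<forall>i. (\<lambda>x. f x $ i) \<in> borel_measurable lborel"
  have "(\<lambda>x. axis i (f x $ i)) \<in> borel_measurable lborel" for i
    using borel_measurable_continuous_on[OF linear_continuous_on[OF bounded_linear_axis]] * by blast
  then have "(\<lambda>x. axis 1 (f x $ 1) + axis (2::2) (f x $ 2)) \<in> borel_measurable lborel" by simp
  then show "f \<in> borel_measurable lborel" by (simp add: vec2_axis[symmetric])
qed

lemma vec2_integrable_iff:
  fixes f :: "real \<Rightarrow> complex ^ 2"
  shows "integrable M f \<longleftrightarrow> (\<forall>i. integrable M (\<lambda>x. f x $ i))"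
proof
  assume "integrable M f"
  then show "\<forall>i. integrable M (\<lambda>x. f x $ i)"
    using integrable_bounded_linear[OF bounded_linear_vec_nth] by blast
next
  assume *: "\<forall>i. integrable M (\<lambda>x. f x $ i)"
  have "integrable M (\<lambda>x. axis i (f x $ i))" for i
    using integrable_bounded_linear[OF bounded_linear_axis] * by blast
  then have "integrable M (\<lambda>x. axis 1 (f x $ 1) + axis (2::2) (f x $ 2))" by simp
  then show "integrable M f" by (simp add: vec2_axis[symmetric])
qed

lemma vec2_integral_nth:
  fixes f :: "real \<Rightarrow> complex ^ 2"
  assumes "integrable M f"
  shows "(LINT x|M. f x) $ i = (LINT x|M. f x $ i)"
  using integral_bounded_linear[OF bounded_linear_vec_nth assms] by simp

lemma L2_iff: "L2 f \<longleftrightarrow> (\<forall>i. square_integrable (\<lambda>x. f x $ i))"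
proof -
  have n: "(norm (f x))\<^sup>2 = (cmod (f x $ 1))\<^sup>2 + (cmod (f x $ 2))\<^sup>2" for x
    by (simp add: norm_vec_def L2_set_def sum_2 real_sqrt_pow2)
  show ?thesis
  proof
    assume L: "L2 f"
    then have m: "\<forall>i. (\<lambda>x. f x $ i) \<in> borel_measurable lborel"
      by (simp add: L2_def vec2_measurable_iff del: measurable_lborel2)
    have "integrable lborel (\<lambda>x. (cmod (f x $ i))\<^sup>2)" for i
    proof (rule Bochner_Integration.integrable_bound)
      show "integrable lborel (\<lambda>x. (norm (f x))\<^sup>2)" using L by (simp add: L2_def)
      have [measurable]: "(\<lambda>x. f x $ i) \<in> borel_measurable borel" using m by simp
      show "(\<lambda>x. (cmod (f x $ i))\<^sup>2) \<in> borel_measurable lborel" by measurable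
      show "AE x in lborel. norm ((cmod (f x $ i))\<^sup>2) \<le> norm ((norm (f x))\<^sup>2)"
        by (intro AE_I2) (auto intro!: power_mono Finite_Cartesian_Product.norm_nth_le)
    qed
    then show "\<forall>i. square_integrable (\<lambda>x. f x $ i)" using m by (simp add: square_integrable_def)
  next
    assume "\<forall>i. square_integrable (\<lambda>x. f x $ i)"
    then show "L2 f" unfolding L2_def vec2_measurable_iff n square_integrable_def
      by (auto simp del: measurable_lborel2)
  qed
qed

lemma H1_deriv_iff:
  "H1_deriv u v \<longleftrightarrow> L2 u \<and> L2 v \<and> (\<forall>i. ac_deriv (\<lambda>x. u x $ i) (\<lambda>x. v x $ i))"
proof -
  have si: "set_integrable lborel {a..b} v" "set_integrable lborel {a..b} (\<lambda>x. v x $ i)" if "L2 v" for a b i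
  proof -
    have "set_integrable lborel {a..b} (\<lambda>x. v x $ i)" for i
      using that square_integrable_imp_set_integrable by (auto simp: L2_iff)
    then show "set_integrable lborel {a..b} v" "set_integrable lborel {a..b} (\<lambda>x. v x $ i)"
      unfolding set_integrable_def vec2_integrable_iff by simp_all
  qed
  have "(LINT x:{a..b}|lborel. v x) = u b - u a \<longleftrightarrow> (\<forall>i. (LINT x:{a..b}|lborel. v x $ i) = u b $ i - u a $ i)"
    if "L2 v" for a b
    using si(1)[OF that, of a b] unfolding vec_eq_iff set_integrable_def set_lebesgue_integral_def
    by (simp add: vec2_integral_nth)
  then show ?thesis unfolding H1_deriv_def ac_deriv_def using si by auto
qed

lemma matrix2_vector_nth: "(A *v x) $ i = A $ i $ 1 * x $ 1 + A $ i $ 2 * x $ 2"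
  for A :: "complex ^ 2 ^ 2"
  by (simp add: matrix_vector_mult_def sum_2)

lemma matrix2_mult_nth: "(A ** B) $ i $ j = A $ i $ 1 * B $ 1 $ j + A $ i $ 2 * B $ 2 $ j"
  for A B :: "complex ^ 2 ^ 2"
  by (simp add: matrix_matrix_mult_def sum_2)

section \<open>Conjugation of the Lax operator\<close>

text \<open>
  The pointwise form of \<open>L\<^sub>q V = V L\<^sub>p\<close> for a bounded \<open>C\<^sup>1\<close> matrix function \<open>V\<close> with bounded
  derivative. It is stated entrywise because all analysis is done on scalar components.
\<close>
definition intertwines ::
  "complex \<Rightarrow> (real \<Rightarrow> complex) \<Rightarrow> (real \<Rightarrow> complex) \<Rightarrow> (real \<Rightarrow> complex ^ 2 ^ 2) \<Rightarrow> bool" where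
  "intertwines \<kappa> p q V \<longleftrightarrow> (\<exists>V'. 
     (\<forall>i j x. ((\<lambda>x. V x $ i $ j) has_vector_derivative V' x $ i $ j) (at x)) \<and>
     (\<forall>i j. continuous_on UNIV (\<lambda>x. V' x $ i $ j)) \<and>
     (\<exists>C. \<forall>i j x. cmod (V x $ i $ j) \<le> C \<and> cmod (V' x $ i $ j) \<le> C) \<and>
     (\<forall>x. V' x + L_coeff \<kappa> q x ** V x = V x ** L_coeff \<kappa> p x))"

lemma L2_matrix_mult:
  assumes f: "L2 f" and m: "\<And>i j. continuous_on UNIV (\<lambda>x. V x $ i $ j)"
    and C: "\<And>i j x. cmod (V x $ i $ j) \<le> C"
  shows "L2 (\<lambda>x. V x *v f x)"
  unfolding L2_iff matrix2_vector_nth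
  by (intro allI square_integrable_add square_integrable_bounded_mult[where C = C] C
        borel_measurable_continuous_onI m f[unfolded L2_iff, rule_format])

lemma L2_add: "L2 f \<Longrightarrow> L2 g \<Longrightarrow> L2 (\<lambda>x. f x + g x)"
  by (simp add: L2_iff square_integrable_add)

theorem intertwines_L_graph:
  assumes V: "intertwines \<kappa> p q V" and wg: "L_graph \<kappa> p w g"
  shows "L_graph \<kappa> q (\<lambda>x. V x *v w x) (\<lambda>x. V x *v g x)"
proof -
  obtain V' C where
    dV: "\<And>i j x. ((\<lambda>x. V x $ i $ j) has_vector_derivative V' x $ i $ j) (at x)" and
    cV': "\<And>i j. continuous_on UNIV (\<lambda>x. V' x $ i $ j)" and
    C: "\<And>i j x. cmod (V x $ i $ j) \<le> C" "\<And>i j x. cmod (V' x $ i $ j) \<le> C" and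
    eq: "\<And>x. V' x + L_coeff \<kappa> q x ** V x = V x ** L_coeff \<kappa> p x"
    using V unfolding intertwines_def by blast
  have cV: "continuous_on UNIV (\<lambda>x. V x $ i $ j)" for i j
    using dV by (meson continuous_at_imp_continuous_on has_vector_derivative_continuous)
  obtain v where g: "L2 g" and H: "H1_deriv w v" and ae: "AE x in lborel. g x = v x + L_coeff \<kappa> p x *v w x"
    using wg unfolding L_graph_def by blast
  have L: "L2 w" "L2 v" and ac: "\<And>i. ac_deriv (\<lambda>x. w x $ i) (\<lambda>x. v x $ i)"
    using H by (auto simp: H1_deriv_iff)
  show ?thesis unfolding L_graph_def
  proof (intro conjI exI[of _ "\<lambda>x. V' x *v w x + V x *v v x"])
    show "L2 (\<lambda>x. V x *v g x)" by (rule L2_matrix_mult[OF g cV C(1)])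
    show "H1_deriv (\<lambda>x. V x *v w x) (\<lambda>x. V' x *v w x + V x *v v x)"
      unfolding H1_deriv_iff
    proof (intro conjI allI)
      show "L2 (\<lambda>x. V x *v w x)" by (rule L2_matrix_mult[OF L(1) cV C(1)])
      show "L2 (\<lambda>x. V' x *v w x + V x *v v x)"
        by (intro L2_add L2_matrix_mult[OF L(1) cV' C(2)] L2_matrix_mult[OF L(2) cV C(1)])
      fix i :: 2
      have "ac_deriv (\<lambda>x. V x $ i $ 1 * w x $ 1 + V x $ i $ 2 * w x $ 2)
          (\<lambda>x. (V' x $ i $ 1 * w x $ 1 + V x $ i $ 1 * v x $ 1) + (V' x $ i $ 2 * w x $ 2 + V x $ i $ 2 * v x $ 2))"
        by (intro ac_deriv_add ac_deriv_mult ac dV cV')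
      then show "ac_deriv (\<lambda>x. (V x *v w x) $ i) (\<lambda>x. (V' x *v w x + V x *v v x) $ i)"
        by (simp add: matrix2_vector_nth algebra_simps)
    qed
    show "AE x in lborel. V x *v g x = V' x *v w x + V x *v v x + L_coeff \<kappa> q x *v (V x *v w x)"
      using ae
    proof eventually_elim
      case (elim x)
      have "V x *v g x = V x *v v x + (V x ** L_coeff \<kappa> p x) *v w x"
        unfolding elim by (simp add: matrix_vector_right_distrib matrix_vector_mul_assoc)
      also have "\<dots> = V x *v v x + (V' x + L_coeff \<kappa> q x ** V x) *v w x" by (simp only: eq)
      finally show ?case
        by (simp add: matrix_vector_mult_add_rdistrib matrix_vector_mul_assoc algebra_simps)
    qed
  qed
qed

section \<open>The free operator\<close>

definition free_kernel :: "real \<Rightarrow> real \<Rightarrow> real \<Rightarrow> complex ^ 2 ^ 2" where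
  "free_kernel \<nu> x y = vector [vector [scalar_kernel \<nu> (x - y), 0],
                               vector [0, scalar_kernel (- \<nu>) (x - y)]]"

lemma free_kernel_mult_nth:
  "(free_kernel \<nu> x y *v f) $ 1 = scalar_kernel \<nu> (x - y) * f $ 1"
  "(free_kernel \<nu> x y *v f) $ 2 = scalar_kernel (- \<nu>) (x - y) * f $ 2"
  by (simp_all add: matrix2_vector_nth free_kernel_def)

lemma free_kernel_integrable:
  assumes "\<nu> \<noteq> 0" "L2 f"
  shows "integrable lborel (\<lambda>y. free_kernel \<nu> x y *v f y)"
  unfolding vec2_integrable_iff forall_2 free_kernel_mult_nth
  using assms scalar_kernel_integrable_mult[of \<nu>] scalar_kernel_integrable_mult[of "- \<nu>"]
  by (simp add: L2_iff)

lemma free_coeff_mult_nth: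
  assumes "\<i> * \<kappa>\<^sup>2 = complex_of_real \<nu>"
  shows "(L_coeff \<kappa> (\<lambda>_. 0) x *v u) $ 1 = of_real \<nu> * u $ 1"
        "(L_coeff \<kappa> (\<lambda>_. 0) x *v u) $ 2 = of_real (- \<nu>) * u $ 2"
  using assms by (simp_all add: matrix2_vector_nth L_coeff_def rfun_def)

lemma free_L_graph_exists:
  assumes \<kappa>: "\<i> * \<kappa>\<^sup>2 = complex_of_real \<nu>" and \<nu>: "\<nu> \<noteq> 0" and f: "L2 f"
  shows "L_graph \<kappa> (\<lambda>_. 0) (\<lambda>x. LINT y|lborel. free_kernel \<nu> x y *v f y) f"
proof -
  define u where "u x = (LINT y|lborel. free_kernel \<nu> x y *v f y)" for x
  have f12: "square_integrable (\<lambda>x. f x $ i)" for i using f by (simp add: L2_iff)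
  have u1: "u x $ 1 = (LINT y|lborel. scalar_kernel \<nu> (x - y) * f y $ 1)" for x
    unfolding u_def vec2_integral_nth[OF free_kernel_integrable[OF \<nu> f]] free_kernel_mult_nth ..
  have u2: "u x $ 2 = (LINT y|lborel. scalar_kernel (- \<nu>) (x - y) * f y $ 2)" for x
    unfolding u_def vec2_integral_nth[OF free_kernel_integrable[OF \<nu> f]] free_kernel_mult_nth ..
  have \<nu>': "- \<nu> \<noteq> 0" using \<nu> by simp
  have squ: "square_integrable (\<lambda>x. u x $ 1)" "square_integrable (\<lambda>x. u x $ 2)"
    unfolding u1 u2 by (rule square_integrable_scalar_resolvent[OF \<nu> f12] square_integrable_scalar_resolvent[OF \<nu>' f12])+
  define v where "v x = f x - L_coeff \<kappa> (\<lambda>_. 0) x *v u x" for x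
  have v1: "v x $ 1 = f x $ 1 - of_real \<nu> * u x $ 1" and v2: "v x $ 2 = f x $ 2 - of_real (- \<nu>) * u x $ 2" for x
    unfolding v_def vector_minus_component free_coeff_mult_nth[OF \<kappa>] by simp_all
  have "L_graph \<kappa> (\<lambda>_. 0) u f" unfolding L_graph_def H1_deriv_iff
  proof (intro conjI exI[of _ v] f)
    show "L2 u" unfolding L2_iff forall_2 using squ by blast
    show "L2 v" unfolding L2_iff forall_2 v1 v2
      by (intro conjI square_integrable_diff f12 square_integrable_bounded_mult[where C = "\<bar>\<nu>\<bar>"] squ) auto
    show "\<forall>i. ac_deriv (\<lambda>x. u x $ i) (\<lambda>x. v x $ i)"
      unfolding forall_2 v1 v2 u1 u2
      using ac_deriv_scalar_resolvent[OF \<nu> f12] ac_deriv_scalar_resolvent[OF \<nu>' f12] by blast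
    show "AE x in lborel. f x = v x + L_coeff \<kappa> (\<lambda>_. 0) x *v u x" by (simp add: v_def)
  qed
  then show ?thesis by (simp add: u_def[abs_def])
qed

lemma free_L_graph_unique:
  assumes \<kappa>: "\<i> * \<kappa>\<^sup>2 = complex_of_real \<nu>" and \<nu>: "\<nu> \<noteq> 0"
    and "L_graph \<kappa> (\<lambda>_. 0) u f" "L_graph \<kappa> (\<lambda>_. 0) u' f"
  shows "u = u'"
proof -
  obtain v v' where L: "L2 u" "L2 u'"
    and ac: "\<And>i. ac_deriv (\<lambda>x. u x $ i) (\<lambda>x. v x $ i)" "\<And>i. ac_deriv (\<lambda>x. u' x $ i) (\<lambda>x. v' x $ i)"
    and ae: "AE x in lborel. f x = v x + L_coeff \<kappa> (\<lambda>_. 0) x *v u x"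
      "AE x in lborel. f x = v' x + L_coeff \<kappa> (\<lambda>_. 0) x *v u' x"
    using assms(3,4) unfolding L_graph_def H1_deriv_iff by blast
  have e: "AE x in lborel. v x + L_coeff \<kappa> (\<lambda>_. 0) x *v u x = v' x + L_coeff \<kappa> (\<lambda>_. 0) x *v u' x"
    using ae by eventually_elim simp
  have comp: "u x $ i = u' x $ i"
    if coeff: "\<And>x w. (L_coeff \<kappa> (\<lambda>_. 0) x *v w) $ i = of_real \<mu> * w $ i" and "\<mu> \<noteq> 0" for x i \<mu>
  proof -
    have "u x $ i - u' x $ i = 0"
    proof (rule scalar_homogeneous_solution_zero[OF \<open>\<mu> \<noteq> 0\<close> _ ac_deriv_diff[OF ac]])
      show "square_integrable (\<lambda>x. u x $ i - u' x $ i)"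
        using L by (auto simp: L2_iff intro: square_integrable_diff)
      show "AE x in lborel. v x $ i - v' x $ i = - complex_of_real \<mu> * (u x $ i - u' x $ i)"
        using e
      proof eventually_elim
        case (elim x)
        from arg_cong[OF this, of "\<lambda>w. w $ i"] show ?case
          unfolding vector_add_component coeff by (simp add: algebra_simps)
      qed
    qed
    then show ?thesis by simp
  qed
  have "- \<nu> \<noteq> 0" using \<nu> by simp
  then show ?thesis
    using comp[OF free_coeff_mult_nth(1)[OF \<kappa>] \<nu>] comp[OF free_coeff_mult_nth(2)[OF \<kappa>]]
    by (simp add: fun_eq_iff vec_eq_iff forall_2)
qed

section \<open>The Green's function of a conjugated operator\<close>

text \<open>
  \<open>V\<close> and its inverse \<open>W\<close> carry solutions of the free problem to solutions for \<open>q\<close> and back,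
  so unique solvability transfers and the solution operator becomes \<open>V\<close> times the free one
  times \<open>W\<close>.
\<close>
theorem conjugated_inverse_kernel:
  assumes \<kappa>: "\<i> * \<kappa>\<^sup>2 = complex_of_real \<nu>" and \<nu>: "\<nu> \<noteq> 0"
    and V: "intertwines \<kappa> (\<lambda>_. 0) q V" and W: "intertwines \<kappa> q (\<lambda>_. 0) W"
    and VW: "\<And>x. V x ** W x = mat 1" and WV: "\<And>x. W x ** V x = mat 1"
  shows "inverse_kernel \<kappa> q (\<lambda>x y. V x ** free_kernel \<nu> x y ** W y)"
proof -
  have cV: "continuous_on UNIV (\<lambda>x. V x $ i $ j)" and cW: "continuous_on UNIV (\<lambda>x. W x $ i $ j)" for i j
    using V W unfolding intertwines_def
    by (meson continuous_at_imp_continuous_on has_vector_derivative_continuous)+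
  obtain C where C: "\<And>i j x. cmod (W x $ i $ j) \<le> C"
    using W unfolding intertwines_def by blast
  have sol: "integrable lborel (\<lambda>y. (V x ** free_kernel \<nu> x y ** W y) *v f y) \<and>
       u x = (LINT y|lborel. (V x ** free_kernel \<nu> x y ** W y) *v f y)" if g: "L_graph \<kappa> q u f" for u f x
  proof -
    have Wg: "L_graph \<kappa> (\<lambda>_. 0) (\<lambda>x. W x *v u x) (\<lambda>x. W x *v f x)"
      by (rule intertwines_L_graph[OF W g])
    have L: "L2 (\<lambda>x. W x *v f x)" using Wg by (simp add: L_graph_def)
    have "(\<lambda>x. W x *v u x) = (\<lambda>x. LINT y|lborel. free_kernel \<nu> x y *v (W y *v f y))"
      by (rule free_L_graph_unique[OF \<kappa> \<nu> Wg free_L_graph_exists[OF \<kappa> \<nu> L]])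
    then have Wu: "W x *v u x = (LINT y|lborel. free_kernel \<nu> x y *v (W y *v f y))"
      by (rule fun_cong)
    have bl: "bounded_linear ((*v) (V x))"
      by (rule linear_conv_bounded_linear[THEN iffD1])
         (auto intro!: linearI simp: matrix_vector_right_distrib vec_eq_iff matrix2_vector_nth scaleR_conv_of_real algebra_simps)
    have i: "integrable lborel (\<lambda>y. free_kernel \<nu> x y *v (W y *v f y))"
      by (rule free_kernel_integrable[OF \<nu> L])
    have "u x = V x *v (W x *v u x)" by (simp add: matrix_vector_mul_assoc VW)
    also have "\<dots> = (LINT y|lborel. V x *v (free_kernel \<nu> x y *v (W y *v f y)))"
      unfolding Wu by (rule integral_bounded_linear[OF bl i, symmetric])
    finally show ?thesis
      using integrable_bounded_linear[OF bl i] by (simp add: matrix_vector_mul_assoc matrix_mul_assoc)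
  qed
  have ex: "L_graph \<kappa> q (\<lambda>x. LINT y|lborel. (V x ** free_kernel \<nu> x y ** W y) *v f y) f" if f: "L2 f" for f
  proof -
    have L: "L2 (\<lambda>x. W x *v f x)" by (rule L2_matrix_mult[OF f cW C])
    from intertwines_L_graph[OF V free_L_graph_exists[OF \<kappa> \<nu> L]]
    have g: "L_graph \<kappa> q (\<lambda>x. V x *v (LINT y|lborel. free_kernel \<nu> x y *v (W y *v f y))) f"
      by (simp add: matrix_vector_mul_assoc VW)
    have "(\<lambda>x. V x *v (LINT y|lborel. free_kernel \<nu> x y *v (W y *v f y)))
        = (\<lambda>x. LINT y|lborel. (V x ** free_kernel \<nu> x y ** W y) *v f y)"
      using sol[OF g] by blast
    then show ?thesis using g by simp
  qed
  have "L_invertible \<kappa> q" unfolding L_invertible_def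
  proof (intro allI impI)
    fix f :: "real \<Rightarrow> complex ^ 2" assume "L2 f"
    then show "\<exists>!u. L_graph \<kappa> q u f" using ex sol by (metis (lifting) ext)
  qed
  moreover have "case_prod (\<lambda>x y. V x ** free_kernel \<nu> x y ** W y) \<in> borel_measurable borel"
  proof -
    have [measurable]: "(\<lambda>x. V x $ i $ j) \<in> borel_measurable borel" "(\<lambda>x. W x $ i $ j) \<in> borel_measurable borel" for i j
      by (intro borel_measurable_continuous_onI cV cW)+
    have ent: "(\<lambda>z. (V (fst z) ** free_kernel \<nu> (fst z) (snd z) ** W (snd z)) $ i $ j) \<in> borel_measurable (borel \<Otimes>\<^sub>M borel)" for i j
      unfolding matrix2_mult_nth free_kernel_def by (simp, measurable)
    have "(\<lambda>z. V (fst z) ** free_kernel \<nu> (fst z) (snd z) ** W (snd z)) \<in> borel_measurable (borel \<Otimes>\<^sub>M borel)"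
    proof (subst borel_measurable_euclidean_space, intro ballI)
      fix b :: "complex ^ 2 ^ 2" assume "b \<in> Basis"
      then obtain i c where b: "b = axis i c" "c \<in> Basis" by (auto simp: Basis_vec_def)
      then obtain j d where c: "c = axis j d" by (auto simp: Basis_vec_def)
      have "(A :: complex ^ 2 ^ 2) \<bullet> b = A $ i $ j \<bullet> d" for A
        unfolding b(1) c by (simp add: inner_axis)
      then show "(\<lambda>z. (V (fst z) ** free_kernel \<nu> (fst z) (snd z) ** W (snd z)) \<bullet> b) \<in> borel_measurable (borel \<Otimes>\<^sub>M borel)"
        using ent[of i j] by simp
    qed
    then show ?thesis by (simp add: case_prod_beta' borel_prod)
  qed
  ultimately show ?thesis unfolding inverse_kernel_def using sol by auto
qed

lemma intertwines_id: "intertwines \<kappa> q q (\<lambda>_. mat 1)"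
  unfolding intertwines_def
proof (intro exI[of _ "\<lambda>_. 0"] conjI)
  show "\<exists>C. \<forall>i j x. cmod ((mat 1 :: complex ^ 2 ^ 2) $ i $ j) \<le> C \<and> cmod ((0 :: complex ^ 2 ^ 2) $ i $ j) \<le> C"
    by (intro exI[of _ 1]) (auto simp: mat_def)
qed auto

corollary free_inverse_kernel:
  assumes "\<i> * \<kappa>\<^sup>2 = complex_of_real \<nu>" and "\<nu> \<noteq> 0"
  shows "inverse_kernel \<kappa> (\<lambda>_. 0) (free_kernel \<nu>)"
  using conjugated_inverse_kernel[OF assms intertwines_id intertwines_id] by simp

text \<open>
  Across the diagonal the Green's function jumps by \<open>V W = 1\<close>, exactly as the free one does,
  so the difference of the two has a jump term \<open>B\<close> that vanishes there.
\<close>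
lemma continuous_on_cutoff:
  fixes A B :: "real \<times> real \<Rightarrow> complex"
  assumes A: "continuous_on UNIV A" and B: "continuous_on UNIV B" and 0: "\<And>x. B (x, x) = 0"
  shows "continuous_on UNIV (\<lambda>z. A z - (if fst z < snd z then B z else 0))"
proof -
  have "continuous_on UNIV (\<lambda>z. if snd z - fst z \<le> 0 then A z else A z - B z)"
  proof (rule continuous_on_cases_le)
    show "continuous_on UNIV (\<lambda>z :: real \<times> real. snd z - fst z)" by (intro continuous_intros)
    show "A z = A z - B z" if "z \<in> UNIV" "snd z - fst z = 0" for z
    proof -
      have "z = (fst z, fst z)" using that by (simp add: prod_eq_iff)
      then have "B z = 0" using 0 by metis
      then show ?thesis by simp
    qed
  qed (intro continuous_intros continuous_on_subset[OF A] continuous_on_subset[OF B]; simp)+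
  also have "(\<lambda>z. if snd z - fst z \<le> 0 then A z else A z - B z) = (\<lambda>z. A z - (if fst z < snd z then B z else 0))"
    by auto
  finally show ?thesis .
qed

lemma scalar_kernel_split:
  "scalar_kernel \<mu> (x - y) = (if 0 < \<mu> then 1 else 0) * complex_of_real (exp (- \<mu> * (x - y)))
      - (if x < y then complex_of_real (exp (- \<mu> * (x - y))) else 0)"
  by (auto simp: scalar_kernel_def)

lemma continuous_on_matrix2:
  fixes M :: "'a::topological_space \<Rightarrow> complex ^ 2 ^ 2"
  assumes "\<And>i j. continuous_on S (\<lambda>z. M z $ i $ j)"
  shows "continuous_on S M"
proof -
  have "continuous_on S (\<lambda>z. \<chi> i j. M z $ i $ j)"
    by (intro continuous_on_vec_lambda assms)
  then show ?thesis by simp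
qed

lemma is_green_diff_conjugated:
  assumes \<kappa>: "\<i> * \<kappa>\<^sup>2 = complex_of_real \<nu>" and \<nu>: "\<nu> \<noteq> 0"
    and V: "intertwines \<kappa> (\<lambda>_. 0) q V" and W: "intertwines \<kappa> q (\<lambda>_. 0) W"
    and VW: "\<And>x. V x ** W x = mat 1" and WV: "\<And>x. W x ** V x = mat 1"
  shows "is_green_diff \<kappa> q (\<lambda>x y. V x ** free_kernel \<nu> x y ** W y - free_kernel \<nu> x y)"
  unfolding is_green_diff_def
proof (intro conjI exI allI)
  show "inverse_kernel \<kappa> q (\<lambda>x y. V x ** free_kernel \<nu> x y ** W y)"
    by (rule conjugated_inverse_kernel[OF assms])
  show "inverse_kernel \<kappa> (\<lambda>_. 0) (free_kernel \<nu>)" by (rule free_inverse_kernel[OF \<kappa> \<nu>])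
  show "V x ** free_kernel \<nu> x y ** W y - free_kernel \<nu> x y = V x ** free_kernel \<nu> x y ** W y - free_kernel \<nu> x y" for x y ..
  have cV: "continuous_on UNIV (\<lambda>x. V x $ i $ j)" and cW: "continuous_on UNIV (\<lambda>x. W x $ i $ j)" for i j
    using V W unfolding intertwines_def
    by (meson continuous_at_imp_continuous_on has_vector_derivative_continuous)+
  define e where "e k z = complex_of_real (exp (- (if k = 1 then \<nu> else - \<nu>) * (fst z - snd z)))" for k :: 2 and z
  define h where "h k = (if 0 < (if k = 1 then \<nu> else - \<nu>) then 1 else 0 :: complex)" for k :: 2
  define B where "B i j z = V (fst z) $ i $ 1 * e 1 z * W (snd z) $ 1 $ j + V (fst z) $ i $ 2 * e 2 z * W (snd z) $ 2 $ j
       - (if i = j then e i z else 0)" for i j z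
  define A where "A i j z = V (fst z) $ i $ 1 * (h 1 * e 1 z) * W (snd z) $ 1 $ j
       + V (fst z) $ i $ 2 * (h 2 * e 2 z) * W (snd z) $ 2 $ j - (if i = j then h i * e i z else 0)" for i j z
  have ce: "continuous_on UNIV (e k)" for k unfolding e_def by (intro continuous_intros)
  have cV2: "continuous_on UNIV (\<lambda>z. V (fst z) $ i $ j)" and cW2: "continuous_on UNIV (\<lambda>z. W (snd z) $ i $ j)"
    for i j by (intro continuous_on_compose2[OF cV] continuous_on_compose2[OF cW] continuous_intros; simp)+
  have cA: "continuous_on UNIV (A i j)" for i j
    unfolding A_def by (cases "i = j") (auto intro!: continuous_intros cV2 cW2 ce)
  have cB: "continuous_on UNIV (B i j)" for i j
    unfolding B_def by (cases "i = j") (auto intro!: continuous_intros cV2 cW2 ce)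
  have B0: "B i j (x, x) = 0" for i j x
  proof -
    have "V x $ i $ 1 * W x $ 1 $ j + V x $ i $ 2 * W x $ 2 $ j = (if i = j then 1 else 0)"
      using VW[of x] by (simp add: vec_eq_iff matrix2_mult_nth mat_def)
    then show ?thesis by (simp add: B_def e_def)
  qed
  have k: "free_kernel \<nu> x y $ i $ j = (if i = j then h i * e i (x, y) - (if x < y then e i (x, y) else 0) else 0)" for i j x y
    using exhaust_2[of i] exhaust_2[of j]
    by (auto simp: free_kernel_def h_def e_def scalar_kernel_split)
  have eq: "(V x ** free_kernel \<nu> x y ** W y - free_kernel \<nu> x y) $ i $ j
       = A i j (x, y) - (if fst (x, y) < snd (x, y) then B i j (x, y) else 0)" for x y i j
    unfolding vector_minus_component matrix2_mult_nth k A_def B_def by (simp add: algebra_simps)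
  show "continuous_on UNIV (\<lambda>(x, y). V x ** free_kernel \<nu> x y ** W y - free_kernel \<nu> x y)"
  proof (rule continuous_on_matrix2)
    fix i j
    have *: "(\<lambda>z. (case z of (x, y) \<Rightarrow> V x ** free_kernel \<nu> x y ** W y - free_kernel \<nu> x y) $ i $ j)
        = (\<lambda>z. A i j z - (if fst z < snd z then B i j z else 0))"
      using eq by (simp add: fun_eq_iff)
    show "continuous_on UNIV (\<lambda>z. (case z of (x, y) \<Rightarrow> V x ** free_kernel \<nu> x y ** W y - free_kernel \<nu> x y) $ i $ j)"
      unfolding * by (rule continuous_on_cutoff[OF cA cB B0])
  qed
qed

section \<open>Uniqueness of integral kernels\<close>

text \<open>
  Testing with countably many rays matters for kernels, where the null set of exceptional \<open>x\<close>
  depends on the test function. Rays form an intersection-stable generator of the Borel sets,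
  and rational end points suffice by continuity of the integral.
\<close>
lemma AE_zero_if_rational_tails_zero:
  fixes g :: "real \<Rightarrow> complex"
  assumes g: "integrable lborel g"
    and tails: "\<And>r. r \<in> \<rat> \<Longrightarrow> (LINT y:{r<..}|lborel. g y) = 0"
    and total: "(LINT y|lborel. g y) = 0"
  shows "AE y in lborel. g y = 0"
proof (rule sigma_finite_measure.density_zero[OF lborel.sigma_finite_measure_axioms g])
  have [measurable]: "g \<in> borel_measurable borel" using g by (auto dest: borel_measurable_integrable)
  have gA: "set_integrable lborel A g" if "A \<in> sets borel" for A
    unfolding set_integrable_def by (rule integrable_mult_indicator) (use that g in auto)
  have ray: "(LINT y:{a<..}|lborel. g y) = 0" for a
  proof -
    have "\<exists>r. r \<in> \<rat> \<and> a < r \<and> r < a + 1 / real (Suc n)" for n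
      using Rats_dense_in_real[of a "a + 1 / real (Suc n)"] by auto
    then obtain r where r: "\<And>n. r n \<in> \<rat>" "\<And>n. a < r n" "\<And>n. r n < a + 1 / real (Suc n)" by metis
    have rlim: "r \<longlonglongrightarrow> a"
    proof (rule tendsto_sandwich[of "\<lambda>_. a" r sequentially "\<lambda>n. a + 1 / real (Suc n)"])
      show "(\<lambda>n. a + 1 / real (Suc n)) \<longlonglongrightarrow> a"
        using tendsto_add[OF tendsto_const LIMSEQ_inverse_real_of_nat, of a] by (simp add: inverse_eq_divide)
    qed (use r in \<open>auto intro!: always_eventually less_imp_le\<close>)
    have "(\<lambda>n. LINT y:{r n<..}|lborel. g y) \<longlonglongrightarrow> (LINT y:{a<..}|lborel. g y)"
      unfolding set_lebesgue_integral_def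
    proof (rule integral_dominated_convergence[where w = "\<lambda>y. cmod (g y)"])
      show "AE y in lborel. (\<lambda>n. indicat_real {r n<..} y *\<^sub>R g y) \<longlonglongrightarrow> indicat_real {a<..} y *\<^sub>R g y"
      proof (intro AE_I2)
        fix y
        show "(\<lambda>n. indicat_real {r n<..} y *\<^sub>R g y) \<longlonglongrightarrow> indicat_real {a<..} y *\<^sub>R g y"
        proof (cases "a < y")
          case True
          have "\<forall>\<^sub>F n in sequentially. r n < y" by (rule order_tendstoD(2)[OF rlim True])
          then have "\<forall>\<^sub>F n in sequentially. indicat_real {r n<..} y *\<^sub>R g y = indicat_real {a<..} y *\<^sub>R g y"
            by eventually_elim (use True in simp)
          then show ?thesis by (rule tendsto_eventually)
        next
          case False
          then have e: "indicat_real {r n<..} y *\<^sub>R g y = indicat_real {a<..} y *\<^sub>R g y" for n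
            using r(2)[of n] by (simp add: indicator_def)
          show ?thesis unfolding e by (rule tendsto_const)
        qed
      qed
    qed (use g in \<open>auto simp: indicator_def\<close>)
    then have "(\<lambda>n. 0 :: complex) \<longlonglongrightarrow> (LINT y:{a<..}|lborel. g y)" using tails r(1) by simp
    then show ?thesis using LIMSEQ_unique tendsto_const by blast
  qed
  have Int: "Int_stable (range greaterThan :: real set set)"
  proof (rule Int_stableI_image)
    show "\<exists>c\<in>UNIV. {a<..} \<inter> {b<..} = {c<..}" for a b :: real
      by (intro bexI[of _ "max a b"]) auto
  qed
  have Pow: "range greaterThan \<subseteq> Pow (UNIV :: real set)" by simp
  fix A assume "A \<in> sets (lborel :: real measure)"
  then have "A \<in> sigma_sets UNIV (range greaterThan)"
    by (simp add: borel_Ioi sets_measure_of)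
  with Int Pow show "(LINT y:A|lborel. g y) = 0"
  proof (induction rule: sigma_sets_induct_disjoint)
    case (basic A)
    then show ?case using ray by auto
  next
    case empty
    show ?case by (simp add: set_lebesgue_integral_def)
  next
    case (compl A)
    then have A: "A \<in> sets borel" by (simp add: borel_Ioi)
    have "(LINT y:UNIV|lborel. g y) = (LINT y:A \<union> (UNIV - A)|lborel. g y)" by simp
    also have "\<dots> = (LINT y:A|lborel. g y) + (LINT y:UNIV - A|lborel. g y)"
      by (rule set_integral_Un[OF _ gA gA]) (use A in auto)
    finally show ?case using compl.IH total by (simp add: set_lebesgue_integral_def)
  next
    case (union A)
    then have A: "A i \<in> sets lborel" for i by (auto simp: borel_Ioi)
    have "(LINT y:(\<Union>i. A i)|lborel. g y) = (\<Sum>i. LINT y:A i|lborel. g y)"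
      by (rule lebesgue_integral_countable_add[OF A])
         (use union A gA[of "\<Union>i. A i"] in \<open>auto simp: disjoint_family_on_def\<close>)
    then show ?case using union by simp
  qed
qed

text \<open>
  Both kernels are tested with \<open>exp(-\<bar>y\<bar>)\<close> and its restrictions to rational rays, in either
  component. The exponential is in \<open>L\<^sup>2\<close> and nowhere zero, so the weighted difference of the
  kernels is integrable in \<open>y\<close> for almost every \<open>x\<close> and has the same zeros as the difference
  itself.
\<close>
lemma inverse_kernel_unique:
  assumes K: "inverse_kernel \<kappa> q K" and K': "inverse_kernel \<kappa> q K'"
  shows "AE x in lborel. AE y in lborel. K x y = K' x y"
proof -
  define w where "w y = complex_of_real (exp (- \<bar>y\<bar>))" for y
  \<comment> \<open>The index \<open>None\<close> stands for the whole line, \<open>Some r\<close> for the ray above \<open>r\<close>.\<close>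
  define t where "t r y = (case r of None \<Rightarrow> w y | Some r \<Rightarrow> indicat_real {r<..} y *\<^sub>R w y)" for r y
  define T where "T r j y = (axis j (t r y) :: complex ^ 2)" for r j y
  have t2: "square_integrable (t r)" for r
  proof -
    have "integrable lborel (\<lambda>y. exp (- \<bar>2::real\<bar> * \<bar>y\<bar>))" by (rule exp_abs_integrable) simp
    then have i: "integrable lborel (\<lambda>y. (cmod (w y))\<^sup>2)"
      by (simp add: w_def flip: exp_double)
    have [measurable]: "w \<in> borel_measurable borel" unfolding w_def by measurable
    have [measurable]: "t r \<in> borel_measurable borel" unfolding t_def by (cases r; simp)
    show ?thesis unfolding square_integrable_def
    proof
      show "integrable lborel (\<lambda>y. (cmod (t r y))\<^sup>2)"
      proof (rule Bochner_Integration.integrable_bound[OF i])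
        show "AE y in lborel. norm ((cmod (t r y))\<^sup>2) \<le> norm ((cmod (w y))\<^sup>2)"
          by (intro AE_I2) (auto simp: t_def indicator_def split: option.splits)
      qed measurable
    qed measurable
  qed
  have T2: "L2 (T r j)" for r j
    unfolding L2_iff
  proof
    fix i
    show "square_integrable (\<lambda>x. T r j x $ i)"
      using t2[of r] by (cases "i = j") (auto simp: T_def axis_def square_integrable_def)
  qed
  have test: "AE x in lborel. integrable lborel (\<lambda>y. K x y *v T r j y) \<and> integrable lborel (\<lambda>y. K' x y *v T r j y)
      \<and> (LINT y|lborel. K x y *v T r j y) = (LINT y|lborel. K' x y *v T r j y)" for r j
  proof -
    obtain u where u: "L_graph \<kappa> q u (T r j)"
      using K T2[of r j] unfolding inverse_kernel_def L_invertible_def by blast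
    have "AE x in lborel. integrable lborel (\<lambda>y. K x y *v T r j y) \<and> u x = (LINT y|lborel. K x y *v T r j y)"
      "AE x in lborel. integrable lborel (\<lambda>y. K' x y *v T r j y) \<and> u x = (LINT y|lborel. K' x y *v T r j y)"
      using K K' u unfolding inverse_kernel_def by blast+
    then show ?thesis by eventually_elim auto
  qed
  have cnt: "countable (insert None (Some ` \<rat>) :: real option set)"
    by (simp add: countable_rat)
  have "AE x in lborel. \<forall>r\<in>insert None (Some ` \<rat>). \<forall>j\<in>UNIV.
      integrable lborel (\<lambda>y. K x y *v T r j y) \<and> integrable lborel (\<lambda>y. K' x y *v T r j y)
      \<and> (LINT y|lborel. K x y *v T r j y) = (LINT y|lborel. K' x y *v T r j y)"
    by (intro AE_ball_countable[THEN iffD2] cnt ballI countable_finite finite test)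
  then show ?thesis
  proof eventually_elim
    case (elim x)
    have ent: "AE y in lborel. K x y $ i $ j = K' x y $ i $ j" for i j
    proof -
      define g where "g r y = (K x y $ i $ j - K' x y $ i $ j) * t r y" for r y
      have mv: "(A *v T r j y) $ i = A $ i $ j * t r y" for A r y
        unfolding T_def matrix2_vector_nth axis_def using exhaust_2[of j] by auto
      have g: "integrable lborel (g r) \<and> (LINT y|lborel. g r y) = 0" if r: "r \<in> insert None (Some ` \<rat>)" for r
      proof -
        have e: "integrable lborel (\<lambda>y. K x y *v T r j y)" "integrable lborel (\<lambda>y. K' x y *v T r j y)"
          "(LINT y|lborel. K x y *v T r j y) = (LINT y|lborel. K' x y *v T r j y)"
          using elim r by blast+
        have "integrable lborel (\<lambda>y. K x y $ i $ j * t r y)" "integrable lborel (\<lambda>y. K' x y $ i $ j * t r y)"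
          using e(1,2) unfolding vec2_integrable_iff by (auto simp flip: mv)
        moreover have "(LINT y|lborel. K x y $ i $ j * t r y) = (LINT y|lborel. K' x y $ i $ j * t r y)"
          using arg_cong[OF e(3), of "\<lambda>v. v $ i"] unfolding vec2_integral_nth[OF e(1)] vec2_integral_nth[OF e(2)] mv .
        ultimately show ?thesis unfolding g_def left_diff_distrib by simp
      qed
      have "AE y in lborel. g None y = 0"
      proof (rule AE_zero_if_rational_tails_zero)
        show "integrable lborel (g None)" "(LINT y|lborel. g None y) = 0" using g by auto
        fix r :: real assume "r \<in> \<rat>"
        then have "(LINT y|lborel. g (Some r) y) = 0" using g by auto
        moreover have "g (Some r) y = indicat_real {r<..} y *\<^sub>R g None y" for y by (simp add: g_def t_def)
        ultimately show "(LINT y:{r<..}|lborel. g None y) = 0" by (simp add: set_lebesgue_integral_def)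
      qed
      then show ?thesis by eventually_elim (simp add: g_def t_def w_def)
    qed
    have "AE y in lborel. \<forall>i\<in>UNIV. \<forall>j\<in>UNIV. K x y $ i $ j = K' x y $ i $ j"
      by (intro AE_ball_countable[THEN iffD2] ballI countable_finite finite ent)
    then show ?case by eventually_elim (simp add: vec_eq_iff)
  qed
qed

lemma continuous_AE_eq_imp_eq:
  fixes f g :: "real \<Rightarrow> 'a::t2_space"
  assumes "continuous_on UNIV f" "continuous_on UNIV g" "AE x in lborel. f x = g x"
  shows "f x = g x"
proof -
  have "closed {x. f x = g x}" using assms(1,2) by (rule closed_Collect_eq)
  moreover have "AE x in lborel. x \<in> {x. f x = g x}" using assms(3) by simp
  ultimately have "x \<in> {x. f x = g x}" for x
    by (rule mem_closed_if_AE_lebesgue[of _ x, OF _ AE_completion])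
  then show ?thesis by blast
qed

lemma is_green_diff_unique:
  assumes D: "is_green_diff \<kappa> q D" and D': "is_green_diff \<kappa> q D'"
  shows "D = D'"
proof -
  obtain G G0 H H0 where G: "inverse_kernel \<kappa> q G" "inverse_kernel \<kappa> (\<lambda>_. 0) G0" "\<And>x y. D x y = G x y - G0 x y"
    and H: "inverse_kernel \<kappa> q H" "inverse_kernel \<kappa> (\<lambda>_. 0) H0" "\<And>x y. D' x y = H x y - H0 x y"
    using D D' unfolding is_green_diff_def by blast
  have c: "continuous_on UNIV (case_prod D)" "continuous_on UNIV (case_prod D')"
    using D D' by (auto simp: is_green_diff_def)
  have cx: "continuous_on UNIV (\<lambda>x. D x y)" "continuous_on UNIV (\<lambda>x. D' x y)"
    and cy: "continuous_on UNIV (D x)" "continuous_on UNIV (D' x)" for x y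
  proof -
    have p: "continuous_on UNIV (\<lambda>x. (x, y))" "continuous_on UNIV (\<lambda>y. (x, y))"
      by (intro continuous_intros)+
    show "continuous_on UNIV (\<lambda>x. D x y)" "continuous_on UNIV (\<lambda>x. D' x y)"
      "continuous_on UNIV (D x)" "continuous_on UNIV (D' x)"
      using continuous_on_compose2[OF c(1) p(1)] continuous_on_compose2[OF c(2) p(1)]
        continuous_on_compose2[OF c(1) p(2)] continuous_on_compose2[OF c(2) p(2)] by simp_all
  qed
  have "AE x in lborel. \<forall>y. D x y = D' x y"
    using inverse_kernel_unique[OF G(1) H(1)] inverse_kernel_unique[OF G(2) H(2)]
  proof eventually_elim
    case (elim x)
    have "AE y in lborel. D x y = D' x y"
      using elim by eventually_elim (simp add: G H)
    then show ?case using continuous_AE_eq_imp_eq[OF cy] by blast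
  qed
  then have "AE x in lborel. D x y = D' x y" for y by eventually_elim blast
  then show ?thesis using continuous_AE_eq_imp_eq[OF cx] by blast
qed

section \<open>The diagonal Green's function in terms of Riccati solutions\<close>

lemma bounded_range_mult:
  fixes f g :: "'a \<Rightarrow> complex"
  assumes "bounded (range f)" "bounded (range g)"
  shows "bounded (range (\<lambda>x. f x * g x))"
proof -
  obtain A B where AB: "\<And>x. cmod (f x) \<le> A" "\<And>x. cmod (g x) \<le> B"
    using assms unfolding bounded_iff by auto
  have "A \<ge> 0" using order_trans[OF norm_ge_zero AB(1)] .
  then show ?thesis
    by (intro boundedI[of _ "A * B"]) (auto simp: norm_mult intro!: mult_mono AB)
qed

text \<open>
  The phases \<open>\<phi>\<close> and \<open>\<psi>\<close> of the conjugating matrix are bounded because \<open>q\<close> is integrable;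
  this is where the decay of Schwartz functions enters the construction of \<open>V\<close>.
\<close>
lemma bounded_integrable_antiderivative:
  fixes f :: "real \<Rightarrow> complex"
  assumes f: "continuous_on UNIV f" "integrable lborel f"
  shows "\<exists>\<phi>. (\<forall>x. (\<phi> has_vector_derivative f x) (at x)) \<and> bounded (range \<phi>)"
proof -
  define \<phi> where "\<phi> x = (LINT y:{..x}|lborel. f y)" for x
  have fA: "set_integrable lborel A f" if "A \<in> sets borel" for A
    unfolding set_integrable_def by (rule integrable_mult_indicator) (use that f in auto)
  have "cmod (\<phi> x) \<le> (LINT y|lborel. cmod (f y))" for x
    unfolding \<phi>_def set_lebesgue_integral_def
    by (rule Bochner_Integration.integral_norm_bound_integral)
       (use fA[of "{..x}"] f in \<open>auto simp: set_integrable_def indicator_def\<close>)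
  moreover have "(\<phi> has_vector_derivative f x) (at x)" for x
  proof -
    have eq: "\<phi> y = \<phi> (x - 1) + integral {x-1..y} f" if "x - 1 < y" for y
    proof -
      have "\<phi> y = (LINT z:{..<x-1} \<union> {x-1..y}|lborel. f z)"
        unfolding \<phi>_def by (rule arg_cong[where f="\<lambda>A. set_lebesgue_integral lborel A f"]) (use that in auto)
      also have "\<dots> = (LINT z:{..<x-1}|lborel. f z) + (LINT z:{x-1..y}|lborel. f z)"
        by (rule set_integral_Un[OF _ fA fA]) auto
      also have "(LINT z:{..<x-1}|lborel. f z) = \<phi> (x - 1)"
        unfolding \<phi>_def set_lebesgue_integral_def
        using f(2) by (intro integral_cong_AE)
           (auto simp: indicator_def intro!: eventually_mono[OF AE_lborel_singleton[of "x - 1"]])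
      also have "(LINT z:{x-1..y}|lborel. f z) = integral {x-1..y} f"
        by (rule set_borel_integral_eq_integral(2)[OF fA]) simp
      finally show ?thesis .
    qed
    have "((\<lambda>u. integral {x-1..u} f) has_vector_derivative f x) (at x within {x-1..x+1})"
      by (rule integral_has_vector_derivative) (use continuous_on_subset[OF f(1)] in auto)
    then have "((\<lambda>u. \<phi> (x - 1) + integral {x-1..u} f) has_vector_derivative f x) (at x)"
      by (auto simp: at_within_interior[of x "{x-1..x+1}"] intro!: derivative_eq_intros)
    then show ?thesis
      by (rule has_vector_derivative_transform_within_open[where S="{x-1<..}"]) (auto intro!: eq[symmetric])
  qed
  ultimately show ?thesis by (intro exI[of _ \<phi>]) (auto intro!: boundedI)
qed

lemma intertwines_vectorI:
  assumes d: "\<And>x. (v11 has_vector_derivative w11 x) (at x)" "\<And>x. (v12 has_vector_derivative w12 x) (at x)"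
      "\<And>x. (v21 has_vector_derivative w21 x) (at x)" "\<And>x. (v22 has_vector_derivative w22 x) (at x)"
    and c: "continuous_on UNIV w11" "continuous_on UNIV w12" "continuous_on UNIV w21" "continuous_on UNIV w22"
    and b: "bounded (range v11)" "bounded (range v12)" "bounded (range v21)" "bounded (range v22)"
      "bounded (range w11)" "bounded (range w12)" "bounded (range w21)" "bounded (range w22)"
    and eq: "\<And>x. (vector [vector [w11 x, w12 x], vector [w21 x, w22 x]] :: complex ^ 2 ^ 2)
        + L_coeff \<kappa> q x ** vector [vector [v11 x, v12 x], vector [v21 x, v22 x]]
        = vector [vector [v11 x, v12 x], vector [v21 x, v22 x]] ** L_coeff \<kappa> p x"
  shows "intertwines \<kappa> p q (\<lambda>x. vector [vector [v11 x, v12 x], vector [v21 x, v22 x]])"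
  unfolding intertwines_def
proof (intro exI[of _ "\<lambda>x. vector [vector [w11 x, w12 x], vector [w21 x, w22 x]]"] conjI allI eq)
  define R where "R = range v11 \<union> range v12 \<union> range v21 \<union> range v22 \<union> range w11 \<union> range w12 \<union> range w21 \<union> range w22"
  have "bounded R" unfolding R_def using b by simp
  then obtain C where C: "\<And>z. z \<in> R \<Longrightarrow> cmod z \<le> C" unfolding bounded_iff by blast
  show "\<exists>C. \<forall>i j x. cmod ((vector [vector [v11 x, v12 x], vector [v21 x, v22 x]] :: complex ^ 2 ^ 2) $ i $ j) \<le> C
      \<and> cmod ((vector [vector [w11 x, w12 x], vector [w21 x, w22 x]] :: complex ^ 2 ^ 2) $ i $ j) \<le> C"
    by (intro exI[of _ C]) (auto simp: forall_2 R_def intro!: C)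
next
  fix i j :: 2 and x
  show "((\<lambda>x. (vector [vector [v11 x, v12 x], vector [v21 x, v22 x]] :: complex ^ 2 ^ 2) $ i $ j)
      has_vector_derivative (vector [vector [w11 x, w12 x], vector [w21 x, w22 x]] :: complex ^ 2 ^ 2) $ i $ j) (at x)"
    using d exhaust_2[of i] exhaust_2[of j] by auto
next
  fix i j :: 2
  show "continuous_on UNIV (\<lambda>x. (vector [vector [w11 x, w12 x], vector [w21 x, w22 x]] :: complex ^ 2 ^ 2) $ i $ j)"
    using c exhaust_2[of i] exhaust_2[of j] by auto
qed

lemma matrix2_eq_iff: "A = B \<longleftrightarrow> A $ 1 $ 1 = B $ 1 $ 1 \<and> A $ 1 $ 2 = B $ 1 $ 2 \<and> A $ 2 $ 1 = B $ 2 $ 1 \<and> A $ 2 $ 2 = B $ 2 $ 2"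
  for A B :: "complex ^ 2 ^ 2"
  by (auto simp: vec_eq_iff forall_2)

text \<open>
  With \<open>\<phi>' = \<kappa>q a\<close> and \<open>\<psi>' = \<kappa>r b\<close> the Riccati equations say exactly that the columns
  \<open>exp(\<phi>) (1,a)\<close> and \<open>exp(\<psi>) (b,1)\<close> of \<open>V\<close> satisfy \<open>V' + C V = V C\<^sub>0\<close> for the coefficient
  matrices \<open>C\<close> of \<open>L\<close> and \<open>C\<^sub>0\<close> of \<open>L\<^sub>0\<close>; the rows of the inverse \<open>W\<close> satisfy the adjoint
  relation because \<open>(ab)' = (\<kappa>q a + \<kappa>r b)(1 - ab)\<close>. On the diagonal the phases cancel.
  Changing the sign of \<open>\<nu>\<close> exchanges the two projections in \<open>G\<^sub>0\<close>, which sum to the identity,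
  so \<open>G - G\<^sub>0\<close> changes only its sign there; the factor \<open>sgn(i\<kappa>\<^sup>2)\<close> in the definitions removes
  it.
\<close>
theorem green_diff_riccati:
  assumes \<kappa>: "\<i> * \<kappa>\<^sup>2 = complex_of_real \<nu>" and \<nu>: "\<nu> \<noteq> 0"
    and q: "continuous_on UNIV q" "bounded (range q)" "integrable lborel q"
    and a: "\<And>x. (a has_vector_derivative
               (complex_of_real (2 * \<nu>) * a x + \<kappa> * rfun q x - \<kappa> * q x * (a x)\<^sup>2)) (at x)"
    and b: "\<And>x. (b has_vector_derivative
               (complex_of_real (2 * - \<nu>) * b x + \<kappa> * q x - \<kappa> * rfun q x * (b x)\<^sup>2)) (at x)"
    and ab: "\<And>x. cmod (a x) \<le> 1 / 2" "\<And>x. cmod (b x) \<le> 1 / 2"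
  shows "L_invertible \<kappa> q" "is_green_diff \<kappa> q (green_diff \<kappa> q)"
    "gam \<kappa> q x = 2 * a x * b x / (1 - a x * b x)"
    "g12 \<kappa> q x = - b x / (1 - a x * b x)"
    "g21 \<kappa> q x = a x / (1 - a x * b x)"
proof -
  define r where "r = rfun q"
  have ca: "continuous_on S a" and cb: "continuous_on S b" for S
    using a b by (meson continuous_at_imp_continuous_on has_vector_derivative_continuous)+
  have cq: "continuous_on S q" and cr: "continuous_on S r" for S
    using continuous_on_subset[OF q(1)] unfolding r_def rfun_def by (auto intro!: continuous_intros)
  obtain Cq where Cq: "\<And>x. cmod (q x) \<le> Cq" using q(2) unfolding bounded_iff by auto
  have Cr: "cmod (r x) \<le> Cq" for x using Cq[of x] by (simp add: r_def rfun_def)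
  have ri: "integrable lborel r" using q(3) by (simp add: r_def rfun_def[abs_def])
  have det: "cmod (a x * b x) \<le> 1 / 4" for x
    using mult_mono[OF ab(1)[of x] ab(2)[of x]] by (simp add: norm_mult)
  have det0: "1 - a x * b x \<noteq> 0" for x using det[of x] by auto
  have mult_int: "integrable lborel (\<lambda>x. \<kappa> * p x * c x)"
    if p: "integrable lborel p" "continuous_on UNIV c" "\<And>x. cmod (c x) \<le> 1 / 2" for p c :: "real \<Rightarrow> complex"
  proof -
    have [measurable]: "p \<in> borel_measurable borel" "c \<in> borel_measurable borel"
      using p by (auto dest: borel_measurable_integrable intro!: borel_measurable_continuous_onI)
    have "integrable lborel (\<lambda>x. \<kappa> * p x)" using p(1) by simp
    then show ?thesis
    proof (rule Bochner_Integration.integrable_bound)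
      have "cmod (\<kappa> * p x) * cmod (c x) \<le> cmod (\<kappa> * p x) * 1" for x
        using p(3)[of x] by (intro mult_left_mono) auto
      then show "AE x in lborel. norm (\<kappa> * p x * c x) \<le> norm (\<kappa> * p x)"
        unfolding norm_mult[of _ "c _"] by (intro AE_I2) simp
    qed measurable
  qed
  have ctn: "continuous_on UNIV (\<lambda>x. \<kappa> * q x * a x)" "continuous_on UNIV (\<lambda>x. \<kappa> * r x * b x)"
    by (intro continuous_intros ca cb cq cr)+
  obtain \<phi> where d\<phi>: "\<And>x. (\<phi> has_vector_derivative \<kappa> * q x * a x) (at x)" and b\<phi>: "bounded (range \<phi>)"
    using bounded_integrable_antiderivative[OF ctn(1) mult_int[OF q(3) ca ab(1)]] by blast
  obtain \<psi> where d\<psi>: "\<And>x. (\<psi> has_vector_derivative \<kappa> * r x * b x) (at x)" and b\<psi>: "bounded (range \<psi>)"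
    using bounded_integrable_antiderivative[OF ctn(2) mult_int[OF ri cb ab(2)]] by blast
  define E F where "E x = exp (\<phi> x)" and "F x = exp (\<psi> x)" for x
  define P N where "P x = exp (- \<phi> x) / (1 - a x * b x)" and "N x = exp (- \<psi> x) / (1 - a x * b x)" for x
  have dexp: "((\<lambda>x. exp (c * f x)) has_vector_derivative exp (c * f x) * (c * f')) (at x)"
    if "(f has_vector_derivative f') (at x)" for f :: "real \<Rightarrow> complex" and f' x c
  proof -
    have "((\<lambda>x. c * f x) has_vector_derivative c * f') (at x)"
      by (rule has_vector_derivative_mult_right[OF that])
    from field_vector_diff_chain_at[OF this, of exp "exp (c * f x)"] DERIV_exp
    have "((exp \<circ> (\<lambda>x. c * f x)) has_vector_derivative c * f' * exp (c * f x)) (at x)" by blast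
    then show ?thesis by (simp add: o_def mult.commute)
  qed
  have dE: "(E has_vector_derivative \<kappa> * q x * a x * E x) (at x)" for x
    using dexp[OF d\<phi>, of 1 x] by (simp add: E_def[abs_def] mult_ac)
  have dF: "(F has_vector_derivative \<kappa> * r x * b x * F x) (at x)" for x
    using dexp[OF d\<psi>, of 1 x] by (simp add: F_def[abs_def] mult_ac)
  have a': "(a has_vector_derivative (of_real (2 * \<nu>) * a x + \<kappa> * r x - \<kappa> * q x * (a x)\<^sup>2)) (at x)"
    and b': "(b has_vector_derivative (of_real (2 * - \<nu>) * b x + \<kappa> * q x - \<kappa> * r x * (b x)\<^sup>2)) (at x)" for x
    using a[of x] b[of x] by (simp_all add: r_def)
  have dinv: "((\<lambda>x. inverse (1 - a x * b x)) has_vector_derivative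
      (\<kappa> * q x * a x + \<kappa> * r x * b x) * inverse (1 - a x * b x)) (at x)" for x
  proof -
    have 1: "((\<lambda>x. 1 - a x * b x) has_vector_derivative - ((\<kappa> * q x * a x + \<kappa> * r x * b x) * (1 - a x * b x))) (at x)"
      by (rule has_vector_derivative_eq_rhs, (rule a' b' derivative_eq_intros refl)+)
         (simp add: algebra_simps power2_eq_square)
    have 2: "(inverse has_field_derivative - (inverse (1 - a x * b x) ^ Suc (Suc 0))) (at (1 - a x * b x))"
      by (rule DERIV_inverse[OF det0])
    have "((inverse \<circ> (\<lambda>x. 1 - a x * b x)) has_vector_derivative
        - ((\<kappa> * q x * a x + \<kappa> * r x * b x) * (1 - a x * b x)) * - (inverse (1 - a x * b x) ^ Suc (Suc 0))) (at x)"
      by (rule field_vector_diff_chain_at[OF 1 2])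
    also have "- ((\<kappa> * q x * a x + \<kappa> * r x * b x) * (1 - a x * b x)) * - (inverse (1 - a x * b x) ^ Suc (Suc 0))
        = (\<kappa> * q x * a x + \<kappa> * r x * b x) * inverse (1 - a x * b x)"
      using det0[of x] by simp
    finally show ?thesis by (simp add: o_def)
  qed
  have dP: "(P has_vector_derivative \<kappa> * r x * b x * P x) (at x)" for x
    unfolding P_def divide_inverse
    by (rule has_vector_derivative_eq_rhs, rule has_vector_derivative_mult[OF dexp[OF d\<phi>, of "-1" x, simplified] dinv])
       (simp add: algebra_simps)
  have dN: "(N has_vector_derivative \<kappa> * q x * a x * N x) (at x)" for x
    unfolding N_def divide_inverse
    by (rule has_vector_derivative_eq_rhs, rule has_vector_derivative_mult[OF dexp[OF d\<psi>, of "-1" x, simplified] dinv])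
       (simp add: algebra_simps)
  have cont: "continuous_on UNIV E" "continuous_on UNIV F" "continuous_on UNIV P" "continuous_on UNIV N"
    using dE dF dP dN by (meson continuous_at_imp_continuous_on has_vector_derivative_continuous)+
  have bexp: "bounded (range (\<lambda>x. exp (c * f x)))" if f: "bounded (range f)" for f :: "real \<Rightarrow> complex" and c
  proof -
    obtain M where M: "\<And>x. cmod (f x) \<le> M" using f unfolding bounded_iff by auto
    have *: "cmod (exp (c * f x)) \<le> exp (cmod c * M)" for x
      by (rule order_trans[OF norm_exp]) (simp add: norm_mult mult_left_mono M)
    show ?thesis by (rule boundedI[of _ "exp (cmod c * M)"]) (use * in blast)
  qed
  have ba: "bounded (range a)" "bounded (range b)" using ab by (auto intro!: boundedI[of _ "1 / 2"])
  have bq: "bounded (range q)" "bounded (range r)" using Cq Cr by (auto intro!: boundedI[of _ Cq])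
  have bc: "bounded (range (\<lambda>x. c))" for c :: complex by (auto intro!: boundedI[of _ "cmod c"])
  have binv: "bounded (range (\<lambda>x. inverse (1 - a x * b x)))"
  proof (intro boundedI)
    fix z assume "z \<in> range (\<lambda>x. inverse (1 - a x * b x))"
    then obtain x where z: "z = inverse (1 - a x * b x)" by auto
    have "1 / 2 \<le> cmod (1 - a x * b x)"
      using norm_triangle_ineq2[of 1 "a x * b x"] det[of x] by simp
    then show "norm z \<le> 2" unfolding z norm_inverse
      using le_imp_inverse_le[of "1/2" "cmod (1 - a x * b x)"] by simp
  qed
  have bd: "bounded (range E)" "bounded (range F)" "bounded (range P)" "bounded (range N)"
    unfolding E_def F_def P_def N_def divide_inverse
    using bexp[OF b\<phi>, of 1] bexp[OF b\<psi>, of 1]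
      bounded_range_mult[OF bexp[OF b\<phi>, of "-1"] binv] bounded_range_mult[OF bexp[OF b\<psi>, of "-1"] binv] by simp_all
  have bneg: "bounded (range (\<lambda>x. - f x))" if "bounded (range f)" for f :: "real \<Rightarrow> complex"
    using that by (auto simp: bounded_iff)
  note bintros = bounded_range_mult bounded_plus_comp bounded_minus_comp bneg bc ba bq bd
  define V W :: "real \<Rightarrow> complex ^ 2 ^ 2"
    where "V x = vector [vector [E x, b x * F x], vector [a x * E x, F x]]"
      and "W x = vector [vector [P x, - (b x * P x)], vector [- (a x * N x), N x]]" for x
  have IV: "intertwines \<kappa> (\<lambda>_. 0) q V" unfolding V_def
  proof (rule intertwines_vectorI)
    show "(E has_vector_derivative \<kappa> * q x * a x * E x) (at x)" for x by (rule dE)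
    show "(F has_vector_derivative \<kappa> * r x * b x * F x) (at x)" for x by (rule dF)
    show "((\<lambda>x. b x * F x) has_vector_derivative (of_real (2 * - \<nu>) * b x + \<kappa> * q x) * F x) (at x)" for x
      by (rule has_vector_derivative_eq_rhs, rule has_vector_derivative_mult[OF b' dF])
         (simp add: algebra_simps power2_eq_square)
    show "((\<lambda>x. a x * E x) has_vector_derivative (of_real (2 * \<nu>) * a x + \<kappa> * r x) * E x) (at x)" for x
      by (rule has_vector_derivative_eq_rhs, rule has_vector_derivative_mult[OF a' dE])
         (simp add: algebra_simps power2_eq_square)
    show "vector [vector [\<kappa> * q x * a x * E x, (of_real (2 * - \<nu>) * b x + \<kappa> * q x) * F x],
            vector [(of_real (2 * \<nu>) * a x + \<kappa> * r x) * E x, \<kappa> * r x * b x * F x]]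
        + L_coeff \<kappa> q x ** vector [vector [E x, b x * F x], vector [a x * E x, F x]]
        = vector [vector [E x, b x * F x], vector [a x * E x, F x]] ** L_coeff \<kappa> (\<lambda>_. 0) x" for x
      unfolding L_coeff_def \<kappa> r_def[symmetric]
      by (simp add: matrix2_eq_iff matrix2_mult_nth rfun_def[of "\<lambda>_. 0"] algebra_simps \<kappa>)
  qed (intro continuous_intros ca cb cq cr cont bintros)+
  have IW: "intertwines \<kappa> q (\<lambda>_. 0) W" unfolding W_def
  proof (rule intertwines_vectorI)
    show "(P has_vector_derivative \<kappa> * r x * b x * P x) (at x)" for x by (rule dP)
    show "(N has_vector_derivative \<kappa> * q x * a x * N x) (at x)" for x by (rule dN)
    show "((\<lambda>x. - (b x * P x)) has_vector_derivative (of_real (2 * \<nu>) * b x - \<kappa> * q x) * P x) (at x)" for x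
      by (rule has_vector_derivative_eq_rhs, rule has_vector_derivative_minus, rule has_vector_derivative_mult[OF b' dP])
         (simp add: algebra_simps power2_eq_square)
    show "((\<lambda>x. - (a x * N x)) has_vector_derivative - (of_real (2 * \<nu>) * a x + \<kappa> * r x) * N x) (at x)" for x
      by (rule has_vector_derivative_eq_rhs, rule has_vector_derivative_minus, rule has_vector_derivative_mult[OF a' dN])
         (simp add: algebra_simps power2_eq_square)
    show "vector [vector [\<kappa> * r x * b x * P x, (of_real (2 * \<nu>) * b x - \<kappa> * q x) * P x],
            vector [- (of_real (2 * \<nu>) * a x + \<kappa> * r x) * N x, \<kappa> * q x * a x * N x]]
        + L_coeff \<kappa> (\<lambda>_. 0) x ** vector [vector [P x, - (b x * P x)], vector [- (a x * N x), N x]]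
        = vector [vector [P x, - (b x * P x)], vector [- (a x * N x), N x]] ** L_coeff \<kappa> q x" for x
      unfolding L_coeff_def \<kappa> r_def[symmetric]
      by (simp add: matrix2_eq_iff matrix2_mult_nth rfun_def[of "\<lambda>_. 0"] algebra_simps \<kappa>)
  qed (intro continuous_intros ca cb cq cr cont bintros)+
  have EP: "E x * P x = 1 / (1 - a x * b x)" and FN: "F x * N x = 1 / (1 - a x * b x)" for x
    by (simp_all add: E_def P_def F_def N_def exp_minus)
  have PE: "P x * E x = 1 / (1 - a x * b x)" and NF: "N x * F x = 1 / (1 - a x * b x)" for x
    using EP[of x] FN[of x] by (simp_all add: mult.commute)
  have VW: "V x ** W x = mat 1" for x
  proof -
    have one: "1 / (1 - a x * b x) - a x * b x * (1 / (1 - a x * b x)) = 1"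
      using det0[of x] by (simp add: field_simps)
    have "E x * P x + b x * F x * - (a x * N x) = E x * P x - a x * b x * (F x * N x)"
      "E x * - (b x * P x) + b x * F x * N x = b x * (F x * N x) - b x * (E x * P x)"
      "a x * E x * P x + F x * - (a x * N x) = a x * (E x * P x) - a x * (F x * N x)"
      "a x * E x * - (b x * P x) + F x * N x = F x * N x - a x * b x * (E x * P x)"
      by (simp_all add: algebra_simps)
    then have "E x * P x + b x * F x * - (a x * N x) = 1" "E x * - (b x * P x) + b x * F x * N x = 0"
      "a x * E x * P x + F x * - (a x * N x) = 0" "a x * E x * - (b x * P x) + F x * N x = 1"
      unfolding EP FN one by simp_all
    then show ?thesis
      unfolding matrix2_eq_iff matrix2_mult_nth mat_def V_def W_def by simp
  qed
  have WV: "W x ** V x = mat 1" for x using VW[of x] by (simp add: matrix_left_right_inverse)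
  define D where "D x y = V x ** free_kernel \<nu> x y ** W y - free_kernel \<nu> x y" for x y
  have isD: "is_green_diff \<kappa> q D"
    unfolding D_def by (rule is_green_diff_conjugated[OF \<kappa> \<nu> IV IW VW WV])
  have GD: "green_diff \<kappa> q = D"
    unfolding green_diff_def by (rule the_equality) (use isD is_green_diff_unique in blast)+
  show "L_invertible \<kappa> q"
    using conjugated_inverse_kernel[OF \<kappa> \<nu> IV IW VW WV] by (simp add: inverse_kernel_def)
  show "is_green_diff \<kappa> q (green_diff \<kappa> q)" using isD GD by simp
  define \<Delta> where "\<Delta> = 1 - a x * b x"
  have \<Delta>0: "\<Delta> \<noteq> 0" using det0 by (simp add: \<Delta>_def)
  have ent: "D x x $ 1 $ 1 = of_real (sgn \<nu>) * (a x * b x / \<Delta>)" "D x x $ 1 $ 2 = - of_real (sgn \<nu>) * (b x / \<Delta>)"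
    "D x x $ 2 $ 1 = of_real (sgn \<nu>) * (a x / \<Delta>)" "D x x $ 2 $ 2 = - of_real (sgn \<nu>) * (a x * b x / \<Delta>)"
  proof -
    have x1: "E x * (P x * z) = z / \<Delta>" "F x * (N x * z) = z / \<Delta>" for z
      using EP[of x] FN[of x] by (simp_all add: \<Delta>_def flip: mult.assoc)
    have one: "1 / \<Delta> - 1 = a x * b x / \<Delta>" using \<Delta>0 by (simp add: field_simps) (simp add: \<Delta>_def)
    consider "\<nu> > 0" | "\<nu> < 0" using \<nu> by linarith
    then have "D x x $ 1 $ 1 = of_real (sgn \<nu>) * (a x * b x / \<Delta>) \<and> D x x $ 1 $ 2 = - of_real (sgn \<nu>) * (b x / \<Delta>) \<and>
      D x x $ 2 $ 1 = of_real (sgn \<nu>) * (a x / \<Delta>) \<and> D x x $ 2 $ 2 = - of_real (sgn \<nu>) * (a x * b x / \<Delta>)"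
    proof cases
      case 1
      then show ?thesis
        using one x1[of 1] x1[of "b x"] x1[of "a x"] x1[of "a x * b x"]
        by (simp add: D_def matrix2_mult_nth V_def W_def free_kernel_def scalar_kernel_def mult_ac)
    next
      case 2
      then show ?thesis
        using one x1[of 1] x1[of "b x"] x1[of "a x"] x1[of "a x * b x"]
        by (simp add: D_def matrix2_mult_nth V_def W_def free_kernel_def scalar_kernel_def mult_ac)
    qed
    then show "D x x $ 1 $ 1 = of_real (sgn \<nu>) * (a x * b x / \<Delta>)" "D x x $ 1 $ 2 = - of_real (sgn \<nu>) * (b x / \<Delta>)"
      "D x x $ 2 $ 1 = of_real (sgn \<nu>) * (a x / \<Delta>)" "D x x $ 2 $ 2 = - of_real (sgn \<nu>) * (a x * b x / \<Delta>)" by blast+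
  qed
  have sg: "sgn (complex_of_real \<nu>) * (complex_of_real (sgn \<nu>) * z) = z" for z
    using \<nu> by (cases "\<nu> > 0") (auto simp: sgn_of_real)
  show "gam \<kappa> q x = 2 * a x * b x / (1 - a x * b x)"
    unfolding gam_def GD ent \<kappa> \<Delta>_def[symmetric] using sg[of "2 * a x * b x / \<Delta>"] by (simp add: algebra_simps)
  show "g12 \<kappa> q x = - b x / (1 - a x * b x)"
    unfolding g12_def GD ent \<kappa> \<Delta>_def[symmetric] using sg[of "- b x / \<Delta>"] by simp
  show "g21 \<kappa> q x = a x / (1 - a x * b x)"
    unfolding g21_def GD ent \<kappa> \<Delta>_def[symmetric] using sg[of "a x / \<Delta>"] by simp
qed

section \<open>Schwartz functions\<close>

lemma schwartz_dx:
  assumes f: "schwartz f"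
  shows "schwartz (dx f)"
proof -
  have "(dx ^^ n) (dx f) = (dx ^^ Suc n) f" for n by (simp add: funpow_swap1)
  then show ?thesis using f unfolding schwartz_def by presburger
qed

lemma schwartz_has_vector_derivative:
  assumes "schwartz f"
  shows "(f has_vector_derivative dx f x) (at x)"
proof -
  have "\<forall>n x. (dx ^^ n) f differentiable (at x)" using assms by (simp add: schwartz_def)
  from this[rule_format, of 0 x] have "f differentiable (at x)" by simp
  then show ?thesis unfolding dx_def by (simp add: vector_derivative_works)
qed

lemma schwartz_continuous:
  assumes "schwartz f"
  shows "continuous_on S f"
  using schwartz_has_vector_derivative[OF assms]
  by (meson continuous_at_imp_continuous_on has_vector_derivative_continuous)

lemma schwartz_decay:
  assumes "schwartz f"
  shows "\<exists>C. \<forall>x. \<bar>x\<bar> ^ m * cmod (f x) \<le> C"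
proof -
  have "\<forall>m n. bdd_above (range (\<lambda>x. \<bar>x\<bar> ^ m * cmod ((dx ^^ n) f x)))"
    using assms by (simp add: schwartz_def)
  from this[rule_format, of m 0] show ?thesis unfolding bdd_above_def by auto
qed

lemma schwartz_bounded:
  assumes "schwartz f"
  shows "bounded (range f)"
  using schwartz_decay[OF assms, of 0] by (auto intro: boundedI)

lemma integrable_inverse_quadratic: "integrable lborel (\<lambda>x::real. inverse (1 + x\<^sup>2))"
  using integrable_inverse_1_plus_square by (simp add: set_integrable_def)

lemma inverse_quadratic_bound:
  assumes "\<And>x. cmod (g x) \<le> A" "\<And>x. x\<^sup>2 * cmod (g x) \<le> B"
  shows "cmod (g x) \<le> (A + B) * inverse (1 + x\<^sup>2)"
proof -
  have "cmod (g x) * (1 + x\<^sup>2) \<le> A + B"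
    using assms(1)[of x] assms(2)[of x] by (simp add: algebra_simps)
  moreover have "1 + x\<^sup>2 > 0" by (simp add: add_pos_nonneg)
  ultimately show ?thesis by (simp add: divide_inverse[symmetric] pos_le_divide_eq)
qed

lemma integrable_if_inverse_quadratic_bound:
  assumes "g \<in> borel_measurable lborel" and C: "\<And>x. cmod (g x) \<le> C * inverse (1 + x\<^sup>2)"
  shows "integrable lborel g"
proof (rule Bochner_Integration.integrable_bound)
  show "integrable lborel (\<lambda>x. C * inverse (1 + x\<^sup>2))"
    using integrable_inverse_quadratic by simp
  show "AE x in lborel. norm (g x) \<le> norm (C * inverse (1 + x\<^sup>2))"
    by (intro AE_I2) (use C in \<open>auto intro: order_trans[OF _ abs_ge_self]\<close>)
qed fact

lemma schwartz_inverse_quadratic_bound: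
  assumes "schwartz f"
  shows "\<exists>C. \<forall>x. cmod (f x) \<le> C * inverse (1 + x\<^sup>2)"
proof -
  obtain A B where A: "\<And>x. \<bar>x\<bar> ^ 0 * cmod (f x) \<le> A" and B: "\<And>x. \<bar>x\<bar> ^ 2 * cmod (f x) \<le> B"
    using schwartz_decay[OF assms] by blast
  then show ?thesis using inverse_quadratic_bound[of f A B] by auto
qed

lemma schwartz_integrable:
  assumes "schwartz f"
  shows "integrable lborel f"
proof -
  obtain C where "\<And>x. cmod (f x) \<le> C * inverse (1 + x\<^sup>2)"
    using schwartz_inverse_quadratic_bound[OF assms] by blast
  then show ?thesis
    using borel_measurable_continuous_onI[OF schwartz_continuous[OF assms]]
    by (intro integrable_if_inverse_quadratic_bound) auto
qed

lemma schwartz_square_integrable: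
  assumes "schwartz f"
  shows "square_integrable f"
proof -
  have [measurable]: "f \<in> borel_measurable borel"
    using borel_measurable_continuous_onI[OF schwartz_continuous[OF assms]] by simp
  obtain A where A: "\<And>x. cmod (f x) \<le> A" using schwartz_decay[OF assms, of 0] by auto
  have "integrable lborel (\<lambda>x. A * cmod (f x))" using schwartz_integrable[OF assms] by simp
  then have "integrable lborel (\<lambda>x. (cmod (f x))\<^sup>2)"
  proof (rule Bochner_Integration.integrable_bound)
    show "AE x in lborel. norm ((cmod (f x))\<^sup>2) \<le> norm (A * cmod (f x))"
      by (intro AE_I2) (auto simp: power2_eq_square abs_mult intro!: mult_right_mono order_trans[OF A abs_ge_self])
  qed measurable
  then show ?thesis by (simp add: square_integrable_def)
qed

lemma schwartz_tendsto_0: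
  assumes "schwartz f"
  shows "(f \<longlongrightarrow> 0) at_top" "(f \<longlongrightarrow> 0) at_bot"
proof -
  obtain C where C: "\<And>x. cmod (f x) \<le> C * inverse (1 + x\<^sup>2)"
    using schwartz_inverse_quadratic_bound[OF assms] by blast
  have l: "((\<lambda>x::real. C * inverse (1 + x\<^sup>2)) \<longlongrightarrow> 0) at_top" "((\<lambda>x::real. C * inverse (1 + x\<^sup>2)) \<longlongrightarrow> 0) at_bot"
    by real_asymp+
  show "(f \<longlongrightarrow> 0) at_top" "(f \<longlongrightarrow> 0) at_bot"
    by (rule Lim_null_comparison[OF always_eventually[OF allI[OF C]] l(1)]
          Lim_null_comparison[OF always_eventually[OF allI[OF C]] l(2)])+
qed

section \<open>Fourier inversion and the Plancherel identity\<close>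

definition character :: "real \<Rightarrow> real \<Rightarrow> complex" where
  "character \<xi> x = exp (\<i> * of_real (\<xi> * x))"

lemma character_measurable [measurable]:
  "(\<lambda>z. character (fst z) (snd z)) \<in> borel_measurable (borel \<Otimes>\<^sub>M borel)"
  unfolding character_def by measurable

lemma character_measurable1 [measurable]: "character \<xi> \<in> borel_measurable borel"
  unfolding character_def by measurable

lemma norm_character [simp]: "cmod (character \<xi> x) = 1"
  by (simp add: character_def)

lemma character_uminus: "character (- \<xi>) x = cnj (character \<xi> x)"
  by (simp add: character_def exp_cnj)

lemma fourier_eq_character: "fourier f \<xi> = (LINT x|lborel. character (- \<xi>) x * f x) / of_real (sqrt (2 * pi))"
  by (simp add: fourier_def character_def)

lemma character_mult_integrable:
  assumes "integrable lborel f"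
  shows "integrable lborel (\<lambda>x. character \<xi> x * f x)"
proof (rule Bochner_Integration.integrable_bound[OF assms])
  have [measurable]: "f \<in> borel_measurable borel" using assms by (auto dest: borel_measurable_integrable)
  show "(\<lambda>x. character \<xi> x * f x) \<in> borel_measurable lborel" by measurable
qed (simp add: norm_mult)

lemma fourier_measurable:
  assumes "integrable lborel f"
  shows "fourier f \<in> borel_measurable borel"
proof -
  have [measurable]: "f \<in> borel_measurable borel" using assms by (auto dest: borel_measurable_integrable)
  have "(\<lambda>\<xi>. (LINT x|lborel. exp (- \<i> * of_real (\<xi> * x)) * f x) / of_real (sqrt (2 * pi))) \<in> borel_measurable borel"
    by measurable
  then show ?thesis by (simp add: fourier_def[abs_def])
qed

lemma fourier_bound:
  assumes "integrable lborel f"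
  shows "cmod (fourier f \<xi>) \<le> (LINT x|lborel. cmod (f x)) / sqrt (2 * pi)"
proof -
  have "cmod (LINT x|lborel. character (- \<xi>) x * f x) \<le> (LINT x|lborel. cmod (f x))"
    by (rule Bochner_Integration.integral_norm_bound_integral[OF character_mult_integrable[OF assms]])
       (use assms in \<open>auto simp: norm_mult\<close>)
  then show ?thesis
    unfolding fourier_eq_character by (simp add: norm_divide divide_right_mono)
qed

lemma character_has_vector_derivative:
  "(character \<xi> has_vector_derivative \<i> * of_real \<xi> * character \<xi> x) (at x)"
proof -
  have "((\<lambda>x. \<i> * of_real (\<xi> * x)) has_vector_derivative \<i> * of_real \<xi>) (at x)"
    by (intro has_vector_derivative_mult_right has_vector_derivative_of_real)
       (auto intro!: derivative_eq_intros simp flip: has_real_derivative_iff_has_vector_derivative)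
  from field_vector_diff_chain_at[OF this DERIV_exp]
  show ?thesis by (simp add: o_def character_def[abs_def])
qed

text \<open>
  The function \<open>exp(-i\<xi>x) (f' - i\<xi>f)\<close> is the derivative of a function that vanishes at both
  ends. Used twice, this gives quadratic decay of the transform, hence its integrability and
  the finiteness of the \<open>H\<^sup>s\<close> integral for \<open>s \<le> 1\<close>.
\<close>
lemma fourier_dx:
  assumes f: "schwartz f"
  shows "fourier (dx f) \<xi> = \<i> * of_real \<xi> * fourier f \<xi>"
proof -
  define c where "c = \<i> * complex_of_real \<xi>"
  define g where "g x = character (- \<xi>) x * dx f x - c * (character (- \<xi>) x * f x)" for x
  have gi: "integrable lborel g"
    unfolding g_def
    using character_mult_integrable[OF schwartz_integrable[OF f]]
      character_mult_integrable[OF schwartz_integrable[OF schwartz_dx[OF f]]] by simp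
  have "(LBINT x=-\<infinity>..\<infinity>. g x) = 0 - 0"
  proof (rule interval_integral_FTC_integrable[where F = "\<lambda>x. character (- \<xi>) x * f x"])
    show "((\<lambda>x. character (- \<xi>) x * f x) has_vector_derivative g x) (at x)" for x
      by (rule has_vector_derivative_eq_rhs,
          rule has_vector_derivative_mult[OF character_has_vector_derivative schwartz_has_vector_derivative[OF f]])
         (simp add: g_def c_def algebra_simps)
    have c: "continuous_on UNIV (character (- \<xi>))"
      using character_has_vector_derivative
      by (meson continuous_at_imp_continuous_on has_vector_derivative_continuous)
    have "continuous_on UNIV g"
      unfolding g_def
      by (intro continuous_intros c schwartz_continuous[OF f] schwartz_continuous[OF schwartz_dx[OF f]])
    then show "isCont g x" for x by (simp add: continuous_on_eq_continuous_at)
    show "set_integrable lborel (einterval (- \<infinity>) \<infinity>) g" using gi by (simp add: set_integrable_def)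
    have "((\<lambda>x. character (- \<xi>) x * f x) \<longlongrightarrow> 0) at_bot" "((\<lambda>x. character (- \<xi>) x * f x) \<longlongrightarrow> 0) at_top"
      using schwartz_tendsto_0[OF f] by (auto simp: tendsto_norm_zero_iff[symmetric, where f = "\<lambda>x. character (- \<xi>) x * f x"]
          norm_mult intro: tendsto_norm_zero)
    then show "(((\<lambda>x. character (- \<xi>) x * f x) \<circ> real_of_ereal) \<longlongrightarrow> 0) (at_right (- \<infinity>))"
      "(((\<lambda>x. character (- \<xi>) x * f x) \<circ> real_of_ereal) \<longlongrightarrow> 0) (at_left \<infinity>)"
      by (simp_all add: ereal_tendsto_simps)
  qed simp
  then have "(LINT x|lborel. g x) = 0"
    by (simp add: interval_lebesgue_integral_def set_lebesgue_integral_def)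
  then have "(LINT x|lborel. character (- \<xi>) x * dx f x) = c * (LINT x|lborel. character (- \<xi>) x * f x)"
    unfolding g_def
    using character_mult_integrable[OF schwartz_integrable[OF f]]
      character_mult_integrable[OF schwartz_integrable[OF schwartz_dx[OF f]]] by simp
  then show ?thesis by (simp add: fourier_eq_character c_def)
qed

lemma fourier_schwartz_bound:
  assumes f: "schwartz f"
  shows "\<exists>C. \<forall>\<xi>. cmod (fourier f \<xi>) \<le> C * inverse (1 + \<xi>\<^sup>2)"
proof -
  define A where "A = (LINT x|lborel. cmod (f x)) / sqrt (2 * pi)"
  define B where "B = (LINT x|lborel. cmod (dx (dx f) x)) / sqrt (2 * pi)"
  have A: "cmod (fourier f \<xi>) \<le> A" for \<xi> unfolding A_def by (rule fourier_bound[OF schwartz_integrable[OF f]])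
  have B: "\<xi>\<^sup>2 * cmod (fourier f \<xi>) \<le> B" for \<xi>
    using fourier_bound[OF schwartz_integrable[OF schwartz_dx[OF schwartz_dx[OF f]]], of \<xi>]
    unfolding B_def fourier_dx[OF schwartz_dx[OF f]] fourier_dx[OF f]
    by (simp add: norm_mult power2_eq_square mult.assoc flip: mult.assoc[of "\<bar>\<xi>\<bar>" "\<bar>\<xi>\<bar>"])
  show ?thesis using inverse_quadratic_bound[OF A B] by blast
qed

lemma fourier_schwartz_integrable:
  assumes f: "schwartz f"
  shows "integrable lborel (fourier f)"
proof -
  obtain C where "\<And>x. cmod (fourier f x) \<le> C * inverse (1 + x\<^sup>2)"
    using fourier_schwartz_bound[OF assms] by blast
  then show ?thesis
    using fourier_measurable[OF schwartz_integrable[OF f]]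
    by (intro integrable_if_inverse_quadratic_bound) auto
qed

text \<open>
  The Gaussian is normalised to be \<open>1\<close> at the origin, as needed for a summability factor.
\<close>
definition gauss :: "real \<Rightarrow> real" where "gauss z = exp (- z\<^sup>2 / 2)"

lemma gauss_measurable [measurable]: "gauss \<in> borel_measurable borel"
  unfolding gauss_def by measurable

lemma gauss_eq: "gauss z = sqrt (2 * pi) * std_normal_density z"
  by (simp add: gauss_def std_normal_density_def)

lemma gauss_integrable: "integrable lborel gauss"
  unfolding gauss_eq using integrable_std_normal_moment[of 0] by simp

lemma gauss_fourier: "(LINT z|lborel. of_real (gauss z) * character t z) = of_real (sqrt (2 * pi) * gauss t)"
proof -
  have "(LINT z|std_normal_distribution. iexp (t * z)) = of_real (exp (- (t\<^sup>2) / 2))"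
    using char_std_normal_distribution by (simp add: char_def fun_eq_iff)
  moreover have "(LINT z|std_normal_distribution. iexp (t * z)) = (LINT z|lborel. std_normal_density z *\<^sub>R iexp (t * z))"
    by (rule integral_density) auto
  ultimately have "(LINT z|lborel. std_normal_density z *\<^sub>R character t z) = of_real (gauss t)"
    by (simp add: character_def gauss_def)
  then have "of_real (sqrt (2 * pi)) * (LINT z|lborel. std_normal_density z *\<^sub>R character t z) = of_real (sqrt (2 * pi) * gauss t)"
    by simp
  then show ?thesis
    by (simp add: gauss_eq scaleR_conv_of_real mult.assoc del: integral_mult_right_zero flip: integral_mult_right_zero)
qed

lemma gauss_integral: "(LINT z|lborel. complex_of_real (gauss z)) = of_real (sqrt (2 * pi))"
  using gauss_fourier[of 0] by (simp add: character_def gauss_def)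

text \<open>
  Fubini moves the transform from \<open>f\<close> to the Gaussian, which is a multiple of its own
  transform; rescaling by \<open>\<epsilon>\<close> turns the result into an average of \<open>f\<close> around \<open>x\<close> at scale \<open>\<epsilon>\<close>.
\<close>
lemma regularized_inversion:
  assumes f: "integrable lborel f" and \<epsilon>: "\<epsilon> > 0"
  shows "(LINT \<xi>|lborel. of_real (gauss (\<epsilon> * \<xi>)) * character \<xi> x * fourier f \<xi>)
       = (LINT w|lborel. of_real (gauss w) * f (x + \<epsilon> * w))"
proof -
  define S where "S = complex_of_real (sqrt (2 * pi))"
  have S0: "S \<noteq> 0" by (simp add: S_def)
  define p where "p \<xi> = complex_of_real (gauss (\<epsilon> * \<xi>)) * character \<xi> x" for \<xi>
  define K where "K \<xi> y = character (- \<xi>) y" for \<xi> y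
  have [measurable]: "(\<lambda>\<xi>. character \<xi> x) \<in> borel_measurable borel" unfolding character_def by measurable
  have [measurable]: "p \<in> borel_measurable borel" unfolding p_def by measurable
  have "integrable lborel (\<lambda>\<xi>. gauss (0 + \<epsilon> * \<xi>))"
    by (rule lborel_integrable_real_affine[OF gauss_integrable]) (use \<epsilon> in simp)
  then have pi: "integrable lborel p"
    by (rule Bochner_Integration.integrable_bound) (auto simp: p_def norm_mult gauss_def)
  have inner: "(LINT \<xi>|lborel. p \<xi> * K \<xi> y) = S * of_real (gauss ((y - x) / \<epsilon>)) / of_real \<epsilon>" for y
  proof -
    have "(LINT \<xi>|lborel. p \<xi> * K \<xi> y)
        = \<bar>1 / \<epsilon>\<bar> *\<^sub>R (LINT \<xi>|lborel. p (0 + 1 / \<epsilon> * \<xi>) * K (0 + 1 / \<epsilon> * \<xi>) y)"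
      by (rule lborel_integral_real_affine) (use \<epsilon> in simp)
    also have "(\<lambda>\<xi>. p (0 + 1 / \<epsilon> * \<xi>) * K (0 + 1 / \<epsilon> * \<xi>) y)
        = (\<lambda>\<xi>. of_real (gauss \<xi>) * character ((x - y) / \<epsilon>) \<xi>)"
      unfolding p_def K_def character_def using \<epsilon>
      by (auto simp: fun_eq_iff field_simps simp flip: exp_add)
    finally have "(LINT \<xi>|lborel. p \<xi> * K \<xi> y)
        = \<bar>1 / \<epsilon>\<bar> *\<^sub>R (LINT \<xi>|lborel. of_real (gauss \<xi>) * character ((x - y) / \<epsilon>) \<xi>)" .
    moreover have "gauss ((x - y) / \<epsilon>) = gauss ((y - x) / \<epsilon>)"
      by (simp add: gauss_def power_divide power2_commute)
    ultimately show ?thesis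
      using \<epsilon> by (simp add: gauss_fourier S_def scaleR_conv_of_real)
  qed
  have "(LINT \<xi>|lborel. p \<xi> * (LINT y|lborel. K \<xi> y * f y)) = (LINT y|lborel. (LINT \<xi>|lborel. p \<xi> * K \<xi> y) * f y)"
    by (rule Fubini_bounded_kernel[OF pi f, where C = 1]) (auto simp: K_def character_def split_beta')
  also have "\<dots> = (LINT y|lborel. S * of_real (gauss ((y - x) / \<epsilon>)) / of_real \<epsilon> * f y)"
    unfolding inner ..
  also have "\<dots> = \<bar>\<epsilon>\<bar> *\<^sub>R (LINT w|lborel. S * of_real (gauss ((x + \<epsilon> * w - x) / \<epsilon>)) / of_real \<epsilon> * f (x + \<epsilon> * w))"
    by (rule lborel_integral_real_affine) (use \<epsilon> in simp)
  also have "\<dots> = S * (LINT w|lborel. of_real (gauss w) * f (x + \<epsilon> * w))"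
  proof -
    have "(\<lambda>w. S * of_real (gauss ((x + \<epsilon> * w - x) / \<epsilon>)) / of_real \<epsilon> * f (x + \<epsilon> * w))
        = (\<lambda>w. (S / of_real \<epsilon>) * (of_real (gauss w) * f (x + \<epsilon> * w)))"
      using \<epsilon> by (auto simp: fun_eq_iff)
    then show ?thesis
      using \<epsilon> by (simp add: scaleR_conv_of_real del: times_divide_eq_left)
  qed
  finally have "(LINT \<xi>|lborel. p \<xi> * (LINT y|lborel. K \<xi> y * f y)) = S * (LINT w|lborel. of_real (gauss w) * f (x + \<epsilon> * w))" .
  moreover have "(LINT \<xi>|lborel. p \<xi> * (LINT y|lborel. K \<xi> y * f y)) = (LINT \<xi>|lborel. S * (p \<xi> * fourier f \<xi>))"
    using S0 by (simp add: fourier_eq_character K_def S_def)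
  ultimately have "S * (LINT \<xi>|lborel. p \<xi> * fourier f \<xi>) = S * (LINT w|lborel. of_real (gauss w) * f (x + \<epsilon> * w))"
    by simp
  then show ?thesis using S0 by (simp add: p_def)
qed

text \<open>
  Both sides of \<open>regularized_inversion\<close> converge as \<open>\<epsilon>\<close> tends to zero, by dominated
  convergence: on the left the transform is integrable, on the right \<open>f\<close> is bounded and
  continuous.
\<close>
theorem fourier_inversion:
  assumes f: "schwartz f"
  shows "(LINT \<xi>|lborel. character \<xi> x * fourier f \<xi>) = of_real (sqrt (2 * pi)) * f x"
proof -
  define \<epsilon> where "\<epsilon> n = 1 / real (Suc n)" for n
  have \<epsilon>0: "\<epsilon> \<longlonglongrightarrow> 0" unfolding \<epsilon>_def using LIMSEQ_inverse_real_of_nat by (simp add: inverse_eq_divide)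
  have \<epsilon>p: "\<epsilon> n > 0" for n by (simp add: \<epsilon>_def)
  have [measurable]: "f \<in> borel_measurable borel" "fourier f \<in> borel_measurable borel"
    using schwartz_integrable[OF f] fourier_schwartz_integrable[OF f] by (auto dest: borel_measurable_integrable)
  have [measurable]: "(\<lambda>\<xi>. character \<xi> x) \<in> borel_measurable borel" unfolding character_def by measurable
  obtain A where A: "\<And>x. cmod (f x) \<le> A" using schwartz_decay[OF f, of 0] by auto
  have "(\<lambda>n. LINT \<xi>|lborel. of_real (gauss (\<epsilon> n * \<xi>)) * character \<xi> x * fourier f \<xi>)
      \<longlonglongrightarrow> (LINT \<xi>|lborel. character \<xi> x * fourier f \<xi>)"
  proof (rule integral_dominated_convergence[where w = "\<lambda>\<xi>. cmod (fourier f \<xi>)"])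
    show "integrable lborel (\<lambda>\<xi>. cmod (fourier f \<xi>))" using fourier_schwartz_integrable[OF f] by simp
    show "AE \<xi> in lborel. (\<lambda>n. of_real (gauss (\<epsilon> n * \<xi>)) * character \<xi> x * fourier f \<xi>) \<longlonglongrightarrow> character \<xi> x * fourier f \<xi>"
    proof (intro AE_I2)
      fix \<xi>
      have "(\<lambda>n. of_real (gauss (\<epsilon> n * \<xi>)) * character \<xi> x * fourier f \<xi>)
          \<longlonglongrightarrow> of_real (exp (- (0 * \<xi>)\<^sup>2 / 2)) * character \<xi> x * fourier f \<xi>"
        unfolding gauss_def by (intro tendsto_intros \<epsilon>0) auto
      then show "(\<lambda>n. of_real (gauss (\<epsilon> n * \<xi>)) * character \<xi> x * fourier f \<xi>) \<longlonglongrightarrow> character \<xi> x * fourier f \<xi>"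
        by simp
    qed
    show "AE \<xi> in lborel. norm (of_real (gauss (\<epsilon> n * \<xi>)) * character \<xi> x * fourier f \<xi>) \<le> cmod (fourier f \<xi>)" for n
      by (intro AE_I2) (auto simp: norm_mult gauss_def mult_left_le_one_le)
  qed measurable
  moreover have "(\<lambda>n. LINT w|lborel. of_real (gauss w) * f (x + \<epsilon> n * w)) \<longlonglongrightarrow> (LINT w|lborel. of_real (gauss w) * f x)"
  proof (rule integral_dominated_convergence[where w = "\<lambda>w. A * gauss w"])
    show "integrable lborel (\<lambda>w. A * gauss w)" using gauss_integrable by simp
    show "AE w in lborel. (\<lambda>n. of_real (gauss w) * f (x + \<epsilon> n * w)) \<longlonglongrightarrow> of_real (gauss w) * f x"
    proof (intro AE_I2)
      fix w
      have "(\<lambda>n. x + \<epsilon> n * w) \<longlonglongrightarrow> x + 0 * w" by (intro tendsto_intros \<epsilon>0)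
      moreover have "isCont f (x + 0 * w)"
        using schwartz_continuous[OF f, of UNIV] by (simp add: continuous_on_eq_continuous_at)
      ultimately have "(\<lambda>n. f (x + \<epsilon> n * w)) \<longlonglongrightarrow> f (x + 0 * w)"
        using isCont_tendsto_compose by blast
      then show "(\<lambda>n. of_real (gauss w) * f (x + \<epsilon> n * w)) \<longlonglongrightarrow> of_real (gauss w) * f x"
        by (intro tendsto_mult tendsto_const) simp
    qed
    show "AE w in lborel. norm (of_real (gauss w) * f (x + \<epsilon> n * w)) \<le> A * gauss w" for n
      by (intro AE_I2) (use A in \<open>auto simp: norm_mult gauss_def mult.commute\<close>)
  qed measurable
  ultimately have "(LINT \<xi>|lborel. character \<xi> x * fourier f \<xi>) = (LINT w|lborel. of_real (gauss w) * f x)"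
    unfolding regularized_inversion[OF schwartz_integrable[OF f] \<epsilon>p] using LIMSEQ_unique by blast
  then show ?thesis using gauss_integral by simp
qed

theorem plancherel:
  assumes f: "schwartz f"
  shows "(LINT x|lborel. (cmod (f x))\<^sup>2) = (LINT \<xi>|lborel. (cmod (fourier f \<xi>))\<^sup>2)"
proof -
  define S where "S = complex_of_real (sqrt (2 * pi))"
  have S0: "S \<noteq> 0" by (simp add: S_def)
  have ci: "integrable lborel (\<lambda>x. cnj (f x))" using schwartz_integrable[OF f] by simp
  have inner: "(LINT x|lborel. cnj (f x) * character \<xi> x) = S * cnj (fourier f \<xi>)" for \<xi>
  proof -
    have "cnj (LINT x|lborel. character (- \<xi>) x * f x) = (LINT x|lborel. cnj (f x) * character \<xi> x)"
    proof -
      have "cnj (LINT x|lborel. character (- \<xi>) x * f x) = (LINT x|lborel. cnj (character (- \<xi>) x * f x))"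
        using integral_bounded_linear[OF bounded_linear_cnj character_mult_integrable[OF schwartz_integrable[OF f]]]
          by simp
      then show ?thesis by (simp add: character_uminus mult.commute)
    qed
    then show ?thesis unfolding fourier_eq_character using S0 by (simp add: S_def)
  qed
  have "S * (LINT x|lborel. of_real ((cmod (f x))\<^sup>2)) = (LINT x|lborel. cnj (f x) * (S * f x))"
    by (simp add: complex_norm_square mult_ac del: of_real_power flip: integral_mult_right_zero)
  also have "\<dots> = (LINT x|lborel. cnj (f x) * (LINT \<xi>|lborel. character \<xi> x * fourier f \<xi>))"
    unfolding fourier_inversion[OF f] S_def ..
  also have "\<dots> = (LINT \<xi>|lborel. (LINT x|lborel. cnj (f x) * character \<xi> x) * fourier f \<xi>)"
    by (rule Fubini_bounded_kernel[OF ci fourier_schwartz_integrable[OF f], where C = 1])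
       (auto simp: character_def split_beta')
  also have "\<dots> = (LINT \<xi>|lborel. S * cnj (fourier f \<xi>) * fourier f \<xi>)"
    unfolding inner ..
  also have "\<dots> = S * (LINT \<xi>|lborel. of_real ((cmod (fourier f \<xi>))\<^sup>2))"
    by (simp add: complex_norm_square mult_ac del: of_real_power flip: integral_mult_right_zero)
  finally show ?thesis using S0 by (simp del: of_real_power)
qed

text \<open>
  The weight in the \<open>H\<^sup>s\<close> norm is at least one. Integrability of the weighted transform has to
  be checked because the integral in the norm would otherwise have the default value zero.
\<close>
theorem L2_le_Hs_norm:
  assumes f: "schwartz f" and s: "0 \<le> s" "s \<le> 1"
  shows "(LINT x|lborel. (cmod (f x))\<^sup>2) \<le> (Hs_norm s f)\<^sup>2"
proof -
  obtain C where C: "\<And>x. cmod (fourier f x) \<le> C * inverse (1 + x\<^sup>2)"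
    using fourier_schwartz_bound[OF assms(1)] by blast
  have [measurable]: "fourier f \<in> borel_measurable borel"
    by (rule fourier_measurable[OF schwartz_integrable[OF f]])
  have i: "integrable lborel (\<lambda>x. 4 * C\<^sup>2 * inverse (1 + x\<^sup>2))" using integrable_inverse_quadratic by simp
  have b: "(4 + \<xi>\<^sup>2) powr s * (cmod (fourier f \<xi>))\<^sup>2 \<le> 4 * C\<^sup>2 * inverse (1 + \<xi>\<^sup>2)" for \<xi>
  proof -
    have pos: "1 + \<xi>\<^sup>2 > 0" by (simp add: add_pos_nonneg)
    have "(4 + \<xi>\<^sup>2) powr s \<le> (4 + \<xi>\<^sup>2) powr 1" using s by (intro powr_mono) auto
    also have "\<dots> \<le> 4 * (1 + \<xi>\<^sup>2)" by simp
    finally have "(4 + \<xi>\<^sup>2) powr s * (cmod (fourier f \<xi>))\<^sup>2 \<le> 4 * (1 + \<xi>\<^sup>2) * (C * inverse (1 + \<xi>\<^sup>2))\<^sup>2"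
      using C[of \<xi>] pos by (intro mult_mono power_mono) auto
    also have "4 * w * (C * inverse w)\<^sup>2 = 4 * C\<^sup>2 * inverse w" if "w > 0" for w
      using that by (simp add: power2_eq_square field_simps)
    note this[OF pos]
    finally show ?thesis .
  qed
  have le: "(cmod (fourier f \<xi>))\<^sup>2 \<le> (4 + \<xi>\<^sup>2) powr s * (cmod (fourier f \<xi>))\<^sup>2" for \<xi>
  proof -
    have "1 \<le> (4 + \<xi>\<^sup>2) powr s" using s by (intro ge_one_powr_ge_zero) auto
    from mult_right_mono[OF this zero_le_power2] show ?thesis by simp
  qed
  have 1: "integrable lborel (\<lambda>\<xi>. (4 + \<xi>\<^sup>2) powr s * (cmod (fourier f \<xi>))\<^sup>2)"
  proof (rule Bochner_Integration.integrable_bound[OF i])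
    show "AE \<xi> in lborel. norm ((4 + \<xi>\<^sup>2) powr s * (cmod (fourier f \<xi>))\<^sup>2) \<le> norm (4 * C\<^sup>2 * inverse (1 + \<xi>\<^sup>2))"
      by (intro AE_I2) (use b in \<open>auto intro: order_trans[OF _ abs_ge_self]\<close>)
  qed measurable
  have 2: "integrable lborel (\<lambda>\<xi>. (cmod (fourier f \<xi>))\<^sup>2)"
    by (rule Bochner_Integration.integrable_bound[OF 1])
       (use le in \<open>auto intro!: AE_I2 intro: order_trans[OF _ abs_ge_self]\<close>)
  have "(LINT x|lborel. (cmod (f x))\<^sup>2) = (LINT \<xi>|lborel. (cmod (fourier f \<xi>))\<^sup>2)" by (rule plancherel[OF f])
  also have "\<dots> \<le> (LINT \<xi>|lborel. (4 + \<xi>\<^sup>2) powr s * (cmod (fourier f \<xi>))\<^sup>2)"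
    by (rule integral_mono[OF 2 1 le])
  also have "\<dots> = (Hs_norm s f)\<^sup>2"
    unfolding Hs_norm_def by (subst real_sqrt_pow2) (auto intro!: integral_nonneg_AE)
  finally show ?thesis .
qed

section \<open>Riccati solutions of a small potential\<close>

lemma has_vector_derivative_quotient:
  fixes f g :: "real \<Rightarrow> complex"
  assumes "(f has_vector_derivative f') (at x within S)" "(g has_vector_derivative g') (at x within S)" "g x \<noteq> 0"
  shows "((\<lambda>x. f x / g x) has_vector_derivative (f' * g x - f x * g') / (g x * g x)) (at x within S)"
proof -
  have "((\<lambda>x. f x / g x) has_derivative (\<lambda>h. (h *\<^sub>R f' * g x - f x * h *\<^sub>R g') / (g x * g x))) (at x within S)"
    using assms unfolding has_vector_derivative_def by (intro has_derivative_divide')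
  moreover have "(\<lambda>h. (h *\<^sub>R f' * g x - f x * h *\<^sub>R g') / (g x * g x)) = (\<lambda>h. h *\<^sub>R ((f' * g x - f x * g') / (g x * g x)))"
    by (auto simp: fun_eq_iff scaleR_conv_of_real algebra_simps diff_divide_distrib)
  ultimately show ?thesis unfolding has_vector_derivative_def by simp
qed

lemma has_vector_derivative_over_det:
  fixes a b :: "real \<Rightarrow> complex"
  assumes a: "(a has_vector_derivative u) (at x within S)" and b: "(b has_vector_derivative w) (at x within S)"
    and det: "1 - a x * b x \<noteq> 0"
  shows "((\<lambda>x. a x / (1 - a x * b x)) has_vector_derivative (u + (a x)\<^sup>2 * w) / (1 - a x * b x)\<^sup>2) (at x within S)" (is ?A)
    "((\<lambda>x. - b x / (1 - a x * b x)) has_vector_derivative - (w + (b x)\<^sup>2 * u) / (1 - a x * b x)\<^sup>2) (at x within S)" (is ?B)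
    "((\<lambda>x. 2 * a x * b x / (1 - a x * b x)) has_vector_derivative 2 * (u * b x + a x * w) / (1 - a x * b x)\<^sup>2) (at x within S)" (is ?C)
proof -
  have d: "((\<lambda>x. 1 - a x * b x) has_vector_derivative - (u * b x + a x * w)) (at x within S)"
    by (rule has_vector_derivative_eq_rhs, (rule a b derivative_eq_intros refl)+) simp
  have n: "((\<lambda>x. 2 * a x * b x) has_vector_derivative 2 * (u * b x + a x * w)) (at x within S)"
    by (rule has_vector_derivative_eq_rhs, (rule a b derivative_eq_intros refl)+) (simp add: algebra_simps)
  show ?A
    by (rule has_vector_derivative_eq_rhs, rule has_vector_derivative_quotient[OF a d det])
       (simp add: algebra_simps power2_eq_square)
  show ?B
    by (rule has_vector_derivative_eq_rhs, rule has_vector_derivative_quotient[OF has_vector_derivative_minus[OF b] d det])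
       (simp add: algebra_simps power2_eq_square)
  show ?C
    by (rule has_vector_derivative_eq_rhs, rule has_vector_derivative_quotient[OF n d det])
       (simp add: algebra_simps power2_eq_square)
qed

lemma small_potential_schwartz:
  assumes q: "schwartz q" and s: "0 < s" "s < 1 / 2" and H: "Hs_norm s q \<le> 1 / 2"
    and \<kappa>: "\<i> * \<kappa>\<^sup>2 = complex_of_real \<nu>"
  shows "small_potential \<nu> (\<lambda>x. \<kappa> * q x)" "small_potential \<nu> (\<lambda>x. \<kappa> * rfun q x)"
proof -
  have n\<kappa>: "(cmod \<kappa>)\<^sup>2 = \<bar>\<nu>\<bar>"
    using arg_cong[OF \<kappa>, of cmod] by (simp add: norm_mult norm_power)
  have cq: "continuous_on S q" for S by (rule schwartz_continuous[OF q])
  have "Hs_norm s q \<ge> 0" unfolding Hs_norm_def by (auto intro!: integral_nonneg_AE)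
  then have H2: "(Hs_norm s q)\<^sup>2 \<le> 1 / 4"
    using power_mono[OF H, of 2] by (simp add: power2_eq_square)
  have qi: "integrable lborel (\<lambda>x. (cmod (q x))\<^sup>2)"
    using schwartz_square_integrable[OF q] by (simp add: square_integrable_def)
  have loc: "integral {x..X} (\<lambda>s. (cmod (q s))\<^sup>2) \<le> 1 / 4" for x X
  proof -
    have i: "set_integrable lborel {x..X} (\<lambda>s. (cmod (q s))\<^sup>2)"
      unfolding set_integrable_def by (rule integrable_mult_indicator[OF _ qi]) simp
    have "integral {x..X} (\<lambda>s. (cmod (q s))\<^sup>2) = (LINT s:{x..X}|lborel. (cmod (q s))\<^sup>2)"
      using set_borel_integral_eq_integral(2)[OF i] by simp
    also have "\<dots> \<le> (LINT s|lborel. (cmod (q s))\<^sup>2)"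
      unfolding set_lebesgue_integral_def
      by (rule integral_mono[OF _ qi]) (use i in \<open>auto simp: set_integrable_def indicator_def\<close>)
    also have "\<dots> \<le> (Hs_norm s q)\<^sup>2" by (rule L2_le_Hs_norm[OF q]) (use s in auto)
    finally show ?thesis using H2 by simp
  qed
  have key: "small_potential \<nu> (\<lambda>x. \<kappa> * p x)"
    if p: "continuous_on UNIV p" "\<And>x. cmod (p x) = cmod (q x)" for p
    unfolding small_potential_def
  proof (intro conjI allI impI)
    show "continuous_on UNIV (\<lambda>x. \<kappa> * p x)" by (intro continuous_intros p)
    obtain B where B: "\<And>x. cmod (q x) \<le> B" using schwartz_decay[OF q, of 0] by auto
    show "bounded (range (\<lambda>x. \<kappa> * p x))"
      by (rule boundedI[of _ "cmod \<kappa> * B"]) (auto simp: norm_mult p intro!: mult_left_mono B)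
    fix x X :: real
    have "integral {x..X} (\<lambda>s. (cmod (\<kappa> * p s))\<^sup>2) = \<bar>\<nu>\<bar> * integral {x..X} (\<lambda>s. (cmod (q s))\<^sup>2)"
      by (simp add: norm_mult power_mult_distrib n\<kappa> p)
    also have "\<dots> \<le> \<bar>\<nu>\<bar> * (1 / 4)" by (intro mult_left_mono loc) auto
    finally show "integral {x..X} (\<lambda>s. (cmod (\<kappa> * p s))\<^sup>2) \<le> \<bar>\<nu>\<bar> / 4" by simp
  qed
  show "small_potential \<nu> (\<lambda>x. \<kappa> * q x)" by (rule key) (auto intro: cq)
  show "small_potential \<nu> (\<lambda>x. \<kappa> * rfun q x)"
    unfolding rfun_def by (rule key) (auto intro!: continuous_intros cq)
qed

lemma small_potential_uminus: "small_potential (- \<nu>) Q \<longleftrightarrow> small_potential \<nu> Q"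
  by (simp add: small_potential_def)

text \<open>
  The sign of \<open>\<nu>\<close> decides from which end of the line each of \<open>a\<close> and \<open>b\<close> is determined; in
  terms of the equations and the bounds both cases look the same.
\<close>
definition riccati_pair ::
  "complex \<Rightarrow> (real \<Rightarrow> complex) \<Rightarrow> (real \<Rightarrow> complex) \<Rightarrow> (real \<Rightarrow> complex) \<Rightarrow> bool" where
  "riccati_pair \<kappa> q a b \<longleftrightarrow>
     (\<forall>x. (a has_vector_derivative
            (2 * \<i> * \<kappa>\<^sup>2 * a x + \<kappa> * rfun q x - \<kappa> * q x * (a x)\<^sup>2)) (at x)) \<and>
     (\<forall>x. (b has_vector_derivative
            (- 2 * \<i> * \<kappa>\<^sup>2 * b x + \<kappa> * q x - \<kappa> * rfun q x * (b x)\<^sup>2)) (at x)) \<and>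
     (\<forall>x. cmod (a x) \<le> 1 / 2) \<and> (\<forall>x. cmod (b x) \<le> 1 / 2)"

lemma two_nu:
  assumes "\<i> * \<kappa>\<^sup>2 = complex_of_real \<nu>"
  shows "complex_of_real (2 * \<nu>) = 2 * \<i> * \<kappa>\<^sup>2" "complex_of_real (2 * - \<nu>) = - 2 * \<i> * \<kappa>\<^sup>2"
  using assms by (simp_all flip: assms add: mult.assoc)

lemma riccati_pair_exists:
  assumes q: "schwartz q" and s: "0 < s" "s < 1 / 2" and H: "Hs_norm s q \<le> 1 / 2"
    and \<kappa>: "\<i> * \<kappa>\<^sup>2 = complex_of_real \<nu>" and \<nu>: "\<nu> \<noteq> 0"
  shows "\<exists>a b. riccati_pair \<kappa> q a b"
proof -
  note sp = small_potential_schwartz[OF q s H \<kappa>]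
  have \<nu>': "- \<nu> \<noteq> 0" using \<nu> by simp
  show ?thesis
    using riccati_bounded_solution[OF \<nu> sp] riccati_bounded_solution[OF \<nu>' sp(2,1)[folded small_potential_uminus[of \<nu>]]]
    unfolding riccati_pair_def two_nu[OF \<kappa>] by (simp add: mult.assoc) blast
qed

lemma riccati_pair_det:
  assumes "riccati_pair \<kappa> q a b"
  shows "1 - a x * b x \<noteq> 0"
proof -
  have "cmod (a x * b x) \<le> 1 / 2 * (1 / 2)"
    unfolding norm_mult using assms by (intro mult_mono) (auto simp: riccati_pair_def)
  then show ?thesis by auto
qed

lemma green_riccati_pair:
  assumes q: "schwartz q" and \<kappa>: "\<i> * \<kappa>\<^sup>2 = complex_of_real \<nu>" and \<nu>: "\<nu> \<noteq> 0"
    and ab: "riccati_pair \<kappa> q a b"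
  shows "L_invertible \<kappa> q" "is_green_diff \<kappa> q (green_diff \<kappa> q)"
    "gam \<kappa> q x = 2 * a x * b x / (1 - a x * b x)"
    "g12 \<kappa> q x = - b x / (1 - a x * b x)"
    "g21 \<kappa> q x = a x / (1 - a x * b x)"
    "2 + gam \<kappa> q x = 2 / (1 - a x * b x)"
    "gam \<kappa> q x + 1 = (1 + a x * b x) / (1 - a x * b x)"
    "rho \<kappa> q x = - (\<kappa> / 2) * (q x * a x - rfun q x * b x)" (is ?rho)
    "j_DNLS \<kappa> q x = \<i> * \<kappa> / 2 * (dx q x * a x + dx (rfun q) x * b x) - \<i> * \<kappa>\<^sup>2 * (q x * rfun q x)
        + (2 * \<kappa>\<^sup>2 + q x * rfun q x) * (\<kappa> / 2 * (q x * a x - rfun q x * b x))" (is ?j)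
proof -
  note G = green_diff_riccati[OF \<kappa> \<nu> schwartz_continuous[OF q] schwartz_bounded[OF q] schwartz_integrable[OF q], of a b]
  have a: "(a has_vector_derivative
               (complex_of_real (2 * \<nu>) * a x + \<kappa> * rfun q x - \<kappa> * q x * (a x)\<^sup>2)) (at x)" for x
    using ab unfolding two_nu[OF \<kappa>] riccati_pair_def by blast
  have b: "(b has_vector_derivative
               (complex_of_real (2 * - \<nu>) * b x + \<kappa> * q x - \<kappa> * rfun q x * (b x)\<^sup>2)) (at x)" for x
    using ab unfolding two_nu[OF \<kappa>] riccati_pair_def by blast
  have bd: "cmod (a x) \<le> 1 / 2" "cmod (b x) \<le> 1 / 2" for x using ab by (auto simp: riccati_pair_def)
  note G = G[OF a b bd]
  show "L_invertible \<kappa> q" "is_green_diff \<kappa> q (green_diff \<kappa> q)" by (rule G)+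
  show g: "gam \<kappa> q x = 2 * a x * b x / (1 - a x * b x)" by (rule G)
  show g12: "g12 \<kappa> q x = - b x / (1 - a x * b x)" by (rule G)
  show g21: "g21 \<kappa> q x = a x / (1 - a x * b x)" by (rule G)
  have d: "1 - a x * b x \<noteq> 0" by (rule riccati_pair_det[OF ab])
  show g2: "2 + gam \<kappa> q x = 2 / (1 - a x * b x)"
    and "gam \<kappa> q x + 1 = (1 + a x * b x) / (1 - a x * b x)"
    unfolding g using d by (simp_all add: add_divide_eq_iff divide_add_eq_iff)
  have quot: "u / (1 - a x * b x) / (2 / (1 - a x * b x)) = u / 2" for u using d by simp
  have eq1: "(q x * g21 \<kappa> q x + rfun q x * g12 \<kappa> q x) / (2 + gam \<kappa> q x) = (q x * a x - rfun q x * b x) / 2"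
    unfolding g2 g12 g21 quot[symmetric] by (simp add: diff_divide_distrib)
  show rho: ?rho unfolding rho_def eq1 by simp
  have eq2: "(dx q x * g21 \<kappa> q x - dx (rfun q) x * g12 \<kappa> q x) / (2 + gam \<kappa> q x) = (dx q x * a x + dx (rfun q) x * b x) / 2"
    unfolding g2 g12 g21 quot[symmetric] by (simp add: add_divide_distrib)
  show ?j
    unfolding j_DNLS_def rho eq2 by (simp add: algebra_simps add_divide_distrib diff_divide_distrib)
qed

section \<open>The zero-curvature identity\<close>

text \<open>
  If \<open>u\<close> evolves by the time part \<open>A\<close> of the Lax pair, then \<open>a = u\<^sub>2/u\<^sub>1\<close> has time derivative
  \<open>v\<close>. That \<open>v\<close> solves the linearised Riccati equation is the compatibility of the two parts
  of the pair, a polynomial identity. The square root \<open>j\<close> of \<open>-1\<close> is left open: \<open>j = i\<close> gives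
  the statement for \<open>a\<close>, and exchanging \<open>q\<close> with \<open>r\<close> and taking \<open>j = -i\<close> gives the one for
  \<open>b\<close>.
\<close>
lemma lax_riccati_compatibility:
  fixes j \<kappa> :: complex
  assumes j: "j * j = - 1"
    and q: "(q has_vector_derivative q1 x) (at x)" "(q1 has_vector_derivative q2) (at x)"
    and r: "(r has_vector_derivative r1 x) (at x)" "(r1 has_vector_derivative r2) (at x)"
    and a: "(a has_vector_derivative (2 * j * \<kappa>\<^sup>2 * a x + \<kappa> * r x - \<kappa> * q x * (a x)\<^sup>2)) (at x)"
  defines "v \<equiv> \<lambda>x. (2 * \<kappa> ^ 3 * r x - j * \<kappa> * r1 x + \<kappa> * q x * (r x)\<^sup>2)
      + 2 * (2 * j * \<kappa> ^ 4 + j * \<kappa>\<^sup>2 * q x * r x) * a x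
      - (2 * \<kappa> ^ 3 * q x + j * \<kappa> * q1 x + \<kappa> * (q x)\<^sup>2 * r x) * (a x)\<^sup>2"
  shows "(v has_vector_derivative ((2 * j * \<kappa>\<^sup>2 - 2 * (\<kappa> * q x) * a x) * v x
      + \<kappa> * (- j * r2 + (q1 x * (r x)\<^sup>2 + 2 * q x * r x * r1 x))
      - \<kappa> * (j * q2 + (2 * q x * q1 x * r x + (q x)\<^sup>2 * r1 x)) * (a x)\<^sup>2)) (at x)"
proof -
  define a' where "a' = 2 * j * \<kappa>\<^sup>2 * a x + \<kappa> * r x - \<kappa> * q x * (a x)\<^sup>2"
  have a2: "(a has_vector_derivative a') (at x)" using a by (simp add: a'_def)
  define d where "d = (2 * \<kappa> ^ 3 * r1 x - j * \<kappa> * r2 + \<kappa> * (q1 x * (r x)\<^sup>2 + 2 * q x * r x * r1 x))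
      + 2 * (2 * j * \<kappa> ^ 4 + j * \<kappa>\<^sup>2 * q x * r x) * a' + 2 * j * \<kappa>\<^sup>2 * (q1 x * r x + q x * r1 x) * a x
      - (2 * \<kappa> ^ 3 * q x + j * \<kappa> * q1 x + \<kappa> * (q x)\<^sup>2 * r x) * (2 * a x * a')
      - (2 * \<kappa> ^ 3 * q1 x + j * \<kappa> * q2 + \<kappa> * (2 * q x * q1 x * r x + (q x)\<^sup>2 * r1 x)) * (a x)\<^sup>2"
  have "(v has_vector_derivative d) (at x)"
    unfolding v_def power2_eq_square
    by (rule has_vector_derivative_eq_rhs, (rule q r a2 derivative_eq_intros refl)+)
       (simp add: d_def algebra_simps power2_eq_square)
  moreover have "d = (2 * j * \<kappa>\<^sup>2 - 2 * (\<kappa> * q x) * a x) * v x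
      + \<kappa> * (- j * r2 + (q1 x * (r x)\<^sup>2 + 2 * q x * r x * r1 x))
      - \<kappa> * (j * q2 + (2 * q x * q1 x * r x + (q x)\<^sup>2 * r1 x)) * (a x)\<^sup>2"
    using j unfolding d_def a'_def v_def by algebra
  ultimately show ?thesis by simp
qed

text \<open>
  The sum of the time derivative of \<open>\<rho>\<close> and the space derivative of the flux, after all
  derivatives have been replaced by the right-hand sides of the equations; its shape is the
  one that the product rule produces.
\<close>
lemma conservation_identity:
  fixes j \<kappa> A B q0 q1 q2 r0 r1 r2 :: complex
  assumes j: "j * j = - 1"
  defines "A12 \<equiv> 2 * \<kappa> ^ 3 * q0 + j * \<kappa> * q1 + \<kappa> * q0\<^sup>2 * r0"
    and "A21 \<equiv> 2 * \<kappa> ^ 3 * r0 - j * \<kappa> * r1 + \<kappa> * q0 * r0\<^sup>2"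
    and "A22 \<equiv> 2 * j * \<kappa> ^ 4 + j * \<kappa>\<^sup>2 * q0 * r0"
  defines "At \<equiv> A21 + 2 * A22 * A - A12 * A\<^sup>2" and "Bt \<equiv> A12 - 2 * A22 * B - A21 * B\<^sup>2"
    and "qt \<equiv> j * q2 + (2 * q0 * q1 * r0 + q0\<^sup>2 * r1)" and "rt \<equiv> - j * r2 + (q1 * r0\<^sup>2 + 2 * q0 * r0 * r1)"
    and "Ax \<equiv> 2 * j * \<kappa>\<^sup>2 * A + \<kappa> * r0 - \<kappa> * q0 * A\<^sup>2" and "Bx \<equiv> - 2 * j * \<kappa>\<^sup>2 * B + \<kappa> * q0 - \<kappa> * r0 * B\<^sup>2"
  shows "- (\<kappa> / 2) * (q0 * At + qt * A - (r0 * Bt + rt * B))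
    + (j * \<kappa> / 2 * (q1 * Ax + q2 * A + (r1 * Bx + r2 * B)) - j * \<kappa>\<^sup>2 * (q0 * r1 + q1 * r0)
       + ((2 * \<kappa>\<^sup>2 + q0 * r0) * (\<kappa> / 2 * (q0 * Ax + q1 * A - (r0 * Bx + r1 * B)))
          + (0 + (q0 * r1 + q1 * r0)) * (\<kappa> / 2 * (q0 * A - r0 * B)))) = 0" (is "?lhs = 0")
proof -
  have "2 * ?lhs = - \<kappa> * (q0 * At + qt * A - (r0 * Bt + rt * B))
    + j * \<kappa> * (q1 * Ax + q2 * A + (r1 * Bx + r2 * B)) - 2 * j * \<kappa>\<^sup>2 * (q0 * r1 + q1 * r0)
       + ((2 * \<kappa>\<^sup>2 + q0 * r0) * (\<kappa> * (q0 * Ax + q1 * A - (r0 * Bx + r1 * B)))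
          + (q0 * r1 + q1 * r0) * (\<kappa> * (q0 * A - r0 * B)))"
    by (simp add: distrib_left right_diff_distrib)
  also have "\<dots> = 0"
    unfolding At_def Bt_def qt_def rt_def Ax_def Bx_def A12_def A21_def A22_def using j by algebra
  finally show ?thesis unfolding mult_eq_0_iff by simp
qed

lemma dx_eqI: "(f has_vector_derivative d) (at x) \<Longrightarrow> dx f x = d"
  unfolding dx_def by (rule vector_derivative_at)

lemma has_vector_derivative_rfun:
  assumes "(q has_vector_derivative d) (at x within S)"
  shows "(rfun q has_vector_derivative - cnj d) (at x within S)"
  unfolding rfun_def
  by (intro has_vector_derivative_minus bounded_linear.has_vector_derivative[OF bounded_linear_cnj] assms)

lemma schwartz_rfun_derivatives:
  assumes q: "schwartz q"
  shows "(rfun q has_vector_derivative dx (rfun q) x) (at x)"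
    "(dx (rfun q) has_vector_derivative dx (dx (rfun q)) x) (at x)"
    "dx (rfun q) x = - cnj (dx q x)" "dx (dx (rfun q)) x = - cnj (dx (dx q) x)"
proof -
  have e: "dx (rfun q) = rfun (dx q)"
    by (auto simp: fun_eq_iff rfun_def[of "dx q"] intro!: dx_eqI has_vector_derivative_rfun schwartz_has_vector_derivative q)
  have e2: "dx (rfun (dx q)) = rfun (dx (dx q))"
    by (auto simp: fun_eq_iff rfun_def[of "dx (dx q)"] intro!: dx_eqI has_vector_derivative_rfun schwartz_has_vector_derivative schwartz_dx q)
  show "(rfun q has_vector_derivative dx (rfun q) x) (at x)"
    unfolding e using has_vector_derivative_rfun[OF schwartz_has_vector_derivative[OF q]] by (simp add: rfun_def[of "dx q"])
  show "(dx (rfun q) has_vector_derivative dx (dx (rfun q)) x) (at x)"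
    unfolding e e2 using has_vector_derivative_rfun[OF schwartz_has_vector_derivative[OF schwartz_dx[OF q]]]
    by (simp add: rfun_def[of "dx (dx q)"])
  show "dx (rfun q) x = - cnj (dx q x)" by (simp add: e rfun_def)
  show "dx (dx (rfun q)) x = - cnj (dx (dx q) x)" by (simp add: e e2 rfun_def)
qed

lemma dx_cubic:
  assumes q: "schwartz q"
  shows "dx (\<lambda>y. (q y)\<^sup>2 * rfun q y) x = 2 * q x * dx q x * rfun q x + (q x)\<^sup>2 * dx (rfun q) x"
    "dx (\<lambda>y. q y * (rfun q y)\<^sup>2) x = dx q x * (rfun q x)\<^sup>2 + 2 * q x * rfun q x * dx (rfun q) x"
    "dx (\<lambda>y. of_real ((cmod (q y))\<^sup>2) * q y) x = - (2 * q x * dx q x * rfun q x + (q x)\<^sup>2 * dx (rfun q) x)"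
proof -
  note d = schwartz_has_vector_derivative[OF q] schwartz_rfun_derivatives(1)[OF q]
  have 1: "((\<lambda>y. (q y)\<^sup>2 * rfun q y) has_vector_derivative (2 * q x * dx q x * rfun q x + (q x)\<^sup>2 * dx (rfun q) x)) (at x)"
    unfolding power2_eq_square
    by (rule has_vector_derivative_eq_rhs, (rule d derivative_eq_intros refl)+) (simp add: algebra_simps)
  then show "dx (\<lambda>y. (q y)\<^sup>2 * rfun q y) x = 2 * q x * dx q x * rfun q x + (q x)\<^sup>2 * dx (rfun q) x"
    by (rule dx_eqI)
  show "dx (\<lambda>y. q y * (rfun q y)\<^sup>2) x = dx q x * (rfun q x)\<^sup>2 + 2 * q x * rfun q x * dx (rfun q) x"
    unfolding power2_eq_square
    by (rule dx_eqI, rule has_vector_derivative_eq_rhs, (rule d derivative_eq_intros refl)+) (simp add: algebra_simps)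
  have "(\<lambda>y. of_real ((cmod (q y))\<^sup>2) * q y) = (\<lambda>y. - ((q y)\<^sup>2 * rfun q y))"
    unfolding complex_norm_square rfun_def by (simp add: fun_eq_iff power2_eq_square)
  then show "dx (\<lambda>y. of_real ((cmod (q y))\<^sup>2) * q y) x = - (2 * q x * dx q x * rfun q x + (q x)\<^sup>2 * dx (rfun q) x)"
    using has_vector_derivative_minus[OF 1] by (auto intro: dx_eqI)
qed

section \<open>Evolution of the Riccati solutions and of the Green's function\<close>

definition dnls_q_rhs :: "(real \<Rightarrow> complex) \<Rightarrow> real \<Rightarrow> complex" where
  "dnls_q_rhs q x = \<i> * dx (dx q) x + (2 * q x * dx q x * rfun q x + (q x)\<^sup>2 * dx (rfun q) x)"

definition dnls_r_rhs :: "(real \<Rightarrow> complex) \<Rightarrow> real \<Rightarrow> complex" where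
  "dnls_r_rhs q x = - \<i> * dx (dx (rfun q)) x + (dx q x * (rfun q x)\<^sup>2 + 2 * q x * rfun q x * dx (rfun q) x)"

lemma dnls_r_rhs_eq: "schwartz q \<Longrightarrow> dnls_r_rhs q x = - cnj (dnls_q_rhs q x)"
  unfolding dnls_r_rhs_def dnls_q_rhs_def
  by (simp add: schwartz_rfun_derivatives(3,4)) (simp add: rfun_def algebra_simps power2_eq_square)

lemma DNLS_time_derivative:
  assumes q: "schwartz (q t)" and D: "DNLS_on I q" and t: "t \<in> I"
  shows "((\<lambda>\<tau>. q \<tau> x) has_vector_derivative dnls_q_rhs (q t) x) (at t within I)"
    "((\<lambda>\<tau>. rfun (q \<tau>) x) has_vector_derivative dnls_r_rhs (q t) x) (at t within I)"
proof -
  obtain qt where qt: "((\<lambda>\<tau>. q \<tau> x) has_vector_derivative qt) (at t within I)"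
    and eq: "\<i> * qt + dx (dx (q t)) x + \<i> * dx (\<lambda>y. of_real ((cmod (q t y))\<^sup>2) * q t y) x = 0"
    using D t unfolding DNLS_on_def by blast
  have "qt = dnls_q_rhs (q t) x"
  proof -
    have "\<i> * (qt - dnls_q_rhs (q t) x) = \<i> * qt + dx (dx (q t)) x + \<i> * dx (\<lambda>y. of_real ((cmod (q t y))\<^sup>2) * q t y) x"
      unfolding dx_cubic(3)[OF q] dnls_q_rhs_def by (simp add: algebra_simps)
    then have "\<i> * (qt - dnls_q_rhs (q t) x) = 0" using eq by simp
    then show ?thesis by simp
  qed
  then show 1: "((\<lambda>\<tau>. q \<tau> x) has_vector_derivative dnls_q_rhs (q t) x) (at t within I)" using qt by simp
  show "((\<lambda>\<tau>. rfun (q \<tau>) x) has_vector_derivative dnls_r_rhs (q t) x) (at t within I)"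
    unfolding dnls_r_rhs_eq[OF q] using has_vector_derivative_rfun[OF 1] by (simp add: rfun_def[abs_def])
qed

lemma schwartz_seminorm_bound:
  assumes "schwartz f" "schwartz g" "schwartz h"
  shows "cmod ((f x - g x) / of_real d - h x) \<le> schwartz_seminorm 0 0 (\<lambda>x. (f x - g x) /\<^sub>R d - h x)"
proof -
  obtain A B C where A: "\<And>x. cmod (f x) \<le> A" and B: "\<And>x. cmod (g x) \<le> B" and C: "\<And>x. cmod (h x) \<le> C"
    using schwartz_decay[OF assms(1), of 0] schwartz_decay[OF assms(2), of 0] schwartz_decay[OF assms(3), of 0] by auto
  have e: "(f x - g x) /\<^sub>R d - h x = (f x - g x) / of_real d - h x" for x
    by (simp add: scaleR_conv_of_real divide_inverse mult.commute)
  have "cmod ((f x - g x) / of_real d - h x) \<le> (A + B) / \<bar>d\<bar> + C" for x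
  proof -
    have "cmod (f x - g x) \<le> A + B" using norm_triangle_ineq4[of "f x" "g x"] A[of x] B[of x] by simp
    then have "cmod ((f x - g x) / of_real d) \<le> (A + B) / \<bar>d\<bar>" by (simp add: norm_divide divide_right_mono)
    then show ?thesis using norm_triangle_ineq4[of "(f x - g x) / of_real d" "h x"] C[of x] by simp
  qed
  then have "bdd_above (range (\<lambda>x. cmod ((f x - g x) / of_real d - h x)))"
    unfolding bdd_above_def by blast
  from cSUP_upper[OF UNIV_I this] show ?thesis
    unfolding schwartz_seminorm_def e by simp
qed

text \<open>
  The lowest Schwartz seminorm gives uniform convergence of the difference quotients. The
  derivative in the sense of \<open>C\<^sup>1(I; S)\<close> is the right-hand side of the equation because
  pointwise derivatives are unique, provided that \<open>t\<close> is a limit point of \<open>I\<close>.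
\<close>
lemma C1_schwartz_uniform_quotient:
  assumes C: "C1_schwartz I q" and D: "DNLS_on I q" and t: "t \<in> I" and nontriv: "at t within I \<noteq> bot"
  shows "\<exists>\<eta>. (\<eta> \<longlongrightarrow> 0) (at t within I) \<and>
      (\<forall>\<tau>\<in>I. \<tau> \<noteq> t \<longrightarrow> (\<forall>x. cmod ((q \<tau> x - q t x) / of_real (\<tau> - t) - dnls_q_rhs (q t) x) \<le> \<eta> \<tau>))"
    "schwartz (dnls_q_rhs (q t))"
proof -
  obtain p where S: "\<And>t. t \<in> I \<Longrightarrow> schwartz (q t)" and p: "\<And>t. t \<in> I \<Longrightarrow> schwartz (p t)"
    and lim: "((\<lambda>\<tau>. schwartz_seminorm 0 0 (\<lambda>x. (q \<tau> x - q t x) /\<^sub>R (\<tau> - t) - p t x)) \<longlongrightarrow> 0) (at t within I)"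
    using C t unfolding C1_schwartz_def by blast
  define \<eta> where "\<eta> \<tau> = schwartz_seminorm 0 0 (\<lambda>x. (q \<tau> x - q t x) /\<^sub>R (\<tau> - t) - p t x)" for \<tau>
  have b: "cmod ((q \<tau> x - q t x) / of_real (\<tau> - t) - p t x) \<le> \<eta> \<tau>" if "\<tau> \<in> I" for \<tau> x
    unfolding \<eta>_def by (rule schwartz_seminorm_bound[OF S[OF that] S[OF t] p[OF t]])
  have \<eta>: "(\<eta> \<longlongrightarrow> 0) (at t within I)" using lim by (simp add: \<eta>_def[abs_def])
  have "p t x = dnls_q_rhs (q t) x" for x
  proof -
    have "((\<lambda>\<tau>. q \<tau> x) has_vector_derivative p t x) (at t within I)"
      by (rule has_vector_derivative_within_if_quotient_bound[OF \<eta> b])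
    from vector_derivative_unique_within[OF nontriv this DNLS_time_derivative(1)[OF S[OF t] D t]]
    show ?thesis .
  qed
  then have e: "p t = dnls_q_rhs (q t)" by (simp add: fun_eq_iff)
  show "\<exists>\<eta>. (\<eta> \<longlongrightarrow> 0) (at t within I) \<and>
      (\<forall>\<tau>\<in>I. \<tau> \<noteq> t \<longrightarrow> (\<forall>x. cmod ((q \<tau> x - q t x) / of_real (\<tau> - t) - dnls_q_rhs (q t) x) \<le> \<eta> \<tau>))"
    using \<eta> b unfolding e by blast
  show "schwartz (dnls_q_rhs (q t))" using p[OF t] by (simp add: e)
qed

text \<open>
  The entries \<open>A\<^sub>1\<^sub>2\<close>, \<open>A\<^sub>2\<^sub>1\<close> and \<open>A\<^sub>2\<^sub>2 = - A\<^sub>1\<^sub>1\<close> of the time part of the Lax pair.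
\<close>
definition lax12 :: "complex \<Rightarrow> (real \<Rightarrow> complex) \<Rightarrow> real \<Rightarrow> complex" where
  "lax12 \<kappa> q x = 2 * \<kappa> ^ 3 * q x + \<i> * \<kappa> * dx q x + \<kappa> * (q x)\<^sup>2 * rfun q x"

definition lax21 :: "complex \<Rightarrow> (real \<Rightarrow> complex) \<Rightarrow> real \<Rightarrow> complex" where
  "lax21 \<kappa> q x = 2 * \<kappa> ^ 3 * rfun q x - \<i> * \<kappa> * dx (rfun q) x + \<kappa> * q x * (rfun q x)\<^sup>2"

definition lax22 :: "complex \<Rightarrow> (real \<Rightarrow> complex) \<Rightarrow> real \<Rightarrow> complex" where
  "lax22 \<kappa> q x = 2 * \<i> * \<kappa> ^ 4 + \<i> * \<kappa>\<^sup>2 * q x * rfun q x"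

text \<open>
  The Riccati solutions are chosen separately at each time; their differentiability in time
  is a consequence of their being bounded.
\<close>
locale small_DNLS_flow =
  fixes \<kappa> :: complex and \<nu> s :: real and I :: "real set" and q a b :: "real \<Rightarrow> real \<Rightarrow> complex"
  assumes \<kappa>: "\<i> * \<kappa>\<^sup>2 = complex_of_real \<nu>" and \<nu>: "\<nu> \<noteq> 0"
    and C1: "C1_schwartz I q" and DNLS: "DNLS_on I q"
    and s: "0 < s" "s < 1 / 2" and small: "\<And>t. t \<in> I \<Longrightarrow> Hs_norm s (q t) \<le> 1 / 2"
    and riccati: "\<And>t. t \<in> I \<Longrightarrow> riccati_pair \<kappa> (q t) (a t) (b t)"
begin

lemma schwartz_q: "t \<in> I \<Longrightarrow> schwartz (q t)"
  using C1 by (auto simp: C1_schwartz_def)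

lemmas green = green_riccati_pair[OF schwartz_q \<kappa> \<nu> riccati]

lemmas det = riccati_pair_det[OF riccati]

lemma green_diff_unique: "t \<in> I \<Longrightarrow> \<exists>!D. is_green_diff \<kappa> (q t) D"
  using green(2) is_green_diff_unique by blast

lemma two_plus_gam_nonzero: "t \<in> I \<Longrightarrow> 2 + gam \<kappa> (q t) x \<noteq> 0"
  using green(6) det by simp

lemma dnls_system:
  assumes t: "t \<in> I"
  shows "((\<lambda>\<tau>. q \<tau> x) has_vector_derivative
      (\<i> * dx (dx (q t)) x + dx (\<lambda>y. (q t y)\<^sup>2 * rfun (q t) y) x)) (at t within I)"
    "((\<lambda>\<tau>. rfun (q \<tau>) x) has_vector_derivative
      (- \<i> * dx (dx (rfun (q t))) x + dx (\<lambda>y. q t y * (rfun (q t) y)\<^sup>2) x)) (at t within I)"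
  using DNLS_time_derivative[OF schwartz_q[OF t] DNLS t] unfolding dnls_q_rhs_def dnls_r_rhs_def dx_cubic[OF schwartz_q[OF t]] .

text \<open>
  If \<open>t\<close> is isolated in \<open>I\<close>, every derivative within \<open>I\<close> is vacuous; otherwise the hypotheses
  of \<open>riccati_time_derivative\<close> are the uniform convergence of the difference quotients of \<open>q\<close>
  and \<open>r\<close> and the zero-curvature identity. For \<open>b\<close> the roles of \<open>q\<close> and \<open>r\<close> and the sign of
  \<open>\<nu>\<close> are exchanged.
\<close>
lemma riccati_time:
  assumes t: "t \<in> I"
  shows "((\<lambda>\<tau>. a \<tau> x) has_vector_derivative
      (lax21 \<kappa> (q t) x + 2 * lax22 \<kappa> (q t) x * a t x - lax12 \<kappa> (q t) x * (a t x)\<^sup>2)) (at t within I)" (is ?A)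
    "((\<lambda>\<tau>. b \<tau> x) has_vector_derivative
      (lax12 \<kappa> (q t) x - 2 * lax22 \<kappa> (q t) x * b t x - lax21 \<kappa> (q t) x * (b t x)\<^sup>2)) (at t within I)" (is ?B)
proof -
  define va where "va x = lax21 \<kappa> (q t) x + 2 * lax22 \<kappa> (q t) x * a t x - lax12 \<kappa> (q t) x * (a t x)\<^sup>2" for x
  define vb where "vb x = lax12 \<kappa> (q t) x - 2 * lax22 \<kappa> (q t) x * b t x - lax21 \<kappa> (q t) x * (b t x)\<^sup>2" for x
  have both: "((\<lambda>\<tau>. a \<tau> x) has_vector_derivative va x) (at t within I) \<and>
    ((\<lambda>\<tau>. b \<tau> x) has_vector_derivative vb x) (at t within I)"
  proof (cases "at t within I = bot")
    case True
    then show ?thesis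
      by (simp add: has_vector_derivative_def has_derivative_def bounded_linear_scaleR_left)
  next
    case False
    obtain \<eta> where \<eta>: "(\<eta> \<longlongrightarrow> 0) (at t within I)"
      and q\<eta>: "\<And>\<tau> x. \<tau> \<in> I \<Longrightarrow> \<tau> \<noteq> t \<Longrightarrow> cmod ((q \<tau> x - q t x) / of_real (\<tau> - t) - dnls_q_rhs (q t) x) \<le> \<eta> \<tau>"
      using C1_schwartz_uniform_quotient(1)[OF C1 DNLS t False] by blast
    note Sd = C1_schwartz_uniform_quotient(2)[OF C1 DNLS t False]
    obtain P where P: "\<And>x. cmod (dnls_q_rhs (q t) x) \<le> P" using schwartz_decay[OF Sd, of 0] by auto
    have rP: "cmod (dnls_r_rhs (q t) x) \<le> P" for x using P[of x] by (simp add: dnls_r_rhs_eq[OF schwartz_q[OF t]])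
    have r\<eta>: "cmod ((rfun (q \<tau>) x - rfun (q t) x) / of_real (\<tau> - t) - dnls_r_rhs (q t) x) \<le> \<eta> \<tau>"
      if "\<tau> \<in> I" "\<tau> \<noteq> t" for \<tau> x
    proof -
      have "(rfun (q \<tau>) x - rfun (q t) x) / of_real (\<tau> - t) - dnls_r_rhs (q t) x
          = - cnj ((q \<tau> x - q t x) / of_real (\<tau> - t) - dnls_q_rhs (q t) x)"
        by (simp add: dnls_r_rhs_eq[OF schwartz_q[OF t]] rfun_def diff_divide_distrib)
      then show ?thesis using q\<eta>[OF that, of x] by (simp del: complex_cnj_diff complex_cnj_divide)
    qed
    have \<kappa>\<eta>: "((\<lambda>\<tau>. cmod \<kappa> * \<eta> \<tau>) \<longlongrightarrow> 0) (at t within I)"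
      using tendsto_mult[OF tendsto_const \<eta>, of "cmod \<kappa>"] by simp
    have sc: "cmod ((\<kappa> * u - \<kappa> * w) / d - \<kappa> * z) \<le> cmod \<kappa> * e" if "cmod ((u - w) / d - z) \<le> e" for u w d z e
    proof -
      have "(\<kappa> * u - \<kappa> * w) / d - \<kappa> * z = \<kappa> * ((u - w) / d - z)" by (simp add: algebra_simps diff_divide_distrib)
      then show ?thesis using that by (simp add: norm_mult mult_left_mono)
    qed
    have cd: "continuous_on UNIV (dnls_q_rhs (q t))" by (rule schwartz_continuous[OF Sd])
    have "dnls_r_rhs (q t) = (\<lambda>x. - cnj (dnls_q_rhs (q t) x))" by (simp add: fun_eq_iff dnls_r_rhs_eq[OF schwartz_q[OF t]])
    then have crd: "continuous_on UNIV (dnls_r_rhs (q t))" by (auto intro!: continuous_intros cd)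
    have sp: "small_potential \<nu> (\<lambda>x. \<kappa> * q \<tau> x)" "small_potential \<nu> (\<lambda>x. \<kappa> * rfun (q \<tau>) x)" if "\<tau> \<in> I" for \<tau>
      using small_potential_schwartz[OF schwartz_q[OF that] s small[OF that] \<kappa>] .
    have oa: "(a \<tau> has_vector_derivative (2 * \<i> * \<kappa>\<^sup>2 * a \<tau> x + \<kappa> * rfun (q \<tau>) x - \<kappa> * q \<tau> x * (a \<tau> x)\<^sup>2)) (at x)"
      and ob: "(b \<tau> has_vector_derivative (- 2 * \<i> * \<kappa>\<^sup>2 * b \<tau> x + \<kappa> * q \<tau> x - \<kappa> * rfun (q \<tau>) x * (b \<tau> x)\<^sup>2)) (at x)"
      and bd: "cmod (a \<tau> x) \<le> 1 / 2" "cmod (b \<tau> x) \<le> 1 / 2" if "\<tau> \<in> I" for \<tau> x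
      using riccati[OF that] by (auto simp: riccati_pair_def)
    have bc: "bounded (range (\<lambda>x. c))" for c :: complex by (auto intro!: boundedI[of _ "cmod c"])
    have brf: "bounded (range (rfun f))" if "schwartz f" for f
      using schwartz_bounded[OF that] by (auto simp: bounded_iff rfun_def)
    have bdr: "bounded (range (dx (rfun (q t))))"
      using schwartz_bounded[OF schwartz_dx[OF schwartz_q[OF t]]]
      by (auto simp: bounded_iff schwartz_rfun_derivatives(3)[OF schwartz_q[OF t]])
    have bab: "bounded (range (a t))" "bounded (range (b t))"
      using bd[OF t] by (auto intro!: boundedI[of _ "1 / 2"])
    note bintros = bounded_range_mult bounded_plus_comp bounded_minus_comp bc bab
      schwartz_bounded[OF schwartz_q[OF t]] schwartz_bounded[OF schwartz_dx[OF schwartz_q[OF t]]] brf[OF schwartz_q[OF t]] bdr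
    have \<kappa>q: "cmod ((\<kappa> * q \<tau> x - \<kappa> * q t x) / of_real (\<tau> - t) - \<kappa> * dnls_q_rhs (q t) x) \<le> cmod \<kappa> * \<eta> \<tau>"
      and \<kappa>r: "cmod ((\<kappa> * rfun (q \<tau>) x - \<kappa> * rfun (q t) x) / of_real (\<tau> - t) - \<kappa> * dnls_r_rhs (q t) x) \<le> cmod \<kappa> * \<eta> \<tau>"
      if "\<tau> \<in> I" "\<tau> \<noteq> t" for \<tau> x
      using sc[OF q\<eta>[OF that]] sc[OF r\<eta>[OF that]] .
    have \<kappa>P: "cmod (\<kappa> * dnls_q_rhs (q t) x) \<le> cmod \<kappa> * P" "cmod (\<kappa> * dnls_r_rhs (q t) x) \<le> cmod \<kappa> * P" for x
      unfolding norm_mult by (intro mult_left_mono P rP norm_ge_zero)+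
    have \<kappa>c: "continuous_on UNIV (\<lambda>x. \<kappa> * dnls_q_rhs (q t) x)" "continuous_on UNIV (\<lambda>x. \<kappa> * dnls_r_rhs (q t) x)"
      by (intro continuous_intros cd crd)+
    note dq = schwartz_has_vector_derivative[OF schwartz_q[OF t]] schwartz_has_vector_derivative[OF schwartz_dx[OF schwartz_q[OF t]]]
      and dr = schwartz_rfun_derivatives(1,2)[OF schwartz_q[OF t]]
    have "((\<lambda>\<tau>. a \<tau> x) has_vector_derivative va x) (at t within I)"
    proof (rule riccati_time_derivative[OF \<nu> t, where Q = "\<lambda>\<tau> x. \<kappa> * q \<tau> x" and R = "\<lambda>\<tau> x. \<kappa> * rfun (q \<tau>) x"
          and Qt = "\<lambda>x. \<kappa> * dnls_q_rhs (q t) x" and Rt = "\<lambda>x. \<kappa> * dnls_r_rhs (q t) x" and P = "cmod \<kappa> * P"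
          and \<eta> = "\<lambda>\<tau>. cmod \<kappa> * \<eta> \<tau>"])
      show "(a \<tau> has_vector_derivative (complex_of_real (2 * \<nu>) * a \<tau> x + \<kappa> * rfun (q \<tau>) x - \<kappa> * q \<tau> x * (a \<tau> x)\<^sup>2)) (at x)"
        if "\<tau> \<in> I" for \<tau> x unfolding two_nu[OF \<kappa>] by (rule oa[OF that])
      show "(va has_vector_derivative ((complex_of_real (2 * \<nu>) - 2 * (\<kappa> * q t x) * a t x) * va x
          + \<kappa> * dnls_r_rhs (q t) x - \<kappa> * dnls_q_rhs (q t) x * (a t x)\<^sup>2)) (at x)" for x
        unfolding two_nu[OF \<kappa>] va_def[abs_def] lax12_def lax21_def lax22_def dnls_q_rhs_def dnls_r_rhs_def
        by (rule lax_riccati_compatibility[OF _ dq dr oa[OF t]]) simp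
      show "bounded (range va)"
        unfolding va_def lax12_def lax21_def lax22_def power2_eq_square by (intro bintros)
    qed ((rule sp bd \<kappa>\<eta> \<kappa>q \<kappa>r \<kappa>P \<kappa>c | assumption)+)
    moreover have "((\<lambda>\<tau>. b \<tau> x) has_vector_derivative vb x) (at t within I)"
    proof (rule riccati_time_derivative[where \<nu> = "- \<nu>", OF _ t, where Q = "\<lambda>\<tau> x. \<kappa> * rfun (q \<tau>) x" and R = "\<lambda>\<tau> x. \<kappa> * q \<tau> x"
          and Qt = "\<lambda>x. \<kappa> * dnls_r_rhs (q t) x" and Rt = "\<lambda>x. \<kappa> * dnls_q_rhs (q t) x" and P = "cmod \<kappa> * P"
          and \<eta> = "\<lambda>\<tau>. cmod \<kappa> * \<eta> \<tau>"])
      show "(b \<tau> has_vector_derivative (complex_of_real (2 * - \<nu>) * b \<tau> x + \<kappa> * q \<tau> x - \<kappa> * rfun (q \<tau>) x * (b \<tau> x)\<^sup>2)) (at x)"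
        if "\<tau> \<in> I" for \<tau> x unfolding two_nu[OF \<kappa>] by (rule ob[OF that])
      have ob': "(b t has_vector_derivative (2 * (- \<i>) * \<kappa>\<^sup>2 * b t x + \<kappa> * q t x - \<kappa> * rfun (q t) x * (b t x)\<^sup>2)) (at x)" for x
        using ob[OF t, of x] by simp
      have ii: "(- \<i>) * (- \<i>) = - 1" by simp
      show "(vb has_vector_derivative ((complex_of_real (2 * - \<nu>) - 2 * (\<kappa> * rfun (q t) x) * b t x) * vb x
          + \<kappa> * dnls_q_rhs (q t) x - \<kappa> * dnls_r_rhs (q t) x * (b t x)\<^sup>2)) (at x)" for x
        unfolding two_nu[OF \<kappa>] vb_def[abs_def] lax12_def lax21_def lax22_def dnls_q_rhs_def dnls_r_rhs_def
        using lax_riccati_compatibility[OF ii dr dq ob'] by (simp add: algebra_simps)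
      show "bounded (range vb)"
        unfolding vb_def lax12_def lax21_def lax22_def power2_eq_square by (intro bintros)
    next
      show "- \<nu> \<noteq> 0" using \<nu> by simp
    qed ((rule sp[folded small_potential_uminus[of \<nu>]] bd \<kappa>\<eta> \<kappa>q \<kappa>r \<kappa>P \<kappa>c | assumption)+)
    ultimately show ?thesis ..
  qed
  show ?A ?B
    using both by (simp_all add: va_def vb_def)
qed

lemma riccati_space:
  assumes "t \<in> I"
  shows "(a t has_vector_derivative (2 * \<i> * \<kappa>\<^sup>2 * a t x + \<kappa> * rfun (q t) x - \<kappa> * q t x * (a t x)\<^sup>2)) (at x)"
    "(b t has_vector_derivative (- 2 * \<i> * \<kappa>\<^sup>2 * b t x + \<kappa> * q t x - \<kappa> * rfun (q t) x * (b t x)\<^sup>2)) (at x)"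
  using riccati[OF assms] by (auto simp: riccati_pair_def)

text \<open>
  Derivatives of \<open>g\<^sub>1\<^sub>2\<close>, \<open>g\<^sub>2\<^sub>1\<close> and \<open>\<gamma>\<close> come with the denominator \<open>(1 - ab)\<^sup>2\<close>; in each case one
  factor \<open>1 - ab\<close> cancels, which is what makes the evolution equations linear in the Green's
  function.
\<close>
lemma quotient_by_det_square:
  assumes "t \<in> I" and "f = g * (1 - a t x * b t x)"
  shows "f / (1 - a t x * b t x)\<^sup>2 = g / (1 - a t x * b t x)"
  using assms(2) det[OF assms(1), of x] by (simp add: power2_eq_square)

lemma g12_evolution:
  assumes t: "t \<in> I"
  shows "((\<lambda>\<tau>. g12 \<kappa> (q \<tau>) x) has_vector_derivative
      (- 2 * lax22 \<kappa> (q t) x * g12 \<kappa> (q t) x - lax12 \<kappa> (q t) x * (gam \<kappa> (q t) x + 1))) (at t within I)"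
proof (rule has_vector_derivative_transform[OF t green(4)])
  define \<Delta> where "\<Delta> = 1 - a t x * b t x"
  have \<Delta>: "\<Delta> \<noteq> 0" using det[OF t] by (simp add: \<Delta>_def)
  show "((\<lambda>\<tau>. - b \<tau> x / (1 - a \<tau> x * b \<tau> x)) has_vector_derivative
      (- 2 * lax22 \<kappa> (q t) x * g12 \<kappa> (q t) x - lax12 \<kappa> (q t) x * (gam \<kappa> (q t) x + 1))) (at t within I)"
  proof (rule has_vector_derivative_eq_rhs[OF has_vector_derivative_over_det(2)[OF riccati_time[OF t] det[OF t]]],
      rule trans[OF quotient_by_det_square[OF t]])
    show "- (lax12 \<kappa> (q t) x - 2 * lax22 \<kappa> (q t) x * b t x - lax21 \<kappa> (q t) x * (b t x)\<^sup>2
          + (b t x)\<^sup>2 * (lax21 \<kappa> (q t) x + 2 * lax22 \<kappa> (q t) x * a t x - lax12 \<kappa> (q t) x * (a t x)\<^sup>2))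
        = (2 * lax22 \<kappa> (q t) x * b t x - lax12 \<kappa> (q t) x * (1 + a t x * b t x)) * (1 - a t x * b t x)"
      by (simp add: algebra_simps power2_eq_square)
    show "(2 * lax22 \<kappa> (q t) x * b t x - lax12 \<kappa> (q t) x * (1 + a t x * b t x)) / (1 - a t x * b t x)
        = - 2 * lax22 \<kappa> (q t) x * g12 \<kappa> (q t) x - lax12 \<kappa> (q t) x * (gam \<kappa> (q t) x + 1)"
      unfolding green(4,7)[OF t t] \<Delta>_def[symmetric] using \<Delta> by (simp add: field_simps)
  qed
qed

lemma g21_evolution:
  assumes t: "t \<in> I"
  shows "((\<lambda>\<tau>. g21 \<kappa> (q \<tau>) x) has_vector_derivative
      (2 * lax22 \<kappa> (q t) x * g21 \<kappa> (q t) x + lax21 \<kappa> (q t) x * (gam \<kappa> (q t) x + 1))) (at t within I)"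
proof (rule has_vector_derivative_transform[OF t green(5)])
  define \<Delta> where "\<Delta> = 1 - a t x * b t x"
  have \<Delta>: "\<Delta> \<noteq> 0" using det[OF t] by (simp add: \<Delta>_def)
  show "((\<lambda>\<tau>. a \<tau> x / (1 - a \<tau> x * b \<tau> x)) has_vector_derivative
      (2 * lax22 \<kappa> (q t) x * g21 \<kappa> (q t) x + lax21 \<kappa> (q t) x * (gam \<kappa> (q t) x + 1))) (at t within I)"
  proof (rule has_vector_derivative_eq_rhs[OF has_vector_derivative_over_det(1)[OF riccati_time[OF t] det[OF t]]],
      rule trans[OF quotient_by_det_square[OF t]])
    show "lax21 \<kappa> (q t) x + 2 * lax22 \<kappa> (q t) x * a t x - lax12 \<kappa> (q t) x * (a t x)\<^sup>2
          + (a t x)\<^sup>2 * (lax12 \<kappa> (q t) x - 2 * lax22 \<kappa> (q t) x * b t x - lax21 \<kappa> (q t) x * (b t x)\<^sup>2)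
        = (2 * lax22 \<kappa> (q t) x * a t x + lax21 \<kappa> (q t) x * (1 + a t x * b t x)) * (1 - a t x * b t x)"
      by (simp add: algebra_simps power2_eq_square)
    show "(2 * lax22 \<kappa> (q t) x * a t x + lax21 \<kappa> (q t) x * (1 + a t x * b t x)) / (1 - a t x * b t x)
        = 2 * lax22 \<kappa> (q t) x * g21 \<kappa> (q t) x + lax21 \<kappa> (q t) x * (gam \<kappa> (q t) x + 1)"
      unfolding green(5,7)[OF t t] \<Delta>_def[symmetric] using \<Delta> by (simp add: field_simps)
  qed
qed

lemma gam_space_derivative:
  assumes t: "t \<in> I"
  shows "(gam \<kappa> (q t) has_vector_derivative
      2 * \<kappa> * (rfun (q t) x * b t x + q t x * a t x) / (1 - a t x * b t x)) (at x)"
proof (rule has_vector_derivative_transform[OF UNIV_I green(3)[OF t t]])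
  show "((\<lambda>x. 2 * a t x * b t x / (1 - a t x * b t x)) has_vector_derivative
      2 * \<kappa> * (rfun (q t) x * b t x + q t x * a t x) / (1 - a t x * b t x)) (at x)"
    by (rule has_vector_derivative_eq_rhs[OF has_vector_derivative_over_det(3)[OF riccati_space[OF t] det[OF t]]],
        rule quotient_by_det_square[OF t]) (simp add: algebra_simps power2_eq_square)
qed

lemma gam_evolution:
  assumes t: "t \<in> I"
  shows "((\<lambda>\<tau>. gam \<kappa> (q \<tau>) x) has_vector_derivative
      (2 * \<kappa>\<^sup>2 * dx (gam \<kappa> (q t)) x
       + 2 * \<i> * \<kappa> * (dx (q t) x * g21 \<kappa> (q t) x + dx (rfun (q t)) x * g12 \<kappa> (q t) x)
       + q t x * rfun (q t) x * dx (gam \<kappa> (q t)) x)) (at t within I)" (is "(_ has_vector_derivative ?R) _")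
proof (rule has_vector_derivative_transform[OF t green(3)])
  have dg: "dx (gam \<kappa> (q t)) x = 2 * \<kappa> * (rfun (q t) x * b t x + q t x * a t x) / (1 - a t x * b t x)"
    by (rule dx_eqI[OF gam_space_derivative[OF t]])
  have "2 * (lax21 \<kappa> (q t) x * b t x + lax12 \<kappa> (q t) x * a t x)
      = 2 * \<kappa>\<^sup>2 * (2 * \<kappa> * (rfun (q t) x * b t x + q t x * a t x))
      + 2 * \<i> * \<kappa> * (dx (q t) x * a t x + dx (rfun (q t)) x * - b t x)
      + q t x * rfun (q t) x * (2 * \<kappa> * (rfun (q t) x * b t x + q t x * a t x))"
    by (simp add: lax12_def lax21_def algebra_simps power2_eq_square power3_eq_cube)
  then have R: "2 * (lax21 \<kappa> (q t) x * b t x + lax12 \<kappa> (q t) x * a t x) / (1 - a t x * b t x) = ?R"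
    unfolding dg green(4,5)[OF t t] by (simp add: add_divide_distrib diff_divide_distrib right_diff_distrib)
  show "((\<lambda>\<tau>. 2 * a \<tau> x * b \<tau> x / (1 - a \<tau> x * b \<tau> x)) has_vector_derivative ?R) (at t within I)"
    by (rule has_vector_derivative_eq_rhs[OF has_vector_derivative_over_det(3)[OF riccati_time[OF t] det[OF t]]],
        rule trans[OF quotient_by_det_square[OF t] R]) (simp add: algebra_simps power2_eq_square)
qed

lemma microscopic_conservation_law:
  assumes t: "t \<in> I"
  shows "\<exists>\<rho>t jx. ((\<lambda>\<tau>. rho \<kappa> (q \<tau>) x) has_vector_derivative \<rho>t) (at t within I) \<and>
             (j_DNLS \<kappa> (q t) has_vector_derivative jx) (at x) \<and> \<rho>t + jx = 0"
proof (intro exI conjI)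
  note q = schwartz_has_vector_derivative[OF schwartz_q[OF t]] schwartz_has_vector_derivative[OF schwartz_dx[OF schwartz_q[OF t]]]
  note r = schwartz_rfun_derivatives(1,2)[OF schwartz_q[OF t]]
  note qt = DNLS_time_derivative[OF schwartz_q[OF t] DNLS t]
  note m = has_vector_derivative_mult and s = has_vector_derivative_diff and c = has_vector_derivative_mult_right
  show "((\<lambda>\<tau>. rho \<kappa> (q \<tau>) x) has_vector_derivative
      - (\<kappa> / 2) * (q t x * (lax21 \<kappa> (q t) x + 2 * lax22 \<kappa> (q t) x * a t x - lax12 \<kappa> (q t) x * (a t x)\<^sup>2)
          + dnls_q_rhs (q t) x * a t x
        - (rfun (q t) x * (lax12 \<kappa> (q t) x - 2 * lax22 \<kappa> (q t) x * b t x - lax21 \<kappa> (q t) x * (b t x)\<^sup>2)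
          + dnls_r_rhs (q t) x * b t x))) (at t within I)"
    by (rule has_vector_derivative_transform[OF t green(8)],
        assumption, assumption, rule c[OF s[OF m[OF qt(1) riccati_time(1)[OF t]] m[OF qt(2) riccati_time(2)[OF t]]]])
  show "(j_DNLS \<kappa> (q t) has_vector_derivative
      (\<i> * \<kappa> / 2 * (dx (q t) x * (2 * \<i> * \<kappa>\<^sup>2 * a t x + \<kappa> * rfun (q t) x - \<kappa> * q t x * (a t x)\<^sup>2) + dx (dx (q t)) x * a t x
            + (dx (rfun (q t)) x * (- 2 * \<i> * \<kappa>\<^sup>2 * b t x + \<kappa> * q t x - \<kappa> * rfun (q t) x * (b t x)\<^sup>2) + dx (dx (rfun (q t))) x * b t x))
        - \<i> * \<kappa>\<^sup>2 * (q t x * dx (rfun (q t)) x + dx (q t) x * rfun (q t) x)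
        + ((2 * \<kappa>\<^sup>2 + q t x * rfun (q t) x) * (\<kappa> / 2 * (q t x * (2 * \<i> * \<kappa>\<^sup>2 * a t x + \<kappa> * rfun (q t) x - \<kappa> * q t x * (a t x)\<^sup>2) + dx (q t) x * a t x
              - (rfun (q t) x * (- 2 * \<i> * \<kappa>\<^sup>2 * b t x + \<kappa> * q t x - \<kappa> * rfun (q t) x * (b t x)\<^sup>2) + dx (rfun (q t)) x * b t x)))
          + (0 + (q t x * dx (rfun (q t)) x + dx (q t) x * rfun (q t) x))
            * (\<kappa> / 2 * (q t x * a t x - rfun (q t) x * b t x))))) (at x)"
    by (rule has_vector_derivative_transform[OF UNIV_I green(9)[OF t t]],
        rule has_vector_derivative_add[OF s[OF
          c[OF has_vector_derivative_add[OF m[OF q(2) riccati_space(1)[OF t]] m[OF r(2) riccati_space(2)[OF t]]]]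
          c[OF m[OF q(1) r(1)]]]
          m[OF has_vector_derivative_add[OF has_vector_derivative_const m[OF q(1) r(1)]]
            c[OF s[OF m[OF q(1) riccati_space(1)[OF t]] m[OF r(1) riccati_space(2)[OF t]]]]]])
qed (simp only: lax12_def lax21_def lax22_def dnls_q_rhs_def dnls_r_rhs_def conservation_identity[OF i_squared])

end

theorem theorem4p9:
  fixes s :: real
  assumes "0 < s" and "s < 1 / 2"
  shows "\<exists>\<delta>>0. \<forall>(\<kappa>::complex) (I::real set) (q :: real \<Rightarrow> real \<Rightarrow> complex).
    \<i> * \<kappa>\<^sup>2 \<in> complex_of_real ` (UNIV - {-1<..<1}) \<longrightarrow>
    is_interval I \<longrightarrow>
    C1_schwartz I q \<longrightarrow>
    (\<forall>t\<in>I. Hs_norm s (q t) \<le> \<delta>) \<longrightarrow>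
    DNLS_on I q \<longrightarrow>
    (let r = (\<lambda>t. rfun (q t));
         G12 = (\<lambda>t. g12 \<kappa> (q t));
         G21 = (\<lambda>t. g21 \<kappa> (q t));
         \<gamma> = (\<lambda>t. gam \<kappa> (q t))
     in
      \<forall>t\<in>I.
        L_invertible \<kappa> (q t) \<and> (\<exists>!D. is_green_diff \<kappa> (q t) D) \<and>
        (\<forall>x.
          ((\<lambda>\<tau>. q \<tau> x) has_vector_derivative
             (\<i> * dx (dx (q t)) x + dx (\<lambda>y. (q t y)\<^sup>2 * r t y) x)) (at t within I) \<and>
          ((\<lambda>\<tau>. r \<tau> x) has_vector_derivative
             (- \<i> * dx (dx (r t)) x + dx (\<lambda>y. q t y * (r t y)\<^sup>2) x)) (at t within I) \<and>
          ((\<lambda>\<tau>. G12 \<tau> x) has_vector_derivative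
             (- 2 * (2 * \<i> * \<kappa> ^ 4 + \<i> * \<kappa>\<^sup>2 * q t x * r t x) * G12 t x
              - (2 * \<kappa> ^ 3 * q t x + \<i> * \<kappa> * dx (q t) x + \<kappa> * (q t x)\<^sup>2 * r t x)
                * (\<gamma> t x + 1))) (at t within I) \<and>
          ((\<lambda>\<tau>. G21 \<tau> x) has_vector_derivative
             (2 * (2 * \<i> * \<kappa> ^ 4 + \<i> * \<kappa>\<^sup>2 * q t x * r t x) * G21 t x
              + (2 * \<kappa> ^ 3 * r t x - \<i> * \<kappa> * dx (r t) x + \<kappa> * q t x * (r t x)\<^sup>2)
                * (\<gamma> t x + 1))) (at t within I) \<and>
          \<gamma> t differentiable (at x) \<and>
          ((\<lambda>\<tau>. \<gamma> \<tau> x) has_vector_derivative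
             (2 * \<kappa>\<^sup>2 * dx (\<gamma> t) x
              + 2 * \<i> * \<kappa> * (dx (q t) x * G21 t x + dx (r t) x * G12 t x)
              + q t x * r t x * dx (\<gamma> t) x)) (at t within I) \<and>
          2 + \<gamma> t x \<noteq> 0 \<and>
          (\<exists>\<rho>t jx.
             ((\<lambda>\<tau>. rho \<kappa> (q \<tau>) x) has_vector_derivative \<rho>t) (at t within I) \<and>
             (j_DNLS \<kappa> (q t) has_vector_derivative jx) (at x) \<and>
             \<rho>t + jx = 0)))"
proof (intro exI[of _ "1 / 2"] conjI allI impI, goal_cases)
  case (2 \<kappa> I q)
  then obtain \<nu> where \<kappa>: "\<i> * \<kappa>\<^sup>2 = complex_of_real \<nu>" and \<nu>: "\<nu> \<noteq> 0" by auto
  have S: "schwartz (q t)" if "t \<in> I" for t using 2(3) that by (auto simp: C1_schwartz_def)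
  have "\<forall>t\<in>I. \<exists>a b. riccati_pair \<kappa> (q t) a b"
    using riccati_pair_exists[OF S assms _ \<kappa> \<nu>] 2(4) by blast
  then obtain a b where ab: "\<And>t. t \<in> I \<Longrightarrow> riccati_pair \<kappa> (q t) (a t) (b t)" by metis
  interpret small_DNLS_flow \<kappa> \<nu> s I q a b
    using \<kappa> \<nu> 2 assms ab by unfold_locales auto
  note evolution = dnls_system g12_evolution[unfolded lax12_def lax22_def]
    g21_evolution[unfolded lax21_def lax22_def] gam_evolution microscopic_conservation_law
  show ?case
    unfolding Let_def
    by (intro ballI conjI allI)
       (rule green(1) green_diff_unique evolution differentiableI_vector[OF gam_space_derivative]
          two_plus_gam_nonzero | assumption)+
qed simp

end
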